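(* Let $S$ be a finite $p$-group and $\mathcal{A}$ a divisible $S$-algebra that has all twisted units. Then for every isomorphism $\varphi:P\to Q$ of $\mathfrak{F}_S(\mathcal{A})$ we have $\mathcal{A}^\times\cap{}^\varphi\mathcal{A}^P\neq\emptyset$.
   Context: $\mathcal{O}$ is a complete local noetherian domain with maximal ideal $\mathfrak{m}$ and algebraically closed residue field of characteristic $p$. An interior $S$-algebra is an $\mathcal{O}$-free finite-rank $\mathcal{O}$-algebra $\mathcal{A}$ with group homomorphism $S\to\mathcal{A}^\times$; it is bifree if it has an $\mathcal{O}$-basis $Y$ with $sY=Y=Ys$ ($s\in S$) on which left and right actions are free. For $P\le S$ and injective $\varphi:P\to S$, ${}^\varphi\mathcal{A}^P=\{a\in\mathcal{A}:\varphi(p)a=ap\ \forall p\in P\}$, and $\mathcal{A}(\varphi)$ is the Brauer quotient ${}^\varphi\mathcal{A}^P/(\mathfrak{m}\,{}^\varphi\mathcal{A}^P+\sum_{V<\Delta}\mathrm{tr}_V^\Delta\mathcal{A}^V)$, $\Delta=\Delta(\varphi,P)=\{(\varphi(p),p)\}\le S\times S$ acting by $(s,t)a=sat^{-1}$; $\mathcal{A}(P)=\mathcal{A}(\iota_P)$. $\mathfrak{F}_S(\mathcal{A})$: objects subgroups of $S$, $\mathrm{Hom}(P,Q)=\{\varphi:P\to Q$ injective$:\mathcal{A}(\varphi)\ne0\}$. $\mathcal{A}$ is divisible if it is bifree and $\mathfrak{F}_S(\mathcal{A})$ contains all inclusions, is closed under composition, and each morphism is an inclusion composed with an isomorphism of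 $\mathfrak{F}_S(\mathcal{A})$. For an isomorphism $\varphi:P\to Q$ of $\mathfrak{F}_S(\mathcal{A})$, a twisted unit is $u\in\mathcal{A}(\varphi)$ with some $u^\dagger\in\mathcal{A}(\varphi^{-1})$ satisfying $u^\dagger u=1_{\mathcal{A}(P)}$ (products computed via $\mathrm{br}_\psi(a)\mathrm{br}_\varphi(c)=\mathrm{br}_{\psi\varphi}(ac)$); $\mathcal{A}$ has all twisted units if every isomorphism of $\mathfrak{F}_S(\mathcal{A})$ has one. *)

theory Defs
  imports "HOL-Algebra.Coset" "HOL-Computational_Algebra.Primes"
begin

definition ideal_in :: "'o::comm_ring_1 set \<Rightarrow> bool" where
  "ideal_in I \<longleftrightarrow> 0 \<in> I \<and> (\<forall>x\<in>I. \<forall>y\<in>I. x + y \<in> I) \<and> (\<forall>r. \<forall>x\<in>I. r * x \<in> I)"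

definition fin_gen_ideal :: "'o::comm_ring_1 set \<Rightarrow> bool" where
  "fin_gen_ideal I \<longleftrightarrow> (\<exists>F. finite F \<and> F \<subseteq> I \<and> I = {y. \<exists>c. y = (\<Sum>x\<in>F. c x * x)})"

fun ideal_pow :: "'o::comm_ring_1 set \<Rightarrow> nat \<Rightarrow> 'o set" where
  "ideal_pow m 0 = UNIV"
| "ideal_pow m (Suc n) =
     {y. \<exists>F. finite F \<and> F \<subseteq> m \<times> ideal_pow m n \<and> y = (\<Sum>(a,b)\<in>F. a * b)}"

definition cl_domain :: "nat \<Rightarrow> 'o::idom set \<Rightarrow> bool" where
  "cl_domain p m \<longleftrightarrow>
     \<comment> \<open>local with maximal ideal m\<close>
     ideal_in m \<and> (1::'o) \<notin> m \<and> (\<forall>x. x \<notin> m \<longrightarrow> (\<exists>y. x * y = 1)) \<and>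
     \<comment> \<open>noetherian\<close>
     (\<forall>I::'o set. ideal_in I \<longrightarrow> fin_gen_ideal I) \<and>
     \<comment> \<open>m-adically complete (and separated)\<close>
     (\<Inter>n. ideal_pow m n) = {0} \<and>
     (\<forall>x::nat \<Rightarrow> 'o. (\<forall>n. x (Suc n) - x n \<in> ideal_pow m n) \<longrightarrow>
         (\<exists>y. \<forall>n. y - x n \<in> ideal_pow m n)) \<and>
     \<comment> \<open>residue field algebraically closed: every monic polynomial has a root mod m\<close>
     (\<forall>n::nat. n \<ge> 1 \<longrightarrow> (\<forall>c::nat \<Rightarrow> 'o. \<exists>x. x ^ n + (\<Sum>i<n. c i * x ^ i) \<in> m)) \<and>
     \<comment> \<open>residue characteristic p\<close>
     prime p \<and> of_nat p \<in> m"

definition O_alg :: "('o::comm_ring_1 \<Rightarrow> 'a::ring_1 \<Rightarrow> 'a) \<Rightarrow> bool" where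
  "O_alg smul \<longleftrightarrow>
     (\<forall>r s a. smul (r + s) a = smul r a + smul s a) \<and>
     (\<forall>r a b. smul r (a + b) = smul r a + smul r b) \<and>
     (\<forall>r s a. smul (r * s) a = smul r (smul s a)) \<and>
     (\<forall>a. smul 1 a = a) \<and>
     (\<forall>r a b. smul r (a * b) = smul r a * b \<and> smul r (a * b) = a * smul r b)"

definition O_basis :: "('o::comm_ring_1 \<Rightarrow> 'a::ring_1 \<Rightarrow> 'a) \<Rightarrow> 'a set \<Rightarrow> bool" where
  "O_basis smul Y \<longleftrightarrow> finite Y \<and>
     (\<forall>a. \<exists>!c::'a \<Rightarrow> 'o. (\<forall>y. y \<notin> Y \<longrightarrow> c y = 0) \<and> a = (\<Sum>y\<in>Y. smul (c y) y))"

definition interior_alg ::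
  "('o::comm_ring_1 \<Rightarrow> 'a::ring_1 \<Rightarrow> 'a) \<Rightarrow> ('s, 'b) monoid_scheme \<Rightarrow> ('s \<Rightarrow> 'a) \<Rightarrow> bool" where
  "interior_alg smul G \<rho> \<longleftrightarrow> O_alg smul \<and> (\<exists>Y. O_basis smul Y) \<and>
     (\<forall>s\<in>carrier G. \<forall>t\<in>carrier G. \<rho> (s \<otimes>\<^bsub>G\<^esub> t) = \<rho> s * \<rho> t) \<and> \<rho> \<one>\<^bsub>G\<^esub> = 1"

definition bifree ::
  "('o::comm_ring_1 \<Rightarrow> 'a::ring_1 \<Rightarrow> 'a) \<Rightarrow> ('s, 'b) monoid_scheme \<Rightarrow> ('s \<Rightarrow> 'a) \<Rightarrow> bool" where
  "bifree smul G \<rho> \<longleftrightarrow> (\<exists>Y. O_basis smul Y \<and>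
     (\<forall>s\<in>carrier G. (\<lambda>y. \<rho> s * y) ` Y = Y \<and> (\<lambda>y. y * \<rho> s) ` Y = Y) \<and>
     (\<forall>s\<in>carrier G. \<forall>y\<in>Y. \<rho> s * y = y \<longrightarrow> s = \<one>\<^bsub>G\<^esub>) \<and>
     (\<forall>s\<in>carrier G. \<forall>y\<in>Y. y * \<rho> s = y \<longrightarrow> s = \<one>\<^bsub>G\<^esub>))"

definition fixpts :: "('s \<Rightarrow> 'a::ring_1) \<Rightarrow> ('s \<Rightarrow> 's) \<Rightarrow> 's set \<Rightarrow> 'a set" where
  "fixpts \<rho> \<phi> P = {a. \<forall>u\<in>P. \<rho> (\<phi> u) * a = a * \<rho> u}"

definition Delta :: "('s \<Rightarrow> 's) \<Rightarrow> 's set \<Rightarrow> ('s \<times> 's) set" where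
  "Delta \<phi> P = (\<lambda>u. (\<phi> u, u)) ` P"

definition act :: "('s, 'b) monoid_scheme \<Rightarrow> ('s \<Rightarrow> 'a::ring_1) \<Rightarrow> 's \<times> 's \<Rightarrow> 'a \<Rightarrow> 'a" where
  "act G \<rho> g a = \<rho> (fst g) * a * \<rho> (inv\<^bsub>G\<^esub> (snd g))"

definition fixV :: "('s, 'b) monoid_scheme \<Rightarrow> ('s \<Rightarrow> 'a::ring_1) \<Rightarrow> ('s \<times> 's) set \<Rightarrow> 'a set" where
  "fixV G \<rho> V = {a. \<forall>g\<in>V. act G \<rho> g a = a}"

definition rtr :: "('s, 'b) monoid_scheme \<Rightarrow> ('s \<Rightarrow> 'a::ring_1) \<Rightarrow> ('s \<times> 's) set
    \<Rightarrow> ('s \<times> 's) set \<Rightarrow> 'a \<Rightarrow> 'a" where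
  "rtr G \<rho> V D a =
     (\<Sum>C\<in>{l_coset (G \<times>\<times> G) g V | g. g \<in> D}. act G \<rho> (SOME g. g \<in> C) a)"

definition ospan :: "('o::comm_ring_1 \<Rightarrow> 'a::ring_1 \<Rightarrow> 'a) \<Rightarrow> 'a set \<Rightarrow> 'a set" where
  "ospan smul X = {y. \<exists>F c. finite F \<and> F \<subseteq> X \<and> y = (\<Sum>x\<in>F. smul (c x) x)}"

text \<open>The kernel m phi-fixed points A^P + sum_{V < Delta} tr_V^Delta A^V of the Brauer quotient.\<close>
definition brK :: "'o::comm_ring_1 set \<Rightarrow> ('o \<Rightarrow> 'a::ring_1 \<Rightarrow> 'a) \<Rightarrow> ('s, 'b) monoid_scheme
    \<Rightarrow> ('s \<Rightarrow> 'a) \<Rightarrow> ('s \<Rightarrow> 's) \<Rightarrow> 's set \<Rightarrow> 'a set" where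
  "brK m smul G \<rho> \<phi> P = ospan smul
     ({smul r a | r a. r \<in> m \<and> a \<in> fixpts \<rho> \<phi> P} \<union>
      (\<Union>V\<in>{V. subgroup V (G \<times>\<times> G) \<and> V \<subset> Delta \<phi> P}.
          rtr G \<rho> V (Delta \<phi> P) ` fixV G \<rho> V))"

definition brauer_nz :: "'o::comm_ring_1 set \<Rightarrow> ('o \<Rightarrow> 'a::ring_1 \<Rightarrow> 'a) \<Rightarrow> ('s, 'b) monoid_scheme
    \<Rightarrow> ('s \<Rightarrow> 'a) \<Rightarrow> ('s \<Rightarrow> 's) \<Rightarrow> 's set \<Rightarrow> bool" where
  "brauer_nz m smul G \<rho> \<phi> P \<longleftrightarrow> (\<exists>a\<in>fixpts \<rho> \<phi> P. a \<notin> brK m smul G \<rho> \<phi> P)"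

definition grp_inj :: "('s, 'b) monoid_scheme \<Rightarrow> ('s \<Rightarrow> 's) \<Rightarrow> 's set \<Rightarrow> 's set \<Rightarrow> bool" where
  "grp_inj G \<phi> P Q \<longleftrightarrow> (\<forall>u\<in>P. \<forall>v\<in>P. \<phi> (u \<otimes>\<^bsub>G\<^esub> v) = \<phi> u \<otimes>\<^bsub>G\<^esub> \<phi> v) \<and>
     inj_on \<phi> P \<and> \<phi> ` P \<subseteq> Q"

definition Fmor :: "'o::comm_ring_1 set \<Rightarrow> ('o \<Rightarrow> 'a::ring_1 \<Rightarrow> 'a) \<Rightarrow> ('s, 'b) monoid_scheme
    \<Rightarrow> ('s \<Rightarrow> 'a) \<Rightarrow> ('s \<Rightarrow> 's) \<Rightarrow> 's set \<Rightarrow> 's set \<Rightarrow> bool" where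
  "Fmor m smul G \<rho> \<phi> P Q \<longleftrightarrow> subgroup P G \<and> subgroup Q G \<and> grp_inj G \<phi> P Q \<and>
     brauer_nz m smul G \<rho> \<phi> P"

definition Fiso :: "'o::comm_ring_1 set \<Rightarrow> ('o \<Rightarrow> 'a::ring_1 \<Rightarrow> 'a) \<Rightarrow> ('s, 'b) monoid_scheme
    \<Rightarrow> ('s \<Rightarrow> 'a) \<Rightarrow> ('s \<Rightarrow> 's) \<Rightarrow> 's set \<Rightarrow> 's set \<Rightarrow> bool" where
  "Fiso m smul G \<rho> \<phi> P Q \<longleftrightarrow> Fmor m smul G \<rho> \<phi> P Q \<and> \<phi> ` P = Q \<and>
     Fmor m smul G \<rho> (inv_into P \<phi>) Q P"

definition divisible :: "'o::comm_ring_1 set \<Rightarrow> ('o \<Rightarrow> 'a::ring_1 \<Rightarrow> 'a) \<Rightarrow> ('s, 'b) monoid_scheme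
    \<Rightarrow> ('s \<Rightarrow> 'a) \<Rightarrow> bool" where
  "divisible m smul G \<rho> \<longleftrightarrow> bifree smul G \<rho> \<and>
     (\<forall>P Q. subgroup P G \<and> subgroup Q G \<and> P \<subseteq> Q \<longrightarrow> Fmor m smul G \<rho> (\<lambda>u. u) P Q) \<and>
     (\<forall>\<phi> \<psi> P Q R. Fmor m smul G \<rho> \<phi> P Q \<and> Fmor m smul G \<rho> \<psi> Q R \<longrightarrow>
        Fmor m smul G \<rho> (\<psi> \<circ> \<phi>) P R) \<and>
     (\<forall>\<phi> P Q. Fmor m smul G \<rho> \<phi> P Q \<longrightarrow>
        (\<exists>\<psi> R. Fiso m smul G \<rho> \<psi> P R \<and> R \<subseteq> Q \<and> (\<forall>u\<in>P. \<phi> u = \<psi> u)))"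

text \<open>Twisted unit for an isomorphism \<phi>: P -> Q: classes u = br(a) in A(\<phi>), u' = br(b) in
  A(\<phi>^{-1}) with u'u = br(ba) = 1 in A(P).\<close>
definition has_twisted_unit :: "'o::comm_ring_1 set \<Rightarrow> ('o \<Rightarrow> 'a::ring_1 \<Rightarrow> 'a)
    \<Rightarrow> ('s, 'b) monoid_scheme \<Rightarrow> ('s \<Rightarrow> 'a) \<Rightarrow> ('s \<Rightarrow> 's) \<Rightarrow> 's set \<Rightarrow> 's set \<Rightarrow> bool" where
  "has_twisted_unit m smul G \<rho> \<phi> P Q \<longleftrightarrow>
     (\<exists>a\<in>fixpts \<rho> \<phi> P. \<exists>b\<in>fixpts \<rho> (inv_into P \<phi>) Q.
        b * a - 1 \<in> brK m smul G \<rho> (\<lambda>u. u) P)"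

definition all_twisted_units :: "'o::comm_ring_1 set \<Rightarrow> ('o \<Rightarrow> 'a::ring_1 \<Rightarrow> 'a)
    \<Rightarrow> ('s, 'b) monoid_scheme \<Rightarrow> ('s \<Rightarrow> 'a) \<Rightarrow> bool" where
  "all_twisted_units m smul G \<rho> \<longleftrightarrow>
     (\<forall>\<phi> P Q. Fiso m smul G \<rho> \<phi> P Q \<longrightarrow> has_twisted_unit m smul G \<rho> \<phi> P Q)"

definition unit_of :: "'a::ring_1 \<Rightarrow> bool" where
  "unit_of a \<longleftrightarrow> (\<exists>b. a * b = 1 \<and> b * a = 1)"

end

theory Submission
  imports Defs "HOL.Modules" "HOL-Algebra.Group_Action" "HOL-Algebra.Zassenhaus"
    "HOL-Algebra.Multiplicative_Group"
begin

text \<open>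
  Write \<open>\<alpha> = \<rho>\<close> and \<open>\<beta> = \<rho> \<circ> \<phi>\<close> for the two maps from \<open>P\<close> to the units of \<open>A\<close>. The elements of \<open>A\<close> that
  intertwine them are the morphisms \<open>A \<rightarrow> A\<close> of \<open>(P, A)\<close>-bimodules for the two left actions, and a unit
  among them is an isomorphism. By induction on \<open>|P|\<close> there are intertwining units over every proper
  subgroup of \<open>P\<close>. Everything happens modulo \<open>mA\<close>, which lies in the radical.

  Take a maximal partial isomorphism \<open>(h, h')\<close> modulo \<open>mA\<close>, with idempotents \<open>e = h' h\<close> and \<open>f = h h'\<close>.
  If \<open>h\<close> is not a unit, some maximal left ideal \<open>N\<close> of the \<open>P\<close>-fixed points contains \<open>e\<close> (or \<open>f\<close>, on the
  other side); choose one whose vertex, a minimal \<open>V\<close> with \<open>tr\<^sub>V\<^sup>P(A\<^sup>V)\<close> not inside \<open>N\<close>, is as large as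
  possible. A twisted unit (if \<open>V = P\<close>) or a unit over a maximal subgroup \<open>H\<close> containing \<open>V\<close> yields, by a
  finite length argument, \<open>H\<close>-fixed morphisms \<open>c, b\<close> with \<open>tr(c (1 - f) b)\<close> outside \<open>N\<close>. Maximality of the
  vertex shows that \<open>1 - f\<close> acts like a trace from \<open>H\<close>, and as the \<open>p\<close>-group \<open>P/H\<close> has fixed vectors on
  nonzero \<open>p\<close>-torsion modules, \<open>c\<close> and \<open>b\<close> can be replaced by \<open>P\<close>-fixed ones. A power of \<open>c (1 - f) b\<close>
  then gives an idempotent by which \<open>(h, h')\<close> can be enlarged, a contradiction.
\<close>

section \<open>Maximal subgroups of finite p-groups\<close>

text \<open>Neither kind of data suffices alone: a twisted unit is invertible only modulo traces
  from proper subgroups, and a unit given by the induction commutes only with a proper subgroup. The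
  vertex decides which of the two is used at a given simple quotient of the fixed points. It must be
  the largest on both sides together: for a subgroup \<open>V\<close> outside \<open>H\<close>,
  Mackey's formula leads to traces from \<open>V \<inter> H\<close>, and these are known to lie in
  \<open>N\<close> when \<open>V\<close> is no larger than the vertex of \<open>N\<close>. The
  largest vertex may occur on the side of either \<alpha> or \<beta>, so twisted units for both
  \<phi> and its inverse enter.

  The argument replaces a comparison of multiplicities in Krull-Schmidt decompositions: isomorphic
  summands are matched one after another, idempotents live only modulo \<open>mA\<close>, and the
  process stops because the left ideals \<open>A h' h + mA\<close> grow strictly.\<close>

lemma (in group_action) card_fixed_points_mod:
  assumes "prime p" "finite E" "finite (carrier G)" "order G = p ^ k"
  shows "card E mod p = card {x \<in> E. \<forall>g \<in> carrier G. \<phi> g x = x} mod p"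
proof -
  define F where "F = {x \<in> E. \<forall>g \<in> carrier G. \<phi> g x = x}"
  define O1 where "O1 = {X \<in> orbits G E \<phi>. card X = 1}"
  define O2 where "O2 = {X \<in> orbits G E \<phi>. card X \<noteq> 1}"
  interpret grp: group G using group_hom group_hom.axioms(1) by blast
  have part: "partition E (orbits G E \<phi>)" by (rule orbit_partition)
  have U: "\<Union>(orbits G E \<phi>) = E"
    using partition.partition_coverture[OF part] by simp
  have fin: "finite (orbits G E \<phi>)" using U assms(2) finite_UnionD by metis
  have finX: "finite X" if "X \<in> orbits G E \<phi>" for X
    using that U assms(2) by (metis Sup_upper finite_subset)
  have disj: "X \<inter> Y = {}"
    if "X \<in> orbits G E \<phi>" "Y \<in> orbits G E \<phi>" "X \<noteq> Y" for X Y
    using that partition.unique_class[OF part] U by blast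
  have "card E = sum card (orbits G E \<phi>)"
    using card_Union_disjoint[of "orbits G E \<phi>"] U finX disj
      by (auto simp: pairwise_def disjnt_def)
  also have "\<dots> = sum card O1 + sum card O2"
  proof -
    have "orbits G E \<phi> = O1 \<union> O2" "O1 \<inter> O2 = {}" unfolding O1_def O2_def by auto
    then show ?thesis using fin by (metis finite_Un sum.union_disjoint)
  qed
  also have "sum card O1 = card F"
  proof -
    have "orbit G \<phi> x = {x}" if "x \<in> F" for x
      using that unfolding F_def orbit_def by (auto intro!: exI[of _ "\<one>"])
    then have "O1 = (\<lambda>x. {x}) ` F"
    proof -
      assume *: "\<And>x. x \<in> F \<Longrightarrow> orbit G \<phi> x = {x}"
      have "X \<in> (\<lambda>x. {x}) ` F" if "X \<in> O1" for X
      proof -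
        from that obtain x where x: "x \<in> E" "X = orbit G \<phi> x" "card X = 1"
          unfolding O1_def orbits_def by auto
        have "x \<in> X" using orbit_refl x by blast
        then have X: "X = {x}" using x(3) by (metis card_1_singletonE singletonD)
        have "\<phi> g x = x" if "g \<in> carrier G" for g
          using that x X unfolding orbit_def by auto
        then show ?thesis using X x unfolding F_def by auto
      qed
      moreover have "{x} \<in> O1" if "x \<in> F" for x
        using *[OF that] that unfolding O1_def orbits_def F_def
        by (auto intro!: exI[of _ x])
      ultimately show ?thesis by blast
    qed
    then have "sum card O1 = sum (card \<circ> (\<lambda>x. {x})) F"
      by (simp add: sum.reindex)
    then show ?thesis by simp
  qed
  finally have eq: "card E = card F + sum card O2" .
  \<comment> \<open>Orbit lengths divide \<open>p ^ k\<close>, so every orbit that is not a single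
    point has length divisible by p.\<close>
  have "p dvd sum card O2"
  proof (rule dvd_sum)
    fix X assume "X \<in> O2"
    then obtain x where x: "x \<in> E" "X = orbit G \<phi> x" "card X \<noteq> 1"
      unfolding O2_def orbits_def by auto
    have "card X dvd p ^ k"
      using orbit_stabilizer_theorem[OF x(1)] x(2) assms(4) by (metis dvd_triv_left)
    then show "p dvd card X" using x(3) assms(1)
      by (metis divides_primepow_nat dvd_power gr0I power_0)
  qed
  then obtain c where "sum card O2 = p * c" by (rule dvdE)
  then show ?thesis using eq unfolding F_def by simp
qed

text \<open>The inverse turns right multiplication into a left action, and the restriction to
  \<open>rcosets H\<close> makes the maps extensional, as \<open>Bij\<close> demands. A coset Hg is
  fixed exactly when g conjugates H into itself.\<close>

lemma (in group) r_coset_mult_action: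
  assumes "subgroup H G"
  shows "group_action (G\<lparr>carrier := H\<rparr>) (rcosets H) (\<lambda>h. \<lambda>C
    \<in> rcosets H. C #> inv h)"
proof -
  have HG: "group (G\<lparr>carrier := H\<rparr>)" using assms subgroup_imp_group by blast
  have sub: "C \<subseteq> carrier G" if "C \<in> rcosets H" for C
    using that assms by (meson rcosets_part_G subgroup.rcosets_carrier group_axioms)
  have Hc: "h \<in> carrier G" if "h \<in> H" for h using that assms subgroup.mem_carrier by metis
  have cl: "C #> g \<in> rcosets H" if C: "C \<in> rcosets H" and g: "g \<in> carrier G" for C g
  proof -
    from C obtain x where x: "x \<in> carrier G" "C = H #> x" unfolding RCOSETS_def by blast
    then have "C #> g = H #> (x \<otimes> g)" using g assms coset_mult_assoc subgroup.subset
      by blast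
    then show ?thesis using x g unfolding RCOSETS_def by auto
  qed
  have bij: "(\<lambda>C \<in> rcosets H. C #> inv h) \<in> Bij (rcosets H)" if h: "h \<in> H" for h
  proof -
    have "bij_betw (\<lambda>C. C #> inv h) (rcosets H) (rcosets H)"
      by (rule bij_betw_byWitness[of _ "\<lambda>C. C #> h"])
         (use h Hc cl sub in \<open>auto simp: coset_mult_assoc coset_mult_one\<close>)
    then show ?thesis unfolding Bij_def by auto
  qed
  have hom: "(\<lambda>h. \<lambda>C \<in> rcosets H. C #> inv h)
    \<in> hom (G\<lparr>carrier := H\<rparr>) (BijGroup (rcosets H))"
  proof (rule homI)
    fix x y assume "x \<in> carrier (G\<lparr>carrier := H\<rparr>)" "y
      \<in> carrier (G\<lparr>carrier := H\<rparr>)"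
    then have xy: "x \<in> H" "y \<in> H" by auto
    have "(\<lambda>C\<in>rcosets H. C #> inv (x \<otimes> y))
      = compose (rcosets H) (\<lambda>C\<in>rcosets H. C #> inv x) (\<lambda>C\<in>rcosets H. C #>
        inv y)"
    proof
      fix C
      have "C #> inv (x \<otimes> y) = C #> inv y #> inv x" if "C \<in> rcosets H"
        using xy Hc sub[OF that] by (simp add: coset_mult_assoc inv_mult_group)
      then show "(\<lambda>C\<in>rcosets H. C #> inv (x \<otimes> y)) C =
          compose (rcosets H) (\<lambda>C\<in>rcosets H. C #> inv x) (\<lambda>C\<in>rcosets H. C #>
            inv y) C"
        using cl[of C "inv y"] xy Hc unfolding compose_def by simp
    qed
    then show "(\<lambda>C\<in>rcosets H. C #> inv (x \<otimes>\<^bsub>G\<lparr>carrier :=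
      H\<rparr>\<^esub> y)) =
      (\<lambda>C\<in>rcosets H. C #> inv x) \<otimes>\<^bsub>BijGroup (rcosets H)\<^esub>
        (\<lambda>C\<in>rcosets H. C #> inv y)"
      using bij xy by (simp add: BijGroup_def)
  qed (use bij in \<open>auto simp: BijGroup_def\<close>)
  show ?thesis
    using HG group_BijGroup hom unfolding group_action_def group_hom_def group_hom_axioms_def
      by blast
qed

text \<open>The number of cosets of H is divisible by p, hence so is the number of cosets fixed by
  H. As H itself is one of these, there is a second one, Hg, and g lies in the normalizer.\<close>

lemma (in group) p_group_normalizer_grows:
  assumes p: "prime p" and ord: "order G = p ^ n" and fin: "finite (carrier G)"
    and H: "subgroup H G" and ne: "H \<noteq> carrier G"
  shows "\<exists>g \<in> carrier G - H. \<forall>h \<in> H. g \<otimes> h \<otimes> inv g \<in> H"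
proof -
  let ?\<phi> = "\<lambda>h. \<lambda>C \<in> rcosets H. C #> inv h"
  interpret A: group_action "G\<lparr>carrier := H\<rparr>" "rcosets H" ?\<phi>
    by (rule r_coset_mult_action[OF H])
  interpret H: subgroup H G by (rule H)
  have finH: "finite H" using fin H.subset finite_subset by blast
  have finE: "finite (rcosets H)" using fin unfolding RCOSETS_def by simp
  have lag: "card (rcosets H) * card H = p ^ n" using lagrange[OF H] ord by simp
  then obtain k where k: "card H = p ^ k" using p by (metis divides_primepow_nat dvd_triv_right)
  obtain j where j: "card (rcosets H) = p ^ j" using lag p
    by (metis divides_primepow_nat dvd_triv_left)
  define F where "F = {C \<in> rcosets H. \<forall>h \<in> H. C #> inv h = C}"
  have "j \<noteq> 0"
  proof
    assume "j = 0"
    then have "card H = order G" using lag j ord by simp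
    then show False using ne fin H.subset card_subset_eq unfolding order_def by blast
  qed
  then have pE: "p dvd card (rcosets H)" using j by simp
  have "F = {C \<in> rcosets H. \<forall>h
    \<in> carrier (G\<lparr>carrier := H\<rparr>). ?\<phi> h C = C}"
    unfolding F_def by auto
  then have "card (rcosets H) mod p = card F mod p"
    using A.card_fixed_points_mod[OF p finE, of k] finH k unfolding order_def by simp
  then have pF: "p dvd card F" using pE by (metis dvd_eq_mod_eq_0)
  have HF: "H \<in> F" unfolding F_def using H H.subgroup_in_rcosets[OF group_axioms]
    by (auto simp: coset_join2)
  have "finite F" using finE unfolding F_def by simp
  then have "card F \<noteq> 0" using HF by auto
  then have "card F \<ge> 2" using pF p by (metis dvd_imp_le gr0I order_trans prime_ge_2_nat)
  then have "\<not> F \<subseteq> {H}" using card_mono[of "{H}" F] by auto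
  then obtain C where C: "C \<in> F" "C \<noteq> H" by blast
  then obtain g where g: "g \<in> carrier G" "C = H #> g" unfolding F_def RCOSETS_def by blast
  have "g \<notin> H" using C(2) g coset_join2[OF _ H] by auto
  moreover have "g \<otimes> h \<otimes> inv g \<in> H" if h: "h \<in> H" for h
  proof -
    have "C #> inv (inv h) = C" using C(1) h H.m_inv_closed unfolding F_def by blast
    then have "H #> (g \<otimes> h) = H #> g" using g h H.mem_carrier H.subset
      by (simp add: coset_mult_assoc)
    then have "g \<otimes> h \<in> H #> g" using g h H.mem_carrier rcos_self[OF _ H] m_closed
      by metis
    then obtain h' where "h' \<in> H" "g \<otimes> h = h' \<otimes> g" unfolding r_coset_def by auto
    then show ?thesis using g H.mem_carrier by (simp add: m_assoc)
  qed
  ultimately show ?thesis using g by blast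
qed

text \<open>A proper subgroup of largest order containing V is normal, because its normalizer is
  strictly larger and hence everything.\<close>

lemma (in group) p_group_maximal_normal:
  assumes p: "prime p" and ord: "order G = p ^ n" and fin: "finite (carrier G)"
    and V: "subgroup V G" and neV: "V \<noteq> carrier G"
  obtains H where "H \<lhd> G" "V \<subseteq> H" "H \<noteq> carrier G"
    "\<And>L. \<lbrakk>subgroup L G; H \<subseteq> L\<rbrakk> \<Longrightarrow> L = H
      \<or> L = carrier G"
proof -
  define P where "P H \<longleftrightarrow> subgroup H G \<and> V \<subseteq> H
    \<and> H \<noteq> carrier G" for H
  have "\<forall>H. P H \<longrightarrow> card H < Suc (order G)"
  proof (intro allI impI)
    fix H assume "P H"
    then have "H \<subseteq> carrier G" unfolding P_def using subgroup.subset by blast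
    then show "card H < Suc (order G)" using card_mono[OF fin] unfolding order_def
      by (simp add: less_Suc_eq_le)
  qed
  then obtain H where H: "P H" "\<And>L. P L \<Longrightarrow> card L \<le> card H"
    using ex_has_greatest_nat[of P V card "Suc (order G)"] neV V unfolding P_def by blast
  have max: "L = H \<or> L = carrier G" if L: "subgroup L G" "H \<subseteq> L" for L
  proof (rule ccontr)
    assume "\<not> ?thesis"
    then have "P L" "H \<subset> L" using L H(1) unfolding P_def by auto
    moreover have "finite L" using L fin subgroup.subset finite_subset by metis
    ultimately show False using H(2)[of L] psubset_card_mono[of L H] by simp
  qed
  interpret H: subgroup H G using H(1) P_def by simp
  have finH: "finite H" using fin H.subset finite_subset by blast
  define N where "N = {g \<in> carrier G. \<forall>h \<in> H. g \<otimes> h \<otimes> inv g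
    \<in> H}"
  have "subgroup N G"
  proof (rule subgroupI)
    show "N \<subseteq> carrier G" unfolding N_def by auto
    have "\<one> \<in> N" unfolding N_def by (auto simp: H.mem_carrier)
    then show "N \<noteq> {}" by auto
    fix a assume a: "a \<in> N"
    then have ac: "a \<in> carrier G" unfolding N_def by simp
    \<comment> \<open>\<open>N\<close> is defined by an inclusion only. Finiteness of H upgrades it
      to equality, which gives closure under inverses.\<close>
    have "(\<lambda>h. a \<otimes> h \<otimes> inv a) ` H = H"
    proof (rule endo_inj_surj[OF finH])
      show "(\<lambda>h. a \<otimes> h \<otimes> inv a) ` H \<subseteq> H" using a unfolding N_def
        by auto
      show "inj_on (\<lambda>h. a \<otimes> h \<otimes> inv a) H" using ac
        by (auto simp: inj_on_def H.mem_carrier)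
    qed
    then have "inv a \<otimes> h \<otimes> inv (inv a) \<in> H" if h: "h \<in> H" for h
    proof -
      obtain h' where h': "h' \<in> H" "h = a \<otimes> h' \<otimes> inv a"
        using h \<open>_ ` H = H\<close> by auto
      then have "inv a \<otimes> h \<otimes> inv (inv a)
        = (inv a \<otimes> a) \<otimes> h' \<otimes> (inv a \<otimes> a)"
      proof -
        have "inv a \<otimes> (a \<otimes> h' \<otimes> inv a) \<otimes> a
          = (inv a \<otimes> a) \<otimes> h' \<otimes> (inv a \<otimes> a)"
          using ac h'(1) H.mem_carrier by (simp only: m_assoc m_closed inv_closed)
        then show ?thesis using ac h'(2) by simp
      qed
      then have "inv a \<otimes> h \<otimes> inv (inv a) = h'" using ac h' H.mem_carrier by simp
      then show ?thesis using h' by simp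
    qed
    then show "inv a \<in> N" using ac unfolding N_def by auto
    fix b assume b: "b \<in> N"
    then have bc: "b \<in> carrier G" unfolding N_def by simp
    have "a \<otimes> b \<otimes> h \<otimes> inv (a \<otimes> b) \<in> H" if "h \<in> H" for h
    proof -
      have "a \<otimes> (b \<otimes> h \<otimes> inv b) \<otimes> inv a \<in> H" using a b that
        unfolding N_def by auto
      then show ?thesis using ac bc that H.mem_carrier by (simp add: m_assoc inv_mult_group)
    qed
    then show "a \<otimes> b \<in> N" using ac bc unfolding N_def by auto
  qed
  moreover have "H \<subseteq> N" unfolding N_def by auto
  moreover have "N \<noteq> H"
    using p_group_normalizer_grows[OF p ord fin H.subgroup_axioms] H(1) unfolding N_def P_def
      by blast
  ultimately have "N = carrier G" using max by blast
  then have "H \<lhd> G" unfolding normal_inv_iff N_def using H.subgroup_axioms by auto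
  then show ?thesis using that H(1) max unfolding P_def by blast
qed

section \<open>Finite algebras over a local ring\<close>

locale local_fin_alg =
  fixes m :: "'o::comm_ring_1 set" and smul :: "'o \<Rightarrow> 'a::ring_1 \<Rightarrow> 'a" and Y
    :: "'a set"
  assumes alg: "O_alg smul"
    and finY: "finite Y"
    and gen: "\<And>a. \<exists>c. a = (\<Sum>y\<in>Y. smul (c y) y)"
    and idl: "ideal_in m"
    and proper: "1 \<notin> m"
    and units: "\<And>x. x \<notin> m \<Longrightarrow> \<exists>y. x * y = 1"
begin

sublocale Modules.module smul
  using alg unfolding O_alg_def by unfold_locales auto

lemma smul_mult_left: "smul r a * b = smul r (a * b)"
  and smul_mult_right: "a * smul r b = smul r (a * b)"
  using alg unfolding O_alg_def by metis+

lemma m_zero: "0 \<in> m" and m_add: "x \<in> m \<Longrightarrow> y \<in> m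
  \<Longrightarrow> x + y \<in> m"
  and m_mult: "x \<in> m \<Longrightarrow> r * x \<in> m"
  using idl unfolding ideal_in_def by auto

lemma m_mult2: "x \<in> m \<Longrightarrow> x * r \<in> m" using m_mult[of x r]
  by (simp add: mult.commute)

lemma span_Y: "span Y = UNIV"
proof -
  have "a \<in> span Y" for a
  proof -
    obtain c where "a = (\<Sum>y\<in>Y. smul (c y) y)" using gen by blast
    moreover have "(\<Sum>y\<in>Y. smul (c y) y) \<in> span Y"
      by (intro span_sum span_scale span_base)
    ultimately show ?thesis by simp
  qed
  then show ?thesis by blast
qed

section \<open>Linear dependence and Nakayama's lemma modulo \<open>mA\<close>\<close>

definition mA :: "'a set" where
  "mA = {\<Sum>y\<in>Y. smul (c y) y | c. \<forall>y\<in>Y. c y \<in> m}"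

lemma mA_smul: assumes "r \<in> m" shows "smul r a \<in> mA"
proof -
  obtain c where "a = (\<Sum>y\<in>Y. smul (c y) y)" using gen by blast
  then have "smul r a = (\<Sum>y\<in>Y. smul (r * c y) y)" by (simp add: scale_sum_right)
  then show ?thesis unfolding mA_def using m_mult2[OF assms]
    by (intro CollectI exI[of _ "\<lambda>y. r * c y"]) simp
qed

lemma mA_zero: "0 \<in> mA" using mA_smul[OF m_zero, of 0] by simp

lemma mA_add: assumes "x \<in> mA" "y \<in> mA" shows "x + y \<in> mA"
proof -
  obtain c d where "\<forall>y\<in>Y. c y \<in> m" "\<forall>y\<in>Y. d y \<in> m"
    "x = (\<Sum>y\<in>Y. smul (c y) y)" "y = (\<Sum>y\<in>Y. smul (d y) y)"
    using assms unfolding mA_def by blast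
  then show ?thesis unfolding mA_def
    by (auto intro!: exI[of _ "\<lambda>y. c y + d y"] m_add simp: scale_left_distrib sum.distrib)
qed

lemma mA_sum: "(\<And>i. i \<in> A \<Longrightarrow> f i \<in> mA)
  \<Longrightarrow> sum f A \<in> mA"
  by (induction A rule: infinite_finite_induct) (auto intro: mA_add mA_zero)

lemma mA_mult_left: assumes "x \<in> mA" shows "a * x \<in> mA"
proof -
  obtain c where c: "\<forall>y\<in>Y. c y \<in> m" "x = (\<Sum>y\<in>Y. smul (c y) y)" using assms
    unfolding mA_def by blast
  then have "a * x = (\<Sum>y\<in>Y. smul (c y) (a * y))"
    by (simp add: sum_distrib_left smul_mult_right)
  then show ?thesis using c by (auto intro!: mA_sum mA_smul)
qed

lemma mA_mult_right: assumes "x \<in> mA" shows "x * a \<in> mA"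
proof -
  obtain c where c: "\<forall>y\<in>Y. c y \<in> m" "x = (\<Sum>y\<in>Y. smul (c y) y)" using assms
    unfolding mA_def by blast
  then have "x * a = (\<Sum>y\<in>Y. smul (c y) (y * a))"
    by (simp add: sum_distrib_right smul_mult_left)
  then show ?thesis using c by (auto intro!: mA_sum mA_smul)
qed

lemma mA_minus: "x \<in> mA \<Longrightarrow> - x \<in> mA" using mA_mult_left[of x "- 1"] by simp

lemma mA_scale: "x \<in> mA \<Longrightarrow> smul r x \<in> mA"
  using mA_mult_left[of x "smul r 1"] by (simp add: smul_mult_left)

lemma subspace_mA: "subspace mA"
  unfolding subspace_def using mA_zero mA_add mA_scale by blast

text \<open>Gaussian elimination over the residue field, done with spans that contain
  \<open>mA\<close> instead of in a quotient. That a term depends on the earlier ones is the form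
  that later yields polynomial relations and bounds ascending chains.\<close>

lemma steinitz_mod:
  assumes "finite Z" "\<And>i. i \<le> card Z \<Longrightarrow> x i \<in> span (Z \<union> mA)"
  shows "\<exists>n \<le> card Z. x n \<in> span (x ` {..<n} \<union> mA)"
  using assms
proof (induction Z arbitrary: x rule: finite_induct)
  case empty
  have "x 0 \<in> span mA" using empty[of 0] by simp
  then show ?case by (auto intro!: exI[of _ 0])
next
  case (insert y Z)
  have "\<exists>k. x i - smul k y \<in> span (Z \<union> mA)" if "i \<le> Suc (card Z)" for i
    using insert.prems[of i] that insert.hyps span_insert[of y "Z \<union> mA"] by auto
  then obtain k
    where k: "\<And>i. i \<le> Suc (card Z)
      \<Longrightarrow> x i - smul (k i) y \<in> span (Z \<union> mA)" by metis
  show ?case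
  proof (cases "\<forall>i \<le> card Z. k i \<in> m")
    case True
    have "x i \<in> span (Z \<union> mA)" if "i \<le> card Z" for i
    proof -
      have "smul (k i) y \<in> span (Z \<union> mA)" using True that mA_smul span_base by blast
      from span_add[OF k[of i] this] that show ?thesis by simp
    qed
    then have "\<exists>n \<le> card Z. x n \<in> span (x ` {..<n} \<union> mA)" by (rule insert.IH)
    then obtain n where "n \<le> card Z" "x n \<in> span (x ` {..<n} \<union> mA)"
      by (elim exE conjE)
    then show ?thesis using insert.hyps by (intro exI[of _ n]) simp
  next
    case False
    \<comment> \<open>The pivot is the first term whose coefficient at y is a unit.\<close>
    define j where "j = (LEAST i. i \<le> card Z \<and> k i \<notin> m)"
    have j: "j \<le> card Z" "k j \<notin> m"
      using LeastI_ex[of "\<lambda>i. i \<le> card Z \<and> k i \<notin> m"] False unfolding j_def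
        by auto
    have jm: "k i \<in> m" if "i < j" for i
      using not_less_Least[of i "\<lambda>i. i \<le> card Z \<and> k i \<notin> m"] that j(1)
        unfolding j_def by auto
    obtain r where r: "k j * r = 1" using units[OF j(2)] by blast
    \<comment> \<open>The pivot is dropped and y is eliminated from the terms after it; the terms
      before it have their y-part in \<open>mA\<close> already. Dropping the pivot shifts indices:
      from j on, \<open>x' n\<close> comes from \<open>x (Suc n)\<close>.\<close>
    define x' where "x' i = (if i < j then x i else x (Suc i) - smul (k (Suc i) * r) (x j))" for i
    have x'in: "x' i \<in> span (Z \<union> mA)" if "i \<le> card Z" for i
    proof (cases "i < j")
      case True
      have "smul (k i) y \<in> span (Z \<union> mA)" using jm[OF True] mA_smul span_base by blast
      from span_add[OF k[of i] this] that True show ?thesis unfolding x'_def by simp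
    next
      case False
      have "smul (k (Suc i) * r) (x j - smul (k j) y) \<in> span (Z \<union> mA)"
        using span_scale k[of j] j by simp
      moreover have "x (Suc i) - smul (k (Suc i)) y \<in> span (Z \<union> mA)"
        using k[of "Suc i"] that by simp
      ultimately have "x (Suc i) - smul (k (Suc i)) y - smul (k (Suc i) * r) (x j - smul (k j) y)
        \<in> span (Z \<union> mA)"
        using span_diff by blast
      moreover have "k (Suc i) * r * k j = k (Suc i)" using r
        by (simp add: mult.assoc mult.commute[of r])
      ultimately show ?thesis using False unfolding x'_def by (simp add: scale_right_diff_distrib)
    qed
    have "\<exists>n \<le> card Z. x' n \<in> span (x' ` {..<n} \<union> mA)" using x'in
      by (rule insert.IH)
    then obtain n where n: "n \<le> card Z" "x' n \<in> span (x' ` {..<n} \<union> mA)"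
      by (elim exE conjE)
    show ?thesis
    proof (cases "n < j")
      case True
      then have "x' ` {..<n} = x ` {..<n}" unfolding x'_def by auto
      then have "x n \<in> span (x ` {..<n} \<union> mA)" using n True unfolding x'_def by simp
      then show ?thesis using n insert.hyps by (intro exI[of _ n]) simp
    next
      case False
      let ?S = "span (x ` {..<Suc n} \<union> mA)"
      have xj: "x j \<in> ?S" using False span_base by auto
      have "x' i \<in> ?S" if "i < n" for i
      proof (cases "i < j")
        case True
        then show ?thesis using that span_base[of "x i"] unfolding x'_def by auto
      next
        case False
        then show ?thesis using that xj span_base[of "x (Suc i)"] span_diff span_scale
          unfolding x'_def by auto
      qed
      then have "span (x' ` {..<n} \<union> mA) \<subseteq> ?S"
        by (intro span_minimal) (auto intro: span_base)
      then have "x' n \<in> ?S" using n by blast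
      then have "x' n + smul (k (Suc n) * r) (x j) \<in> ?S" using xj span_add span_scale by blast
      then have "x (Suc n) \<in> ?S" using False unfolding x'_def by simp
      then show ?thesis using n insert.hyps by (intro exI[of _ "Suc n"]) simp
    qed
  qed
qed

lemma chain_mod:
  fixes x :: "nat \<Rightarrow> 'a"
  shows "\<exists>n \<le> card Y. x n \<in> span (x ` {..<n} \<union> mA)"
proof -
  have "span (Y \<union> mA) = UNIV" using span_Y span_mono[of Y "Y \<union> mA"] by auto
  then show ?thesis using steinitz_mod[OF finY] by simp
qed

text \<open>Generators are removed one at a time: modulo the span of the others, y equals c y for
  some c in m, and 1 - c is a unit.\<close>

lemma nakayama:
  assumes X: "subspace X" and XA: "\<And>a. \<exists>x\<in>X. a - x \<in> mA"
  shows "X = UNIV"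
proof -
  have "span (X \<union> Z) = UNIV \<Longrightarrow> X = UNIV" if "finite Z" for Z
    using that
  proof (induction Z rule: finite_induct)
    case empty
    then show ?case using span_eq_iff[THEN iffD2, OF X] by simp
  next
    case (insert y Z)
    \<comment> \<open>This is the span of X and Z plus m y. It contains \<open>mA\<close> since
      every element of A is a multiple of y modulo that span.\<close>
    define Q where "Q = {x + smul c y | x c. x \<in> span (X \<union> Z) \<and> c \<in> m}"
    have Q_add: "u + v \<in> Q" if "u \<in> Q" "v \<in> Q" for u v
    proof -
      obtain x c where u: "u = x + smul c y" "x \<in> span (X \<union> Z)" "c \<in> m"
        using \<open>u \<in> Q\<close> unfolding Q_def by blast
      obtain x' c' where v: "v = x' + smul c' y" "x' \<in> span (X \<union> Z)" "c' \<in> m"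
        using \<open>v \<in> Q\<close> unfolding Q_def by blast
      note * = u v
      have "u + v = (x + x') + smul (c + c') y" using * by (simp add: scale_left_distrib)
      moreover have "x + x' \<in> span (X \<union> Z)" "c + c' \<in> m" using * span_add m_add
        by auto
      ultimately show ?thesis unfolding Q_def by blast
    qed
    have Q_zero: "0 \<in> Q" unfolding Q_def using span_zero m_zero
      by (intro CollectI exI[of _ 0]) simp
    have Q_smul: "smul r a \<in> Q" if "r \<in> m" for r a
    proof -
      have "a \<in> span (insert y (X \<union> Z))" using insert.prems by simp
      then obtain k where k: "a - smul k y \<in> span (X \<union> Z)" unfolding span_insert by blast
      have "smul r a = smul r (a - smul k y) + smul (r * k) y"
        by (simp add: scale_right_diff_distrib)
      moreover have "smul r (a - smul k y) \<in> span (X \<union> Z)" "r * k \<in> m"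
        using span_scale[OF k] m_mult2[OF that] by auto
      ultimately show ?thesis unfolding Q_def by blast
    qed
    have "mA \<subseteq> Q"
    proof
      fix a assume "a \<in> mA"
      then obtain c where c: "\<forall>y\<in>Y. c y \<in> m" "a = (\<Sum>y\<in>Y. smul (c y) y)"
        unfolding mA_def by blast
      have "(\<Sum>y\<in>W. smul (c y) y) \<in> Q" if "finite W" "W \<subseteq> Y" for W
        using that by (induction W rule: finite_induct) (use c Q_zero Q_add Q_smul in auto)
      then show "a \<in> Q" using c finY by blast
    qed
    obtain x where x: "x \<in> X" "y - x \<in> mA" using XA by blast
    then obtain x' c where c: "y - x = x' + smul c y" "x' \<in> span (X \<union> Z)" "c \<in> m"
      using \<open>mA \<subseteq> Q\<close> unfolding Q_def by blast
    have "1 - c \<notin> m" using m_add[of "1 - c" c] c(3) proper by auto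
    then obtain r where r: "(1 - c) * r = 1" using units by blast
    have "smul (1 - c) y = x + x'" using c(1) by (simp add: scale_left_diff_distrib algebra_simps)
    then have "smul r (x + x') = smul ((1 - c) * r) y" by (metis scale_scale mult.commute)
    then have "y = smul r (x + x')" using r by simp
    moreover have "x + x' \<in> span (X \<union> Z)" using span_add[OF span_base c(2)] x(1) by blast
    ultimately have "y \<in> span (X \<union> Z)" using span_scale by metis
    then have "span (X \<union> insert y Z) \<subseteq> span (X \<union> Z)"
      by (intro span_minimal) (auto intro: span_base)
    then have "span (X \<union> Z) = UNIV" using insert.prems by auto
    then show ?case using insert.IH by simp
  qed
  moreover have "span (X \<union> Y) = UNIV" using span_Y span_mono[of Y "X \<union> Y"] by auto
  ultimately show ?thesis using finY by blast
qed

definition cong_mA :: "'a \<Rightarrow> 'a \<Rightarrow> bool" (infix "\<approx>" 50)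
  where "x \<approx> y \<longleftrightarrow> x - y \<in> mA"

lemma cong_mA_refl [simp]: "x \<approx> x" unfolding cong_mA_def by (simp add: mA_zero)
lemma cong_mA_sym: "x \<approx> y \<Longrightarrow> y \<approx> x" unfolding cong_mA_def
  using mA_minus by fastforce
lemma cong_mA_trans [trans]: "x \<approx> y \<Longrightarrow> y \<approx> z
  \<Longrightarrow> x \<approx> z"
  unfolding cong_mA_def using mA_add[of "x - y" "y - z"] by simp
lemma cong_mA_add: "x \<approx> y \<Longrightarrow> x' \<approx> y'
  \<Longrightarrow> x + x' \<approx> y + y'"
  unfolding cong_mA_def using mA_add[of "x - y" "x' - y'"] by (simp add: algebra_simps)
lemma cong_mA_mult: assumes "x \<approx> y" "x' \<approx> y'" shows "x * x' \<approx> y * y'"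
proof -
  have "x * x' - y * y' = (x - y) * x' + y * (x' - y')" by (simp add: algebra_simps)
  then show ?thesis using assms unfolding cong_mA_def by (metis mA_add mA_mult_left mA_mult_right)
qed
lemma cong_mA_mult_left: "x \<approx> y \<Longrightarrow> a * x \<approx> a * y"
  using cong_mA_mult[of a a] by simp
lemma cong_mA_mult_right: "x \<approx> y \<Longrightarrow> x * a \<approx> y * a"
  using cong_mA_mult[of _ _ a a] by simp
lemma cong_mA_zero_iff: "x \<approx> 0 \<longleftrightarrow> x \<in> mA" unfolding cong_mA_def
  by simp

text \<open>For v congruent to 1, Nakayama applied to A v gives a left inverse of v. This left
  inverse is again congruent to 1, so it has a left inverse too, which must be v itself.\<close>

lemma unit_of_cong_mA_one:
  assumes "u \<approx> 1" shows "unit_of u"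
proof -
  have *: "\<exists>b. b * v = 1" if "v \<approx> 1" for v
  proof -
    define X where "X = range (\<lambda>a. a * v)"
    have "subspace X" unfolding subspace_def X_def
    proof (intro conjI ballI allI)
      show "0 \<in> range (\<lambda>a. a * v)" by (rule range_eqI[of _ _ 0]) simp
      fix x y assume "x \<in> range (\<lambda>a. a * v)" "y \<in> range (\<lambda>a. a * v)"
      then show "x + y \<in> range (\<lambda>a. a * v)" by (auto simp flip: distrib_right)
    next
      fix c x assume "x \<in> range (\<lambda>a. a * v)"
      then show "smul c x \<in> range (\<lambda>a. a * v)" by (auto simp flip: smul_mult_left)
    qed
    moreover have "\<exists>x\<in>X. a - x \<in> mA" for a
    proof
      show "a * v \<in> X" unfolding X_def by blast
      show "a - a * v \<in> mA" using cong_mA_mult_left[OF cong_mA_sym[OF that], of a]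
        unfolding cong_mA_def by simp
    qed
    ultimately have "X = UNIV" by (rule nakayama)
    then show ?thesis unfolding X_def by (metis UNIV_I rangeE)
  qed
  obtain b where b: "b * u = 1" using *[OF assms] by blast
  have "b \<approx> 1" using cong_mA_mult_left[OF assms, of b] b cong_mA_sym by simp
  then obtain c where c: "c * b = 1" using * by blast
  then have "c = u" using b by (metis mult.assoc mult.left_neutral mult.right_neutral)
  then show ?thesis unfolding unit_of_def using b c by blast
qed

definition subalg :: "'a set \<Rightarrow> bool" where
  "subalg L \<longleftrightarrow> subspace L \<and> 1 \<in> L
    \<and> (\<forall>x\<in>L. \<forall>y\<in>L. x * y \<in> L)"

lemma subalg_power: "subalg L \<Longrightarrow> z \<in> L \<Longrightarrow> z ^ n \<in> L"
  by (induction n) (auto simp: subalg_def)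

lemma span_image_lessThan:
  "y \<in> span (x ` {..<n::nat} \<union> mA)
    \<Longrightarrow> \<exists>c. y \<approx> (\<Sum>i<n. smul (c i) (x i))"
proof (induction n arbitrary: y)
  case 0
  then show ?case using subspace_mA by (simp add: cong_mA_zero_iff span_eq_iff[THEN iffD2])
next
  case (Suc n)
  have "x ` {..<Suc n} \<union> mA = insert (x n) (x ` {..<n} \<union> mA)"
    by (auto simp: lessThan_Suc)
  then obtain k where "y - smul k (x n) \<in> span (x ` {..<n} \<union> mA)"
    using Suc.prems by (auto simp: span_insert)
  then obtain c where c: "y - smul k (x n) \<approx> (\<Sum>i<n. smul (c i) (x i))" using Suc.IH
    by blast
  have "(\<Sum>i<n. smul (c i) (x i)) = (\<Sum>i<n. smul ((c(n := k)) i) (x i))"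
    by (rule sum.cong) auto
  then have "(\<Sum>i<Suc n. smul ((c(n := k)) i) (x i))
    = (\<Sum>i<n. smul (c i) (x i)) + smul k (x n)" by simp
  moreover have "y \<approx> (\<Sum>i<n. smul (c i) (x i)) + smul k (x n)"
    using cong_mA_add[OF c cong_mA_refl[of "smul k (x n)"]] by simp
  ultimately show ?case by metis
qed

text \<open>The minimal polynomial of \<open>z\<close> modulo \<open>mA\<close>, divided by its lowest nonzero coefficient.\<close>

lemma fitting:
  assumes "subalg L" "z \<in> L"
  shows "\<exists>n q. q \<in> L \<and> z * q = q * z
    \<and> z ^ Suc n \<approx> z ^ Suc (Suc n) * q"
proof -
  define N where "N = card Y"
  \<comment> \<open>The powers are listed downwards from \<open>z ^ N\<close>, so the dependence
    expresses a power of z by higher ones, from which \<open>z ^ Suc (N - n)\<close> can be factored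
    out.\<close>
  obtain n c where n: "n \<le> N" "z ^ (N - n) \<approx> (\<Sum>i<n. smul (c i) (z ^ (N - i)))"
    using chain_mod[of "\<lambda>i. z ^ (N - i)"] span_image_lessThan[of _ "\<lambda>i. z ^ (N
      - i)"] unfolding N_def by blast
  define q where "q = (\<Sum>i<n. smul (c i) (z ^ (n - i - 1)))"
  have "z ^ (N - i) = z ^ Suc (N - n) * z ^ (n - i - 1)" if "i < n" for i
  proof -
    have "N - i = Suc (N - n) + (n - i - 1)" using that n(1) by simp
    then show ?thesis by (simp only: power_add)
  qed
  then have "(\<Sum>i<n. smul (c i) (z ^ (N - i))) = z ^ Suc (N - n) * q"
    unfolding q_def by (simp add: sum_distrib_left smul_mult_right del: power_Suc)
  then have "z ^ (N - n) \<approx> z ^ Suc (N - n) * q" using n(2) by simp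
  \<comment> \<open>A further factor z makes the exponent positive, so that a single z can later be
    split off.\<close>
  then have "z ^ Suc (N - n) \<approx> z ^ Suc (Suc (N - n)) * q"
    using cong_mA_mult_left[of _ _ z] by (simp add: mult.assoc)
  moreover have "q \<in> L" unfolding q_def using assms subalg_power
    by (auto intro!: subspace_sum subspace_scale simp: subalg_def)
  moreover have "z * q = q * z" unfolding q_def
    by (simp add: sum_distrib_left sum_distrib_right smul_mult_right smul_mult_left power_commutes)
  ultimately show ?thesis by blast
qed


text \<open>Dedekind finiteness: \<open>unit_of_cong_mA_one\<close> gives a true left inverse k of
  h. Multiplying the relation of \<open>fitting\<close> for h by \<open>k ^ Suc n\<close> leaves 1
  congruent to \<open>h * q\<close>, hence h also has a right inverse.\<close>

lemma left_unit_mod_imp_unit: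
  assumes "h' * h \<approx> 1"
  shows "unit_of h"
proof -
  obtain g where g: "g * (h' * h) = 1" using unit_of_cong_mA_one[OF assms] unfolding unit_of_def
    by blast
  define k where "k = g * h'"
  have k: "k * h = 1" unfolding k_def using g by (simp add: mult.assoc)
  have "subalg UNIV" unfolding subalg_def by simp
  from fitting[OF this, of h] obtain n q where
    nq: "h ^ Suc n \<approx> h ^ Suc (Suc n) * q" by blast
  have kn: "k ^ j * h ^ j = 1" for j
  proof (induction j)
    case (Suc j)
    have "k ^ Suc j * h ^ Suc j = k ^ j * (k * h) * h ^ j"
      unfolding power_Suc2[of k] power_Suc[of h] by (simp only: mult.assoc)
    then show ?case using Suc k by simp
  qed simp
  have "k ^ Suc n * h ^ Suc n \<approx> k ^ Suc n * (h ^ Suc n * (h * q))"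
    using cong_mA_mult_left[OF nq, of "k ^ Suc n"] unfolding power_Suc2[of h "Suc n"]
      by (simp only: mult.assoc)
  then have "1 \<approx> h * q" using kn[of "Suc n"] by (metis mult.assoc mult.left_neutral)
  then have "unit_of (h * q)" using unit_of_cong_mA_one cong_mA_sym by blast
  then obtain r where "h * q * r = 1" unfolding unit_of_def by blast
  then have "h * (q * r) = 1" by (simp add: mult.assoc)
  moreover then have "q * r = k" using k by (metis mult.assoc mult.left_neutral mult.right_neutral)
  ultimately show ?thesis using k unfolding unit_of_def by blast
qed

end

section \<open>Intertwiners and relative traces\<close>

text \<open>\<open>K\<close> will be P with the operation of the ambient group. Q then enters only
  through the second representation \<rho> \<circ> \<phi> of the same \<open>K\<close>, so all
  traces run over subgroups of one group.\<close>

locale p_group_alg = local_fin_alg m smul Y + group K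
  for m :: "'o::comm_ring_1 set" and smul :: "'o \<Rightarrow> 'a::ring_1 \<Rightarrow> 'a" and Y ::
    "'a set"
    and K :: "('s, 'b) monoid_scheme" (structure) +
  fixes p n :: nat
  assumes finK: "finite (carrier K)"
    and p: "prime p" and ordK: "order K = p ^ n" and pm: "of_nat p \<in> m"
begin

lemma mult_inv_cancel:
  "x \<in> carrier K \<Longrightarrow> y \<in> carrier K
    \<Longrightarrow> x \<otimes> (inv x \<otimes> y) = y"
  "x \<in> carrier K \<Longrightarrow> y \<in> carrier K
    \<Longrightarrow> inv x \<otimes> (x \<otimes> y) = y"
  by (simp_all flip: m_assoc)

definition unit_representation :: "('s \<Rightarrow> 'a) \<Rightarrow> bool" where
  "unit_representation \<alpha>
    \<longleftrightarrow> (\<forall>u\<in>carrier K. \<forall>v\<in>carrier K. \<alpha> (u \<otimes>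
      v) = \<alpha> u * \<alpha> v) \<and> \<alpha> \<one> = 1"

text \<open>The conjugation action on morphisms from the module given by \<alpha> to that given by
  \<beta>; composition of morphisms is the product of A. Its fixed points under a subgroup form
  \<open>intertw\<close>.\<close>

definition twist ::
  "('s \<Rightarrow> 'a) \<Rightarrow> ('s \<Rightarrow> 'a) \<Rightarrow> 's \<Rightarrow> 'a
    \<Rightarrow> 'a" where
  "twist \<alpha> \<beta> g x = \<beta> g * x * \<alpha> (inv g)"

definition intertw ::
  "('s \<Rightarrow> 'a) \<Rightarrow> ('s \<Rightarrow> 'a) \<Rightarrow> 's set \<Rightarrow> 'a
    set" where
  "intertw \<alpha> \<beta> R = {x. \<forall>u\<in>R. \<beta> u * x = x * \<alpha> u}"

lemma unit_representation_mult: "unit_representation \<alpha> \<Longrightarrow> u \<in> carrier K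
  \<Longrightarrow> v \<in> carrier K \<Longrightarrow> \<alpha> (u \<otimes> v) = \<alpha> u *
    \<alpha> v"
  unfolding unit_representation_def by blast

lemma unit_representation_inv: assumes "unit_representation \<alpha>" "g \<in> carrier K"
  shows "\<alpha> g * \<alpha> (inv g) = 1" "\<alpha> (inv g) * \<alpha> g = 1"
  using assms unit_representation_mult[of \<alpha> g "inv g"] unit_representation_mult[of \<alpha>
    "inv g" g] unfolding unit_representation_def by auto

lemma twist_eq_iff: assumes "unit_representation \<alpha>" "g \<in> carrier K"
  shows "twist \<alpha> \<beta> g x = x \<longleftrightarrow> \<beta> g * x = x * \<alpha> g"
proof
  assume "twist \<alpha> \<beta> g x = x"
  then have "\<beta> g * x * \<alpha> (inv g) * \<alpha> g = x * \<alpha> g" unfolding twist_def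
    by simp
  then show "\<beta> g * x = x * \<alpha> g" using unit_representation_inv[OF assms]
    by (simp add: mult.assoc)
next
  assume "\<beta> g * x = x * \<alpha> g"
  then show "twist \<alpha> \<beta> g x = x" unfolding twist_def
    using unit_representation_inv[OF assms] by (simp add: mult.assoc)
qed

lemma intertw_iff_twist: assumes "unit_representation \<alpha>" "R \<subseteq> carrier K"
  shows "x \<in> intertw \<alpha> \<beta> R
    \<longleftrightarrow> (\<forall>g\<in>R. twist \<alpha> \<beta> g x = x)"
  using twist_eq_iff[OF assms(1)] assms(2) unfolding intertw_def by blast

lemma intertw_mono: "R \<subseteq> S \<Longrightarrow> x \<in> intertw \<alpha> \<beta> S
  \<Longrightarrow> x \<in> intertw \<alpha> \<beta> R" unfolding intertw_def by blast

lemma intertw_mult: assumes "y \<in> intertw \<beta> \<gamma> R" "x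
  \<in> intertw \<alpha> \<beta> R" shows "y * x \<in> intertw \<alpha> \<gamma> R"
proof -
  have "\<gamma> u * (y * x) = y * x * \<alpha> u" if "u \<in> R" for u
  proof -
    have "\<gamma> u * y = y * \<beta> u" "\<beta> u * x = x * \<alpha> u" using assms that
      unfolding intertw_def by auto
    then show ?thesis by (metis mult.assoc)
  qed
  then show ?thesis unfolding intertw_def by blast
qed

lemma intertw_one: "1 \<in> intertw \<alpha> \<alpha> R" unfolding intertw_def by simp
lemma intertw_zero: "0 \<in> intertw \<alpha> \<beta> R" unfolding intertw_def by simp
lemma intertw_add: "x \<in> intertw \<alpha> \<beta> R
  \<Longrightarrow> y \<in> intertw \<alpha> \<beta> R \<Longrightarrow> x + y \<in> intertw
    \<alpha> \<beta> R"
  unfolding intertw_def by (simp add: distrib_left distrib_right)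
lemma intertw_diff: "x \<in> intertw \<alpha> \<beta> R
  \<Longrightarrow> y \<in> intertw \<alpha> \<beta> R \<Longrightarrow> x - y \<in> intertw
    \<alpha> \<beta> R"
  unfolding intertw_def by (simp add: left_diff_distrib right_diff_distrib)
lemma intertw_smul: "x \<in> intertw \<alpha> \<beta> R
  \<Longrightarrow> smul r x \<in> intertw \<alpha> \<beta> R"
  unfolding intertw_def by (simp add: smul_mult_left smul_mult_right)

lemma subspace_intertw: "subspace (intertw \<alpha> \<beta> R)"
  unfolding subspace_def using intertw_zero intertw_add intertw_smul by blast

lemma subalg_intertw: "subalg (intertw \<alpha> \<alpha> R)"
  unfolding subalg_def using subspace_intertw intertw_one intertw_mult by blast

lemma twist_add: "twist \<alpha> \<beta> g (x + y)
  = twist \<alpha> \<beta> g x + twist \<alpha> \<beta> g y"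
  unfolding twist_def by (simp add: distrib_left distrib_right)
lemma twist_diff: "twist \<alpha> \<beta> g (x - y)
  = twist \<alpha> \<beta> g x - twist \<alpha> \<beta> g y"
  unfolding twist_def by (simp add: left_diff_distrib right_diff_distrib)
lemma twist_zero [simp]: "twist \<alpha> \<beta> g 0 = 0" unfolding twist_def by simp
lemma twist_sum: "twist \<alpha> \<beta> g (sum f A)
  = (\<Sum>a\<in>A. twist \<alpha> \<beta> g (f a))"
  by (induction A rule: infinite_finite_induct) (simp_all add: twist_add)
lemma twist_mA: "x \<in> mA \<Longrightarrow> twist \<alpha> \<beta> g x \<in> mA"
  unfolding twist_def by (intro mA_mult_left mA_mult_right)

lemma twist_mult: assumes "unit_representation \<beta>" "g \<in> carrier K"
  shows "twist \<alpha> \<gamma> g (y * x)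
    = twist \<beta> \<gamma> g y * twist \<alpha> \<beta> g x"
proof -
  have "twist \<beta> \<gamma> g y * twist \<alpha> \<beta> g x
    = \<gamma> g * y * (\<beta> (inv g) * \<beta> g) * x * \<alpha> (inv g)"
    unfolding twist_def by (simp only: mult.assoc)
  then show ?thesis using unit_representation_inv[OF assms] unfolding twist_def
    by (simp add: mult.assoc)
qed

lemma twist_comp: assumes "unit_representation \<alpha>" "unit_representation \<beta>" "g
  \<in> carrier K" "h \<in> carrier K"
  shows "twist \<alpha> \<beta> g (twist \<alpha> \<beta> h x)
    = twist \<alpha> \<beta> (g \<otimes> h) x"
  using assms unfolding twist_def by (simp add: unit_representation_mult inv_mult_group mult.assoc)

lemma twist_one: "unit_representation \<alpha> \<Longrightarrow> unit_representation \<beta>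
  \<Longrightarrow> twist \<alpha> \<beta> \<one> x = x"
  unfolding twist_def unit_representation_def by simp

lemma twist_intertw_normal: assumes "unit_representation \<alpha>" "unit_representation \<beta>"
  "H \<lhd> K" "g \<in> carrier K" "x \<in> intertw \<alpha> \<beta> H"
  shows "twist \<alpha> \<beta> g x \<in> intertw \<alpha> \<beta> H"
proof -
  interpret H: normal H K by (rule assms(3))
  have "twist \<alpha> \<beta> u (twist \<alpha> \<beta> g x) = twist \<alpha> \<beta> g x"
    if u: "u \<in> H" for u
  proof -
    have c: "inv g \<otimes> u \<otimes> g \<in> H" using H.inv_op_closed1 assms(4) u by blast
    have uc: "u \<in> carrier K" using u H.mem_carrier by blast
    have "u \<otimes> g = g \<otimes> (inv g \<otimes> u \<otimes> g)" using assms(4) uc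
      by (simp add: m_assoc mult_inv_cancel)
    then have "twist \<alpha> \<beta> u (twist \<alpha> \<beta> g x)
      = twist \<alpha> \<beta> g (twist \<alpha> \<beta> (inv g \<otimes> u \<otimes> g) x)"
      using twist_comp assms uc H.mem_carrier[OF c] by metis
    then show ?thesis using intertw_iff_twist[of \<alpha> H x \<beta>] assms c H.subset by simp
  qed
  then show ?thesis using intertw_iff_twist assms(1) H.subset by blast
qed

section \<open>Transversals and relative traces\<close>

definition transversal :: "'s set \<Rightarrow> 's set \<Rightarrow> 's set \<Rightarrow> bool"
  where
  "transversal X R S \<longleftrightarrow> X \<subseteq> S
    \<and> (\<forall>s\<in>S. \<exists>!x. x \<in> X \<and> inv x \<otimes> s \<in> R)"

text \<open>Representatives are chosen by a predicate that is the same function for all elements of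
  a left coset, so the choice operator returns one element per coset.\<close>

lemma transversal_ex:
  assumes R: "subgroup R K" and S: "subgroup S K"
  shows "\<exists>X. transversal X R S"
proof -
  interpret R: subgroup R K by (rule R)
  interpret S: subgroup S K by (rule S)
  define c where "c s = (SOME t. t \<in> S \<and> inv t \<otimes> s \<in> R)" for s
  have c: "c s \<in> S" "inv (c s) \<otimes> s \<in> R" if "s \<in> S" for s
  proof -
    have "\<exists>t. t \<in> S \<and> inv t \<otimes> s \<in> R" using that S.mem_carrier
      by (intro exI[of _ s]) auto
    then have "c s \<in> S \<and> inv (c s) \<otimes> s \<in> R" unfolding c_def by (rule someI_ex)
    then show "c s \<in> S" "inv (c s) \<otimes> s \<in> R" by auto
  qed
  have c_eq: "c s = c t" if st: "s \<in> S" "t \<in> S" "inv s \<otimes> t \<in> R" for s t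
  proof -
    have "inv u \<otimes> s \<in> R \<longleftrightarrow> inv u \<otimes> t \<in> R"
      if u: "u \<in> S" for u
    proof -
      have carr: "u \<in> carrier K" "s \<in> carrier K" "t \<in> carrier K"
        using st u S.mem_carrier by auto
      have 1: "inv u \<otimes> t = (inv u \<otimes> s) \<otimes> (inv s \<otimes> t)"
        using carr by (simp add: m_assoc mult_inv_cancel)
      have 2: "inv u \<otimes> s = (inv u \<otimes> t) \<otimes> inv (inv s \<otimes> t)"
        using carr by (simp add: m_assoc inv_mult_group mult_inv_cancel)
      show ?thesis using 1 2 st(3) R.m_closed R.m_inv_closed by metis
    qed
    then have "(\<lambda>u. u \<in> S \<and> inv u \<otimes> s \<in> R) = (\<lambda>u. u \<in> S
      \<and> inv u \<otimes> t \<in> R)" by auto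
    then show ?thesis unfolding c_def by simp
  qed
  have "transversal (c ` S) R S" unfolding transversal_def
  proof (intro conjI ballI ex1I)
    show "c ` S \<subseteq> S" using c by auto
    fix s assume s: "s \<in> S"
    show "c s \<in> c ` S" "inv (c s) \<otimes> s \<in> R" using s c by auto
    fix x assume x: "x \<in> c ` S \<and> inv x \<otimes> s \<in> R"
    then obtain t where t: "t \<in> S" "x = c t" by blast
    have "c x = x" using c_eq[of x t] c t by simp
    moreover have "c x = c s" using c_eq[of x s] x s t c by simp
    ultimately show "x = c s" by simp
  qed
  then show ?thesis by blast
qed

definition transversal_of :: "'s set \<Rightarrow> 's set \<Rightarrow> 's set"
  where "transversal_of R S = (SOME X. transversal X R S)"

lemma transversal_transversal_of: "subgroup R K \<Longrightarrow> subgroup S K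
  \<Longrightarrow> transversal (transversal_of R S) R S"
  unfolding transversal_of_def using someI_ex[OF transversal_ex] .

definition rel_trace ::
  "('s \<Rightarrow> 'a) \<Rightarrow> ('s \<Rightarrow> 'a) \<Rightarrow> 's set \<Rightarrow> 's
    set \<Rightarrow> 'a \<Rightarrow> 'a" where
  "rel_trace \<alpha> \<beta> R S x = (\<Sum>g\<in>transversal_of R S. twist \<alpha> \<beta> g x)"

lemma twist_coset: assumes "unit_representation \<alpha>" "unit_representation \<beta>" "R
  \<subseteq> carrier K" "x \<in> intertw \<alpha> \<beta> R"
  "g \<in> carrier K" "h \<in> carrier K" "inv g \<otimes> h \<in> R"
  shows "twist \<alpha> \<beta> g x = twist \<alpha> \<beta> h x"
proof -
  have "h = g \<otimes> (inv g \<otimes> h)" using assms by (simp add: inv_solve_left flip: m_assoc)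
  then have "twist \<alpha> \<beta> h x
    = twist \<alpha> \<beta> g (twist \<alpha> \<beta> (inv g \<otimes> h) x)"
    using twist_comp[of \<alpha> \<beta> g "inv g \<otimes> h"] assms by auto
  then show ?thesis using intertw_iff_twist[of \<alpha> R x \<beta>] assms by simp
qed

text \<open>On elements fixed by R a twist depends only on the left coset, and two transversals
  correspond by sending an element to the representative of its coset in the other (\<open>f\<close>
  below).\<close>

lemma rel_trace_eq: assumes "unit_representation \<alpha>" "unit_representation \<beta>"
  "subgroup R K" "subgroup S K" "x \<in> intertw \<alpha> \<beta> R" "transversal X R S"
  shows "rel_trace \<alpha> \<beta> R S x = (\<Sum>g\<in>X. twist \<alpha> \<beta> g x)"
proof -
  interpret R: subgroup R K by (rule assms(3))
  interpret S: subgroup S K by (rule assms(4))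
  define f where "f X s = (THE x. x \<in> X \<and> inv x \<otimes> s \<in> R)" for X s
  have f: "f X s \<in> X" "inv (f X s) \<otimes> s \<in> R"
    if "transversal X R S" "s \<in> S" for X s
    using that theI'[of "\<lambda>x. x \<in> X \<and> inv x \<otimes> s \<in> R"]
      unfolding transversal_def f_def by auto
  have inv_f: "f X (f X' s) = s"
    if X: "transversal X R S" "transversal X' R S" and s: "s \<in> X" for X X' s
  proof -
    have sS: "s \<in> S" using X(1) s unfolding transversal_def by auto
    have f': "f X' s \<in> S" "inv (f X' s) \<otimes> s \<in> R" using f[OF X(2) sS] X(2)
      unfolding transversal_def by auto
    have "inv (inv (f X' s) \<otimes> s) \<in> R" using f' R.m_inv_closed by blast
    then have "inv s \<otimes> f X' s \<in> R" using sS f' S.mem_carrier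
      by (simp add: inv_mult_group)
    then show ?thesis using f[OF X(1) f'(1)] X(1) s f'(1) unfolding transversal_def by blast
  qed
  have T: "transversal (transversal_of R S) R S" using transversal_transversal_of assms by blast
  have "X \<subseteq> S" "transversal_of R S \<subseteq> S" using T assms(6)
    unfolding transversal_def by auto
  then show ?thesis unfolding rel_trace_def
  proof (intro sum.reindex_bij_witness[of _ "f (transversal_of R S)" "f X"])
    fix a assume a: "a \<in> transversal_of R S"
    show "f (transversal_of R S) (f X a) = a" using inv_f T assms(6) a by blast
    show "f X a \<in> X" using f assms(6) a \<open>transversal_of R S \<subseteq> S\<close> by blast
    show "twist \<alpha> \<beta> (f X a) x = twist \<alpha> \<beta> a x"
      using twist_coset[OF assms(1,2) R.subset assms(5)] f[OF assms(6)] a \<open>transversal_of R S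
        \<subseteq> S\<close> \<open>X \<subseteq> S\<close> S.mem_carrier
      by (meson subsetD)
  next
    fix b assume b: "b \<in> X"
    show "f X (f (transversal_of R S) b) = b" using inv_f T assms(6) b by blast
    show "f (transversal_of R S) b \<in> transversal_of R S"
      using f T b \<open>X \<subseteq> S\<close> by blast
  qed
qed

lemma transversal_of_subset: assumes "subgroup R K" "subgroup S K"
  shows "transversal_of R S \<subseteq> S"
  using transversal_transversal_of[OF assms] unfolding transversal_def by blast

text \<open>Left multiplication by an element of S turns one transversal into another.\<close>

lemma rel_trace_intertw: assumes "unit_representation \<alpha>" "unit_representation \<beta>"
  "subgroup R K" "subgroup S K" "x \<in> intertw \<alpha> \<beta> R"
  shows "rel_trace \<alpha> \<beta> R S x \<in> intertw \<alpha> \<beta> S"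
proof -
  interpret R: subgroup R K by (rule assms(3))
  interpret S: subgroup S K by (rule assms(4))
  have "twist \<alpha> \<beta> s (rel_trace \<alpha> \<beta> R S x)
    = rel_trace \<alpha> \<beta> R S x" if s: "s \<in> S" for s
  proof -
    let ?X = "transversal_of R S"
    have T: "transversal ?X R S" using transversal_transversal_of assms by blast
    then have XS: "?X \<subseteq> S" unfolding transversal_def by auto
    have inj: "inj_on (\<lambda>g. s \<otimes> g) ?X" using s XS S.mem_carrier
      by (simp add: inj_on_def subset_iff)
    have "transversal ((\<lambda>g. s \<otimes> g) ` ?X) R S" unfolding transversal_def
    proof (intro conjI ballI)
      show "(\<lambda>g. s \<otimes> g) ` ?X \<subseteq> S" using XS s by auto
      fix t assume t: "t \<in> S"
      have eq: "inv (s \<otimes> g) \<otimes> t = inv g \<otimes> (inv s \<otimes> t)"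
        if "g \<in> ?X" for g
        using that XS s t by (simp add: inv_mult_group m_assoc subset_iff)
      have "inv s \<otimes> t \<in> S" using s t by auto
      then have "\<exists>!x. x \<in> ?X \<and> inv x \<otimes> (inv s \<otimes> t) \<in> R" using T
        unfolding transversal_def by blast
      then show "\<exists>!x. x \<in> (\<lambda>g. s \<otimes> g) ` ?X
        \<and> inv x \<otimes> t \<in> R" using eq by (smt (verit) imageE imageI)
    qed
    then have "rel_trace \<alpha> \<beta> R S x
      = (\<Sum>g\<in>(\<lambda>g. s \<otimes> g) ` ?X. twist \<alpha> \<beta> g
        x)" using rel_trace_eq assms by blast
    also have "\<dots> = (\<Sum>g\<in>?X. twist \<alpha> \<beta> (s \<otimes> g) x)" using inj
      by (simp add: sum.reindex)
    also have "\<dots> = (\<Sum>g\<in>?X. twist \<alpha> \<beta> s (twist \<alpha> \<beta> g x))"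
      using twist_comp[OF assms(1,2)] s XS by (intro sum.cong) (auto simp: subset_iff)
    finally show ?thesis unfolding rel_trace_def twist_sum by simp
  qed
  then show ?thesis using intertw_iff_twist assms(1) S.subset by blast
qed

lemma rel_trace_add: "rel_trace \<alpha> \<beta> R S (x + y)
  = rel_trace \<alpha> \<beta> R S x + rel_trace \<alpha> \<beta> R S y"
  unfolding rel_trace_def by (simp add: twist_add sum.distrib)
lemma rel_trace_diff: "rel_trace \<alpha> \<beta> R S (x - y)
  = rel_trace \<alpha> \<beta> R S x - rel_trace \<alpha> \<beta> R S y"
  unfolding rel_trace_def by (simp add: twist_diff sum_subtractf)
lemma rel_trace_zero [simp]: "rel_trace \<alpha> \<beta> R S 0 = 0" unfolding rel_trace_def by simp
lemma rel_trace_mA: "x \<in> mA \<Longrightarrow> rel_trace \<alpha> \<beta> R S x \<in> mA"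
  unfolding rel_trace_def by (intro mA_sum twist_mA)

text \<open>Frobenius formula: a factor fixed by S is unchanged by the twists in the sum. With its
  right-hand version it makes the traces from R an ideal.\<close>

lemma rel_trace_mult_left: assumes "unit_representation \<beta>" "subgroup R K" "subgroup S K" "d
  \<in> intertw \<beta> \<gamma> S"
  shows "d * rel_trace \<alpha> \<beta> R S x = rel_trace \<alpha> \<gamma> R S (d * x)"
proof -
  have "twist \<alpha> \<gamma> g (d * x) = d * twist \<alpha> \<beta> g x"
    if "g \<in> transversal_of R S" for g
  proof -
    have g: "g \<in> S" "g \<in> carrier K"
      using that transversal_of_subset[OF assms(2,3)] subgroup.mem_carrier[OF assms(3)] by auto
    have "twist \<beta> \<gamma> g d = d"
      using intertw_iff_twist[of \<beta> S d \<gamma>] assms g subgroup.subset by blast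
    then show ?thesis using twist_mult[OF assms(1) g(2)] by simp
  qed
  then show ?thesis unfolding rel_trace_def by (simp add: sum_distrib_left)
qed

lemma rel_trace_mult_right: assumes "unit_representation \<alpha>" "unit_representation \<beta>"
  "subgroup R K" "subgroup S K" "d \<in> intertw \<alpha> \<beta> S"
  shows "rel_trace \<beta> \<gamma> R S x * d = rel_trace \<alpha> \<gamma> R S (x * d)"
proof -
  have "twist \<alpha> \<gamma> g (x * d) = twist \<beta> \<gamma> g x * d"
    if "g \<in> transversal_of R S" for g
  proof -
    have g: "g \<in> S" "g \<in> carrier K"
      using that transversal_of_subset[OF assms(3,4)] subgroup.mem_carrier[OF assms(4)] by auto
    have "twist \<alpha> \<beta> g d = d"
      using intertw_iff_twist[of \<alpha> S d \<beta>] assms g subgroup.subset by blast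
    then show ?thesis using twist_mult[OF assms(2) g(2)] by simp
  qed
  then show ?thesis unfolding rel_trace_def by (simp add: sum_distrib_right)
qed

lemma rel_trace_self: assumes "unit_representation \<alpha>" "unit_representation \<beta>"
  "subgroup S K" "x \<in> intertw \<alpha> \<beta> S"
  shows "rel_trace \<alpha> \<beta> S S x = x"
proof -
  interpret S: subgroup S K by (rule assms(3))
  have "transversal {\<one>} S S" unfolding transversal_def using S.mem_carrier by auto
  then show ?thesis using rel_trace_eq[OF assms(1,2,3,3,4)] twist_one assms by simp
qed

text \<open>The products of a transversal of S in T with one of R in S form a transversal of R in
  T.\<close>

lemma rel_trace_trans: assumes "unit_representation \<alpha>" "unit_representation \<beta>"
  "subgroup R K" "subgroup S K" "subgroup T K"
    "R \<subseteq> S" "S \<subseteq> T" "x \<in> intertw \<alpha> \<beta> R"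
  shows "rel_trace \<alpha> \<beta> S T (rel_trace \<alpha> \<beta> R S x)
    = rel_trace \<alpha> \<beta> R T x"
proof -
  interpret R: subgroup R K by (rule assms(3))
  interpret S: subgroup S K by (rule assms(4))
  interpret T: subgroup T K by (rule assms(5))
  let ?X = "transversal_of R S" and ?Z = "transversal_of S T"
  have X: "transversal ?X R S" and Z: "transversal ?Z S T" using transversal_transversal_of assms
    by auto
  have XS: "?X \<subseteq> S" and ZT: "?Z \<subseteq> T" using X Z unfolding transversal_def by auto
  have uniq: "z = z' \<and> x = x'"
    if h: "z \<in> ?Z" "x \<in> ?X" "z' \<in> ?Z" "x' \<in> ?X" "t \<in> T"
     "inv (z \<otimes> x) \<otimes> t \<in> R" "inv (z' \<otimes> x') \<otimes> t
       \<in> R" for z x z' x' t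
  proof -
    have c: "z \<in> carrier K" "z' \<in> carrier K" "t \<in> carrier K" "x \<in> S" "x' \<in> S" "x
      \<in> carrier K" "x' \<in> carrier K"
      using h XS ZT T.mem_carrier S.mem_carrier by auto
    have e: "inv (z \<otimes> x) \<otimes> t
      = inv x \<otimes> (inv z \<otimes> t)" "inv (z' \<otimes> x') \<otimes> t = inv x' \<otimes>
        (inv z' \<otimes> t)"
      using c by (simp_all add: inv_mult_group m_assoc)
    have "x \<otimes> (inv x \<otimes> (inv z \<otimes> t))
      \<in> S" "x' \<otimes> (inv x' \<otimes> (inv z' \<otimes> t)) \<in> S"
      using e h c assms(6) by (metis S.m_closed subsetD)+
    then have s: "inv z \<otimes> t \<in> S" "inv z' \<otimes> t \<in> S" using c
      by (simp_all flip: m_assoc)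
    then have "z = z'" using Z h unfolding transversal_def by blast
    then show ?thesis using e h(6,7) s X h(2,4) unfolding transversal_def by metis
  qed
  have inj: "inj_on (\<lambda>(z, x). z \<otimes> x) (?Z \<times> ?X)"
  proof (rule inj_onI, clarify)
    fix z x z' x' assume h: "z \<in> ?Z" "x \<in> ?X" "z' \<in> ?Z" "x' \<in> ?X" "z \<otimes> x
      = z' \<otimes> x'"
    have "z \<otimes> x \<in> T" using h XS ZT assms(7) by blast
    then have "inv (z \<otimes> x) \<otimes> (z \<otimes> x) \<in> R" using T.mem_carrier by simp
    then show "z = z' \<and> x = x'" using uniq[OF h(1-4) \<open>z \<otimes> x \<in> T\<close>] h(5)
      by simp
  qed
  have "transversal ((\<lambda>(z, x). z \<otimes> x) ` (?Z \<times> ?X)) R T"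
    unfolding transversal_def
  proof (intro conjI ballI)
    show "(\<lambda>(z, x). z \<otimes> x) ` (?Z \<times> ?X) \<subseteq> T" using XS ZT assms(7)
      by auto
    fix t assume t: "t \<in> T"
    obtain z where z: "z \<in> ?Z" "inv z \<otimes> t \<in> S" using Z t unfolding transversal_def
      by blast
    obtain x where x: "x \<in> ?X" "inv x \<otimes> (inv z \<otimes> t) \<in> R" using X z
      unfolding transversal_def by blast
    have c: "z \<in> carrier K" "x \<in> carrier K" "t \<in> carrier K"
      using z x t XS ZT T.mem_carrier S.mem_carrier by auto
    have zx: "inv (z \<otimes> x) \<otimes> t \<in> R" using x(2) c
      by (simp add: inv_mult_group m_assoc)
    show "\<exists>!y. y \<in> (\<lambda>(z, x). z \<otimes> x) ` (?Z \<times> ?X)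
      \<and> inv y \<otimes> t \<in> R"
    proof (rule ex1I[of _ "z \<otimes> x"])
      show "z \<otimes> x \<in> (\<lambda>(z, x). z \<otimes> x) ` (?Z \<times> ?X)
        \<and> inv (z \<otimes> x) \<otimes> t \<in> R"
        using z x zx by auto
      fix y assume "y \<in> (\<lambda>(z, x). z \<otimes> x) ` (?Z \<times> ?X)
        \<and> inv y \<otimes> t \<in> R"
      then obtain z' x'
        where "z' \<in> ?Z" "x' \<in> ?X" "y = z' \<otimes> x'" "inv (z' \<otimes> x') \<otimes> t
          \<in> R" by auto
      then show "y = z \<otimes> x" using uniq[of z' x' z x t] z x t zx by simp
    qed
  qed
  then have "rel_trace \<alpha> \<beta> R T x
    = (\<Sum>g\<in>(\<lambda>(z, x). z \<otimes> x) ` (?Z \<times> ?X). twist \<alpha> \<beta> g x)"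
    using rel_trace_eq assms by blast
  also have "\<dots> = (\<Sum>(z, g)\<in>?Z \<times> ?X. twist \<alpha> \<beta> (z \<otimes> g) x)"
    using inj by (simp add: sum.reindex case_prod_unfold)
  also have "\<dots>
    = (\<Sum>(z, g)\<in>?Z \<times> ?X. twist \<alpha> \<beta> z (twist \<alpha> \<beta> g x))"
  proof (intro sum.cong refl, clarify)
    fix z g assume "z \<in> ?Z" "g \<in> ?X"
    then have "z \<in> carrier K" "g \<in> carrier K" using XS ZT T.mem_carrier S.mem_carrier
      by auto
    then show "twist \<alpha> \<beta> (z \<otimes> g) x
      = twist \<alpha> \<beta> z (twist \<alpha> \<beta> g
        x)" using twist_comp[OF assms(1,2)] by simp
  qed
  also have "\<dots>
    = (\<Sum>z\<in>?Z. \<Sum>g\<in>?X. twist \<alpha> \<beta> z (twist \<alpha> \<beta> g x))"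
    by (simp add: sum.cartesian_product)
  finally show ?thesis unfolding rel_trace_def twist_sum by simp
qed

text \<open>Mackey's formula in the case of a single double coset.\<close>

lemma rel_trace_mackey: assumes "unit_representation \<alpha>" "unit_representation \<beta>"
  "subgroup V K" "subgroup S K"
    "\<And>g. g \<in> carrier K
      \<Longrightarrow> \<exists>s\<in>S. inv s \<otimes> g \<in> V" "x \<in> intertw \<alpha>
        \<beta> V"
  shows "rel_trace \<alpha> \<beta> V (carrier K) x = rel_trace \<alpha> \<beta> (V \<inter> S) S x"
proof -
  interpret V: subgroup V K by (rule assms(3))
  interpret S: subgroup S K by (rule assms(4))
  let ?X = "transversal_of (V \<inter> S) S"
  have VS: "subgroup (V \<inter> S) K" using assms subgroups_Inter_pair by blast
  have X: "transversal ?X (V \<inter> S) S" using transversal_transversal_of VS assms by blast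
  have XS: "?X \<subseteq> S" using X unfolding transversal_def by auto
  \<comment> \<open>As K = S V, each left coset of V meets S in exactly one left coset of
    \<open>V \<inter> S\<close>, so the same representatives serve both.\<close>
  have "transversal ?X V (carrier K)" unfolding transversal_def
  proof (intro conjI ballI)
    show "?X \<subseteq> carrier K" using XS S.subset by blast
    fix g assume g: "g \<in> carrier K"
    obtain s where s: "s \<in> S" "inv s \<otimes> g \<in> V" using assms(5) g by blast
    have eq: "inv x \<otimes> g \<in> V \<longleftrightarrow> inv x \<otimes> s \<in> V \<inter> S"
      if x: "x \<in> ?X" for x
    proof -
      have xS: "x \<in> S" using x XS by blast
      have c: "x \<in> carrier K" "s \<in> carrier K" using xS s by auto
      have 1: "inv x \<otimes> g = (inv x \<otimes> s) \<otimes> (inv s \<otimes> g)" using c g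
        by (simp add: m_assoc mult_inv_cancel)
      have 2: "inv x \<otimes> s = (inv x \<otimes> g) \<otimes> inv (inv s \<otimes> g)"
        using c g by (simp add: m_assoc inv_mult_group mult_inv_cancel)
      show ?thesis using 1 2 s xS V.m_closed V.m_inv_closed S.m_closed S.m_inv_closed
        by (metis IntD1 IntI)
    qed
    have "\<exists>!x. x \<in> ?X \<and> inv x \<otimes> s \<in> V \<inter> S" using X s(1)
      unfolding transversal_def by blast
    then show "\<exists>!x. x \<in> ?X \<and> inv x \<otimes> g \<in> V" using eq
      by (metis (no_types, lifting))
  qed
  then show ?thesis using rel_trace_eq[OF assms(1,2,3) subgroup_self assms(6)]
    unfolding rel_trace_def by simp
qed

text \<open>For normal H, right multiplication by g permutes the left cosets, so it carries a
  transversal to a transversal.\<close>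

lemma rel_trace_conj: assumes "unit_representation \<alpha>" "unit_representation \<beta>"
  "H \<lhd> K" "g \<in> carrier K" "x \<in> intertw \<alpha> \<beta> H"
  shows "rel_trace \<alpha> \<beta> H (carrier K) (twist \<alpha> \<beta> g x)
    = rel_trace \<alpha> \<beta> H (carrier K) x"
proof -
  interpret H: normal H K by (rule assms(3))
  let ?X = "transversal_of H (carrier K)"
  have X: "transversal ?X H (carrier K)"
    using transversal_transversal_of H.subgroup_axioms subgroup_self by blast
  then have XK: "?X \<subseteq> carrier K" unfolding transversal_def by auto
  have inj: "inj_on (\<lambda>h. h \<otimes> g) ?X" using XK assms(4)
    by (auto simp: inj_on_def subset_iff)
  have "transversal ((\<lambda>h. h \<otimes> g) ` ?X) H (carrier K)" unfolding transversal_def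
  proof (intro conjI ballI)
    show "(\<lambda>h. h \<otimes> g) ` ?X \<subseteq> carrier K" using XK assms(4) by auto
    fix s assume s: "s \<in> carrier K"
    have eq: "inv (x \<otimes> g) \<otimes> s \<in> H
      \<longleftrightarrow> inv x \<otimes> (s \<otimes> inv g) \<in> H" if "x \<in> ?X" for x
    proof -
      have xc: "x \<in> carrier K" using that XK by blast
      have 1: "inv (x \<otimes> g) \<otimes> s
        = inv g \<otimes> (inv x \<otimes> (s \<otimes> inv g)) \<otimes> g"
        using xc s assms(4) by (simp add: inv_mult_group m_assoc)
      have 2: "inv x \<otimes> (s \<otimes> inv g)
        = g \<otimes> (inv (x \<otimes> g) \<otimes> s) \<otimes> inv g"
        using xc s assms(4) by (simp add: inv_mult_group inv_solve_left flip: m_assoc)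
      show ?thesis using 1 2 H.inv_op_closed1 H.inv_op_closed2 assms(4) by metis
    qed
    have "\<exists>!x. x \<in> ?X \<and> inv x \<otimes> (s \<otimes> inv g) \<in> H"
      using X s assms(4) unfolding transversal_def by auto
    then show "\<exists>!x. x \<in> (\<lambda>h. h \<otimes> g) ` ?X
      \<and> inv x \<otimes> s \<in> H" using eq by (smt (verit) imageE imageI)
  qed
  then have "rel_trace \<alpha> \<beta> H (carrier K) x
    = (\<Sum>h\<in>(\<lambda>h. h \<otimes> g) ` ?X. twist \<alpha> \<beta> h x)"
    using rel_trace_eq[OF assms(1,2) H.subgroup_axioms subgroup_self assms(5)] by blast
  also have "\<dots> = (\<Sum>h\<in>?X. twist \<alpha> \<beta> (h \<otimes> g) x)" using inj
    by (simp add: sum.reindex)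
  also have "\<dots> = (\<Sum>h\<in>?X. twist \<alpha> \<beta> h (twist \<alpha> \<beta> g x))"
    using twist_comp[OF assms(1,2)] XK assms(4) by (intro sum.cong) auto
  finally show ?thesis unfolding rel_trace_def by simp
qed

end

section \<open>Maximal left ideals and partial isomorphisms\<close>

context p_group_alg
begin

lemma cong_mA_zero_left: "x \<approx> 0 \<Longrightarrow> a * x \<approx> 0"
  using cong_mA_mult_left[of x 0 a] by simp
lemma cong_mA_zero_right: "x \<approx> 0 \<Longrightarrow> x * a \<approx> 0"
  using cong_mA_mult_right[of x 0 a] by simp

abbreviation endos :: "('s \<Rightarrow> 'a) \<Rightarrow> 'a set"
  where "endos \<alpha> \<equiv> intertw \<alpha> \<alpha> (carrier K)"

text \<open>Containing all of \<open>mA \<inter> endos \<alpha>\<close> makes these correspond to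
  left ideals of the image of the fixed points in A/mA, so that congruent fixed points can be
  exchanged.\<close>

definition left_ideal :: "('s \<Rightarrow> 'a) \<Rightarrow> 'a set \<Rightarrow> bool" where
  "left_ideal \<alpha> N \<longleftrightarrow> N \<subseteq> endos \<alpha>
    \<and> (\<forall>x\<in>N. \<forall>y\<in>N. x + y \<in> N) \<and> (\<forall>a\<in>endos
      \<alpha>. \<forall>x\<in>N. a * x \<in> N) \<and>
     mA \<inter> endos \<alpha> \<subseteq> N"

definition max_left_ideal :: "('s \<Rightarrow> 'a) \<Rightarrow> 'a set \<Rightarrow> bool" where
  "max_left_ideal \<alpha> N \<longleftrightarrow> left_ideal \<alpha> N \<and> 1 \<notin> N
    \<and> (\<forall>N'. left_ideal \<alpha> N' \<and> 1 \<notin> N' \<and> N \<subseteq> N'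
      \<longrightarrow> N' = N)"

lemma left_ideal_add: "left_ideal \<alpha> N \<Longrightarrow> x \<in> N \<Longrightarrow> y \<in> N
  \<Longrightarrow> x + y \<in> N" unfolding left_ideal_def by blast
lemma left_ideal_mult: "left_ideal \<alpha> N \<Longrightarrow> a \<in> endos \<alpha>
  \<Longrightarrow> x \<in> N \<Longrightarrow> a * x \<in> N" unfolding left_ideal_def by blast
lemma left_ideal_endos: "left_ideal \<alpha> N \<Longrightarrow> x \<in> N
  \<Longrightarrow> x \<in> endos \<alpha>" unfolding left_ideal_def by blast
lemma left_ideal_mA: "left_ideal \<alpha> N \<Longrightarrow> x \<in> mA
  \<Longrightarrow> x \<in> endos \<alpha> \<Longrightarrow> x \<in>
    N" unfolding left_ideal_def by blast
lemma left_ideal_zero: "left_ideal \<alpha> N \<Longrightarrow> 0 \<in> N"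
  using left_ideal_mA mA_zero intertw_zero by blast
lemma left_ideal_minus: assumes "left_ideal \<alpha> N" "x \<in> N" shows "- x \<in> N"
proof -
  have "- 1 \<in> endos \<alpha>" using intertw_diff[OF intertw_zero intertw_one] by simp
  then show ?thesis using left_ideal_mult[OF assms(1) _ assms(2)] by fastforce
qed
lemma left_ideal_diff: "left_ideal \<alpha> N \<Longrightarrow> x \<in> N
  \<Longrightarrow> y \<in> N \<Longrightarrow> x - y \<in> N"
  using left_ideal_add[of \<alpha> N x "- y"] left_ideal_minus by simp

lemma max_left_ideal_ex:
  assumes "left_ideal \<alpha> N" "1 \<notin> N"
  shows "\<exists>M. max_left_ideal \<alpha> M \<and> N \<subseteq> M"
proof -
  let ?F = "{M. left_ideal \<alpha> M \<and> 1 \<notin> M \<and> N \<subseteq> M}"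
  have "\<exists>M\<in>?F. \<forall>X\<in>?F. M \<subseteq> X \<longrightarrow> X = M"
  proof (rule subset_Zorn_nonempty)
    show "?F \<noteq> {}" using assms by blast
    fix C assume C: "C \<noteq> {}" "subset.chain ?F C"
    then have CF: "C \<subseteq> ?F" and tot: "\<And>X Z. X \<in> C \<Longrightarrow> Z \<in> C
      \<Longrightarrow> X \<subseteq> Z \<or> Z \<subseteq> X"
      unfolding subset.chain_def by auto
    have "x + y \<in> \<Union>C" if xy: "x \<in> \<Union>C" "y \<in> \<Union>C" for x y
    proof -
      obtain X Z where "X \<in> C" "x \<in> X" "Z \<in> C" "y \<in> Z" using xy by blast
      then obtain W where "W \<in> C" "x \<in> W" "y \<in> W" using tot by blast
      then show ?thesis using CF left_ideal_add by blast
    qed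
    moreover have "a * x \<in> \<Union>C" if "a \<in> endos \<alpha>" "x \<in> \<Union>C" for a x
      using that CF left_ideal_mult by blast
    moreover have "\<Union>C \<subseteq> endos \<alpha>" using CF left_ideal_endos by blast
    moreover have "mA \<inter> endos \<alpha> \<subseteq> \<Union>C" using C(1) CF left_ideal_mA
      by blast
    moreover have "1 \<notin> \<Union>C" "N \<subseteq> \<Union>C" using C(1) CF by auto
    ultimately show "\<Union>C \<in> ?F" unfolding left_ideal_def by blast
  qed
  then obtain M where M: "M \<in> ?F" "\<forall>X\<in>?F. M \<subseteq> X \<longrightarrow> X = M"
    by blast
  then have "max_left_ideal \<alpha> M" unfolding max_left_ideal_def by (simp, metis order_trans)
  then show ?thesis using M by blast
qed

lemma left_ideal_adjoin:
  assumes "left_ideal \<alpha> N" "x \<in> endos \<alpha>"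
  shows "left_ideal \<alpha> {a * x + y | a y. a \<in> endos \<alpha> \<and> y \<in> N}"
  unfolding left_ideal_def
proof (intro conjI ballI subsetI)
  let ?M = "{a * x + y | a y. a \<in> endos \<alpha> \<and> y \<in> N}"
  fix u assume "u \<in> ?M"
  then obtain a y where u: "u = a * x + y" "a \<in> endos \<alpha>" "y \<in> N" by blast
  show "u \<in> endos \<alpha>" using u assms intertw_add intertw_mult left_ideal_endos by metis
  fix v assume "v \<in> ?M"
  then obtain b z where v: "v = b * x + z" "b \<in> endos \<alpha>" "z \<in> N" by blast
  have "u + v = (a + b) * x + (y + z)" using u v by (simp add: algebra_simps)
  then show "u + v \<in> ?M" using u v intertw_add left_ideal_add[OF assms(1)] by blast
next
  let ?M = "{a * x + y | a y. a \<in> endos \<alpha> \<and> y \<in> N}"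
  fix b u assume b: "b \<in> endos \<alpha>" and "u \<in> ?M"
  then obtain a y where u: "u = a * x + y" "a \<in> endos \<alpha>" "y \<in> N" by blast
  have "b * u = (b * a) * x + b * y" using u by (simp add: algebra_simps)
  then show "b * u \<in> ?M" using u b intertw_mult left_ideal_mult[OF assms(1)] by blast
next
  fix u assume "u \<in> mA \<inter> endos \<alpha>"
  then have "u = 0 * x + u" "u \<in> N" using left_ideal_mA[OF assms(1)] by auto
  then show "u \<in> {a * x + y | a y. a \<in> endos \<alpha> \<and> y \<in> N}" using intertw_zero
    by blast
qed

lemma max_left_ideal_inv:
  assumes "max_left_ideal \<alpha> N" "x \<in> endos \<alpha>" "x \<notin> N"
  shows "\<exists>a\<in>endos \<alpha>. a * x - 1 \<in> N"
proof -
  let ?M = "{a * x + y | a y. a \<in> endos \<alpha> \<and> y \<in> N}"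
  have N: "left_ideal \<alpha> N" using assms(1) unfolding max_left_ideal_def by blast
  have M: "left_ideal \<alpha> ?M" using left_ideal_adjoin[OF N assms(2)] .
  have "N \<subseteq> ?M"
  proof
    fix y assume "y \<in> N"
    moreover have "y = 0 * x + y" by simp
    ultimately show "y \<in> ?M" using intertw_zero by blast
  qed
  moreover have "x \<in> ?M"
  proof -
    have "x = 1 * x + 0" by simp
    then show ?thesis using intertw_one left_ideal_zero[OF N] by blast
  qed
  ultimately have "1 \<in> ?M" using assms(1,3) M unfolding max_left_ideal_def by blast
  then obtain a y where a: "1 = a * x + y" "a \<in> endos \<alpha>" "y \<in> N" by blast
  then have "a * x - 1 = - y" by (simp add: algebra_simps)
  then show ?thesis using a left_ideal_minus[OF N, of y] by metis
qed

definition trace_in ::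
  "('s \<Rightarrow> 'a) \<Rightarrow> 's set \<Rightarrow> 'a set \<Rightarrow> bool" where
  "trace_in \<alpha> V N
    \<longleftrightarrow> (\<forall>x\<in>intertw \<alpha> \<alpha> V. rel_trace \<alpha> \<alpha> V
      (carrier K) x \<in> N)"

text \<open>Modulo \<open>mA\<close> the elements \<open>h' * h\<close> and \<open>h * h'\<close>
  are idempotents that cut out isomorphic summands of the two modules.\<close>

definition partial_iso ::
  "('s \<Rightarrow> 'a) \<Rightarrow> ('s \<Rightarrow> 'a) \<Rightarrow> 'a \<Rightarrow> 'a
    \<Rightarrow> bool" where
  "partial_iso \<alpha> \<beta> h h'
    \<longleftrightarrow> h \<in> intertw \<alpha> \<beta> (carrier K) \<and> h' \<in> intertw
      \<beta> \<alpha> (carrier K) \<and>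
     h * h' * h \<approx> h \<and> h' * h * h' \<approx> h'"

lemma partial_iso_sym: "partial_iso \<alpha> \<beta> h h'
  \<Longrightarrow> partial_iso \<beta> \<alpha> h' h" unfolding partial_iso_def by blast

lemma intertw_carrier: "subgroup R K \<Longrightarrow> x \<in> intertw \<alpha> \<beta> (carrier K)
  \<Longrightarrow> x \<in> intertw \<alpha> \<beta> R"
  using intertw_mono subgroup.subset by blast

text \<open>
  If all these traces were in \<open>N\<close>, then \<open>z = h' a\<close> would act injectively on the quotient of the
  \<open>R\<close>-fixed points by \<open>{b. tr(c b) \<in> N for all c}\<close>. This has finite length, so \<open>z\<close> would act surjectively,
  although \<open>h' a\<close> maps into the part cut out by \<open>h' h\<close>.
\<close>

lemma nonradical_trace_exists:
  assumes \<alpha>: "unit_representation \<alpha>" and \<beta>: "unit_representation \<beta>" and R: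
    "subgroup R K" and N: "left_ideal \<alpha> N"
    and pi: "partial_iso \<alpha> \<beta> h h'" and eN: "h' * h \<in> N"
    and a: "a \<in> intertw \<alpha> \<beta> R" and a': "a' \<in> intertw \<beta> \<alpha> R"
    and inv: "\<And>c b. c \<in> intertw \<alpha> \<alpha> R
      \<Longrightarrow> b \<in> intertw \<alpha> \<alpha> R \<Longrightarrow> rel_trace \<alpha>
        \<alpha> R (carrier K) (c * (a' * a - 1) * b) \<in> N"
    and x0: "x0 \<in> intertw \<alpha> \<alpha> R" and tx0:
      "rel_trace \<alpha> \<alpha> R (carrier K) x0 \<notin> N"
  shows "\<exists>c\<in>intertw \<beta> \<alpha> R. \<exists>b\<in>intertw \<alpha> \<beta> R.
    rel_trace \<alpha> \<alpha> R (carrier K) (c * (1 - h * h') * b) \<notin> N"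
proof (rule ccontr)
  assume "\<not> ?thesis"
  then have off: "rel_trace \<alpha> \<alpha> R (carrier K) (c * (1 - h * h') * b) \<in> N"
    if "c \<in> intertw \<beta> \<alpha> R" "b \<in> intertw \<alpha> \<beta> R" for c b
    using that by blast
  let ?t = "rel_trace \<alpha> \<alpha> R (carrier K)"
  have h: "h \<in> intertw \<alpha> \<beta> R" "h' \<in> intertw \<beta> \<alpha> R"
    using pi intertw_carrier[OF R] unfolding partial_iso_def by auto
  define z where "z = h' * a"
  have z: "z \<in> intertw \<alpha> \<alpha> R" unfolding z_def using h a intertw_mult by blast
  have zinj: "\<forall>c\<in>intertw \<alpha> \<alpha> R. ?t (c * b) \<in> N"
    if b: "b \<in> intertw \<alpha> \<alpha> R" and zb:
      "\<forall>c\<in>intertw \<alpha> \<alpha> R. ?t (c * (z * b)) \<in> N" for b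
  proof
    fix c assume c: "c \<in> intertw \<alpha> \<alpha> R"
    \<comment> \<open>Here 1 is replaced by \<open>a' * a\<close>, then \<open>h * h'\<close> and
      \<open>1 - h * h'\<close> are inserted in the middle. The last term falls under
      \<open>inv\<close>, which asks for an inverse only up to traces in \<open>N\<close> and so
      admits twisted units.\<close>
    have "c * b = (c * a' * h) * (z * b) + (c * a') * (1 - h * h') * (a * b) - c * (a' * a - 1) * b"
      unfolding z_def by (simp add: algebra_simps)
    moreover have "?t ((c * a' * h) * (z * b)) \<in> N" using zb c a' h intertw_mult by blast
    moreover have "?t ((c * a') * (1 - h * h') * (a * b)) \<in> N" using off c a a' b intertw_mult
      by blast
    moreover have "?t (c * (a' * a - 1) * b) \<in> N" using inv c b by blast
    ultimately show "?t (c * b) \<in> N"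
      by (simp add: rel_trace_add rel_trace_diff left_ideal_add[OF N] left_ideal_diff[OF N])
  qed
  have zpow: "\<forall>c\<in>intertw \<alpha> \<alpha> R. ?t (c * b) \<in> N"
    if "b \<in> intertw \<alpha> \<alpha> R" "\<forall>c\<in>intertw \<alpha> \<alpha> R. ?t (c
      * (z ^ k * b)) \<in> N" for b k
    using that
  proof (induction k)
    case (Suc k)
    have "z ^ k * b \<in> intertw \<alpha> \<alpha> R"
      using subalg_power[OF subalg_intertw z] Suc.prems(1) intertw_mult by blast
    then have "\<forall>c\<in>intertw \<alpha> \<alpha> R. ?t (c * (z ^ k * b)) \<in> N"
      using zinj Suc.prems(2) by (simp add: mult.assoc)
    then show ?case using Suc by blast
  qed simp
  obtain k q where q: "q \<in> intertw \<alpha> \<alpha> R" "z ^ Suc k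
    \<approx> z ^ Suc (Suc k) * q"
    using fitting[OF subalg_intertw z] by blast
  \<comment> \<open>By Fitting's relation a power of z kills \<open>1 - z * q\<close> modulo
    \<open>mA\<close>; injectivity of z then puts \<open>x\<close> into the subset that is divided
    out.\<close>
  define x where "x = 1 - z * q"
  have x: "x \<in> intertw \<alpha> \<alpha> R" unfolding x_def
    using intertw_diff intertw_one intertw_mult z q by blast
  have "z ^ Suc k * x = z ^ Suc k - z ^ Suc (Suc k) * q"
    unfolding x_def power_Suc2[of z "Suc k"]
      by (simp only: right_diff_distrib mult.assoc mult_1_right)
  then have zx: "z ^ Suc k * x \<in> mA" using q(2) unfolding cong_mA_def by simp
  have tmA: "?t y \<in> N" if "y \<in> mA" "y \<in> intertw \<alpha> \<alpha> R" for y
    using that rel_trace_mA rel_trace_intertw[OF \<alpha> \<alpha> R subgroup_self] left_ideal_mA[OF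
      N] by blast
  have "\<forall>c\<in>intertw \<alpha> \<alpha> R. ?t (c * (z ^ Suc k * x)) \<in> N"
    using tmA mA_mult_left[OF zx] intertw_mult subalg_power[OF subalg_intertw z] x by blast
  then have xK: "\<forall>c\<in>intertw \<alpha> \<alpha> R. ?t (c * x) \<in> N" using zpow x
    by blast
  have e2: "1 - h' * h \<in> endos \<alpha>" using intertw_diff intertw_one intertw_mult pi
    unfolding partial_iso_def by blast
  then have e2R: "1 - h' * h \<in> intertw \<alpha> \<alpha> R" using intertw_carrier[OF R] by blast
  have 1: "?t (x0 * (1 - h' * h) * x) \<in> N" using xK e2R x0 intertw_mult by blast
  \<comment> \<open>\<open>1 - h' * h\<close> kills the image of z modulo \<open>mA\<close>, so
    multiplying it by \<open>1 - z * q\<close> changes it only by an error in \<open>mA\<close>.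
    This \<open>\<mu>\<close> is that error, with \<open>x0\<close> in front.\<close>
  define \<mu> where "\<mu> = x0 * (h' - h' * h * h') * (a * q)"
  have "h' - h' * h * h' \<in> mA" using pi cong_mA_sym unfolding partial_iso_def cong_mA_def
    by blast
  then have "\<mu> \<in> mA" unfolding \<mu>_def by (intro mA_mult_left mA_mult_right)
  moreover have eq: "x0 * (1 - h' * h) = x0 * (1 - h' * h) * x + \<mu>"
    unfolding \<mu>_def x_def z_def by (simp add: algebra_simps)
  moreover have "\<mu> \<in> intertw \<alpha> \<alpha> R"
  proof -
    have "\<mu> = x0 * (1 - h' * h) - x0 * (1 - h' * h) * x" using eq by (simp add: algebra_simps)
    then show ?thesis using x0 e2R x intertw_mult intertw_diff by metis
  qed
  ultimately have "?t (x0 * (1 - h' * h)) \<in> N" using tmA 1 rel_trace_add left_ideal_add[OF N]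
    by metis
  then have "?t x0 * (1 - h' * h) \<in> N"
    using rel_trace_mult_right[OF \<alpha> \<alpha> R subgroup_self e2] by metis
  moreover have "?t x0 * (h' * h) \<in> N"
    using left_ideal_mult[OF N] rel_trace_intertw[OF \<alpha> \<alpha> R subgroup_self x0] eN
      by blast
  ultimately have "?t x0 * (1 - h' * h) + ?t x0 * (h' * h) \<in> N" using left_ideal_add[OF N]
    by blast
  then show False using tx0 by (simp add: algebra_simps)
qed

text \<open>The four vanishing products are the mixed terms when \<open>(h + b, h' + c)\<close> is
  tested for being a partial isomorphism. That c is nonzero modulo \<open>mA\<close> as well follows
  from b being congruent to \<open>b * c * b\<close>.\<close>

definition orthogonal_partial_iso ::
  "('s \<Rightarrow> 'a) \<Rightarrow> ('s \<Rightarrow> 'a) \<Rightarrow> 'a \<Rightarrow> 'a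
    \<Rightarrow> 'a \<Rightarrow> 'a \<Rightarrow> bool" where
  "orthogonal_partial_iso \<alpha> \<beta> h h' b c
    \<longleftrightarrow> partial_iso \<alpha> \<beta> b c \<and> b \<notin> mA \<and> c * h
      \<approx> 0 \<and> h' * b \<approx> 0 \<and> b * h' \<approx> 0 \<and> h * c \<approx> 0"

lemma orthogonal_partial_iso_sym: assumes "orthogonal_partial_iso \<alpha> \<beta> h h' b c"
  shows "orthogonal_partial_iso \<beta> \<alpha> h' h c b"
proof -
  have "c \<notin> mA"
  proof
    assume "c \<in> mA"
    then have "b * c * b \<in> mA" using mA_mult_left mA_mult_right by blast
    moreover have "b \<approx> b * c * b" using assms cong_mA_sym
      unfolding orthogonal_partial_iso_def partial_iso_def by blast
    ultimately have "b \<approx> 0" using cong_mA_trans cong_mA_zero_iff by blast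
    then show False using assms unfolding orthogonal_partial_iso_def cong_mA_zero_iff by blast
  qed
  then show ?thesis using assms partial_iso_sym unfolding orthogonal_partial_iso_def by blast
qed

text \<open>A left multiple of \<open>c * (1 - h * h') * b\<close> is 1 modulo \<open>N\<close>.
  Compressed to the complement of \<open>h' * h\<close> it becomes an element z with all powers
  congruent to 1 modulo \<open>N\<close>, hence not nilpotent modulo \<open>mA\<close>, and
  \<open>fitting\<close> extracts from z a nonzero idempotent that factors through \<beta>.\<close>

lemma orthogonal_partial_iso_of_nonradical:
  assumes N: "max_left_ideal \<alpha> N" and pi: "partial_iso \<alpha> \<beta> h h'" and eN: "h' * h
    \<in> N"
    and b: "b \<in> intertw \<alpha> \<beta> (carrier K)" and c: "c
      \<in> intertw \<beta> \<alpha> (carrier K)"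
    and cb: "c * (1 - h * h') * b \<notin> N"
  shows "\<exists>b c. orthogonal_partial_iso \<alpha> \<beta> h h' b c"
proof -
  have Nl: "left_ideal \<alpha> N" and N1: "1 \<notin> N" using N unfolding max_left_ideal_def
    by auto
  have h: "h \<in> intertw \<alpha> \<beta> (carrier K)" "h'
    \<in> intertw \<beta> \<alpha> (carrier K)" "h * h' * h \<approx> h" "h' * h * h' \<approx> h'"
    using pi unfolding partial_iso_def by auto
  define f where "f = 1 - h * h'"
  define e where "e = 1 - h' * h"
  have f: "f \<in> endos \<beta>" unfolding f_def using h intertw_mult intertw_one intertw_diff
    by blast
  have e: "e \<in> endos \<alpha>" unfolding e_def using h intertw_mult intertw_one intertw_diff
    by blast
  have fh: "f * h \<approx> 0" unfolding f_def using cong_mA_sym[OF h(3)]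
    by (simp add: cong_mA_def algebra_simps)
  have hf: "h' * f \<approx> 0" unfolding f_def using cong_mA_sym[OF h(4)]
    by (simp add: cong_mA_def algebra_simps)
  have eh: "e * h' \<approx> 0" unfolding e_def using cong_mA_sym[OF h(4)]
    by (simp add: cong_mA_def algebra_simps)
  have he: "h * e \<approx> 0" unfolding e_def using cong_mA_sym[OF h(3)]
    by (simp add: cong_mA_def algebra_simps)
  have ff: "f * f \<approx> f"
  proof -
    have "f * f - f = - (f * h) * h'" unfolding f_def by (simp add: algebra_simps)
    moreover have "- (f * h) * h' \<in> mA" using fh mA_mult_right mA_minus
      unfolding cong_mA_zero_iff by blast
    ultimately show ?thesis unfolding cong_mA_def by simp
  qed
  have "c * f * b \<in> endos \<alpha>" using c f b intertw_mult by blast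
  then obtain l where l: "l \<in> endos \<alpha>" "l * (c * f * b) - 1 \<in> N"
    using max_left_ideal_inv[OF N] cb unfolding f_def by blast
  define w where "w = l * (c * f * b)"
  have w: "w \<in> endos \<alpha>" unfolding w_def using l c f b intertw_mult by blast
  \<comment> \<open>The factors f on the side of \<beta> and e on the side of \<alpha> are what
    produce the orthogonality relations.\<close>
  define B where "B = f * b * e"
  define C where "C = e * l * c * f"
  have B: "B \<in> intertw \<alpha> \<beta> (carrier K)" unfolding B_def using f b e intertw_mult
    by blast
  have C: "C \<in> intertw \<beta> \<alpha> (carrier K)" unfolding C_def using f c l e intertw_mult
    by blast
  define z where "z = C * B"
  have z: "z \<in> endos \<alpha>" unfolding z_def using B C intertw_mult by blast
  have z1: "z - 1 \<in> N"
  proof -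
    have "z = (e * l * c) * (f * f) * (b * e)" unfolding z_def C_def B_def
      by (simp only: mult.assoc)
    also have "\<dots> \<approx> (e * l * c) * f * (b * e)" using ff
      by (intro cong_mA_mult_left cong_mA_mult_right)
    also have "\<dots> = e * w * e" unfolding w_def by (simp only: mult.assoc)
    finally have "z - e * w * e \<in> mA" unfolding cong_mA_def .
    moreover have "z - e * w * e \<in> endos \<alpha>"
      by (rule intertw_diff[OF z intertw_mult[OF intertw_mult[OF e w] e]])
    ultimately have 1: "z - e * w * e \<in> N" by (rule left_ideal_mA[OF Nl])
    \<comment> \<open>\<open>N\<close> is only a left ideal: multiplying w by e on the right is
      harmless because \<open>h' * h\<close> lies in \<open>N\<close>.\<close>
    have "w * e - 1 = (w - 1) - w * (h' * h)" unfolding e_def by (simp add: algebra_simps)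
    then have 2: "w * e - 1 \<in> N"
      using left_ideal_diff[OF Nl l(2)[folded w_def] left_ideal_mult[OF Nl w eN]] by metis
    have "e * w * e - 1 = (w * e - 1) - (h' * h) * (w * e - 1) - h' * h"
      unfolding e_def by (simp add: algebra_simps)
    then have 3: "e * w * e - 1 \<in> N" 
      using left_ideal_diff[OF Nl left_ideal_diff[OF Nl 2 left_ideal_mult[OF Nl left_ideal_endos[OF
        Nl eN] 2]] eN] by metis
    show ?thesis using left_ideal_add[OF Nl 1 3] by simp
  qed
  have zk1: "z ^ k - 1 \<in> N" for k
  proof (induction k)
    case (Suc k)
    have "z ^ Suc k - 1 = z * (z ^ k - 1) + (z - 1)" by (simp add: algebra_simps)
    then show ?case using left_ideal_add[OF Nl left_ideal_mult[OF Nl z Suc] z1] by metis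
  qed (use left_ideal_zero[OF Nl] in simp)
  obtain n q where q: "q \<in> endos \<alpha>" "z * q = q * z" "z ^ Suc n
    \<approx> z ^ Suc (Suc n) * q"
    using fitting[OF subalg_intertw z] by blast
  have comm: "z ^ i * q ^ j = q ^ j * z ^ i" for i j
    using power_commuting_commutes[OF power_commuting_commutes[OF q(2), of i, symmetric], of j]
      by simp
  \<comment> \<open>One of the k factors z will be supplied by the product of C and B, which leaves
    the \<open>z ^ n\<close> in \<open>C1\<close>.\<close>
  define k where "k = Suc n"
  have zk: "z ^ k \<approx> z ^ k * (z ^ j * q ^ j)" for j
  proof (induction j)
    case (Suc j)
    have "z ^ k * (z ^ j * q ^ j) \<approx> z ^ Suc k * q * (z ^ j * q ^ j)"
      using q(3) unfolding k_def by (rule cong_mA_mult_right)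
    also have "z ^ Suc k * q * (z ^ j * q ^ j) = z ^ Suc k * (q * z ^ j) * q ^ j"
      by (simp only: mult.assoc)
    also have "q * z ^ j = z ^ j * q" using comm[of j 1] by simp
    also have "z ^ Suc k * (z ^ j * q) * q ^ j = z ^ k * (z ^ Suc j * q ^ Suc j)"
      unfolding power_Suc[of q] power_Suc2[of z k] power_Suc[of z j] by (simp only: mult.assoc)
    finally show ?case using Suc cong_mA_trans by blast
  qed simp
  \<comment> \<open>The case j = k of \<open>zk\<close>: this element acts as the identity on
    \<open>z ^ k\<close> modulo \<open>mA\<close>, which also makes it idempotent.\<close>
  define \<epsilon> where "\<epsilon> = z ^ k * q ^ k"
  have \<epsilon>: "\<epsilon> \<in> endos \<alpha>" unfolding \<epsilon>_def
    by (rule intertw_mult[OF subalg_power[OF subalg_intertw z] subalg_power[OF subalg_intertw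
      q(1)]])
  have z\<epsilon>: "z ^ k \<approx> z ^ k * \<epsilon>" using zk[of k] unfolding \<epsilon>_def .
  have \<epsilon>\<epsilon>: "\<epsilon> * \<epsilon> \<approx> \<epsilon>"
  proof -
    have "\<epsilon> * \<epsilon> = q ^ k * (z ^ k * \<epsilon>)" unfolding \<epsilon>_def
      by (simp only: comm mult.assoc)
    also have "\<dots> \<approx> q ^ k * z ^ k" using cong_mA_sym[OF z\<epsilon>]
      by (rule cong_mA_mult_left)
    also have "q ^ k * z ^ k = \<epsilon>" unfolding \<epsilon>_def comm ..
    finally show ?thesis .
  qed
  define B1 where "B1 = B * \<epsilon>"
  define C1 where "C1 = \<epsilon> * (z ^ n * q ^ k) * C"
  have B1: "B1 \<in> intertw \<alpha> \<beta> (carrier K)" unfolding B1_def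
    using B \<epsilon> intertw_mult by blast
  have C1: "C1 \<in> intertw \<beta> \<alpha> (carrier K)" unfolding C1_def
    by (rule intertw_mult[OF intertw_mult[OF \<epsilon> intertw_mult[OF subalg_power[OF
      subalg_intertw z] subalg_power[OF subalg_intertw q(1)]]] C])
  have C1B1: "C1 * B1 \<approx> \<epsilon>"
  proof -
    have "C1 * B1 = \<epsilon> * (z ^ n * (q ^ k * z ^ 1)) * \<epsilon>"
      unfolding C1_def B1_def z_def by (simp only: mult.assoc power_one_right)
    also have "q ^ k * z ^ 1 = z ^ 1 * q ^ k" using comm[of 1 k] by (rule sym)
    also have "z ^ n * (z ^ 1 * q ^ k) = \<epsilon>" unfolding \<epsilon>_def k_def
      by (simp add: power_commutes flip: mult.assoc)
    finally have "C1 * B1 = \<epsilon> * \<epsilon> * \<epsilon>" .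
    also have "\<dots> \<approx> \<epsilon> * \<epsilon>" using \<epsilon>\<epsilon>
      by (rule cong_mA_mult_right)
    also have "\<dots> \<approx> \<epsilon>" by (rule \<epsilon>\<epsilon>)
    finally show ?thesis .
  qed
  have "B1 * C1 * B1 \<approx> B1"
  proof -
    have "B1 * C1 * B1 \<approx> B1 * \<epsilon>" using cong_mA_mult_left[OF C1B1, of B1]
      by (simp add: mult.assoc)
    also have "B1 * \<epsilon> \<approx> B1" unfolding B1_def
      using cong_mA_mult_left[OF \<epsilon>\<epsilon>, of B] by (simp add: mult.assoc)
    finally show ?thesis .
  qed
  moreover have "C1 * B1 * C1 \<approx> C1"
  proof -
    have "C1 * B1 * C1 \<approx> \<epsilon> * C1" using C1B1 by (rule cong_mA_mult_right)
    also have "\<epsilon> * C1 \<approx> C1" unfolding C1_def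
      using cong_mA_mult_right[OF \<epsilon>\<epsilon>, of "z ^ n * q ^ k * C"]
        by (simp add: mult.assoc)
    finally show ?thesis .
  qed
  ultimately have "partial_iso \<alpha> \<beta> B1 C1" using B1 C1 unfolding partial_iso_def
    by blast
  moreover have "B1 \<notin> mA"
  proof
    assume "B1 \<in> mA"
    then have "C1 * B1 \<approx> 0" using mA_mult_left cong_mA_zero_iff by blast
    then have "\<epsilon> \<approx> 0" using C1B1 cong_mA_sym cong_mA_trans by blast
    then have "z ^ k \<approx> 0" using z\<epsilon> cong_mA_zero_left cong_mA_trans by blast
    then have "z ^ k \<in> N" using left_ideal_mA[OF Nl] subalg_power[OF subalg_intertw z]
      unfolding cong_mA_zero_iff by blast
    then have "z ^ k - (z ^ k - 1) \<in> N" using zk1 left_ideal_diff[OF Nl] by blast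
    then show False using N1 by simp
  qed
  moreover have "C1 * h \<approx> 0" unfolding C1_def C_def 
    using cong_mA_zero_left[OF fh, of "\<epsilon> * (z ^ n * q ^ k) * e * l * c"]
      by (simp add: mult.assoc)
  moreover have "h' * B1 \<approx> 0"
    using cong_mA_zero_right[OF hf, of "b * e * \<epsilon>"] unfolding B1_def B_def
      by (simp add: mult.assoc)
  moreover have "B1 * h' \<approx> 0"
  proof -
    \<comment> \<open>The idempotent is written with the powers of z last: the final z ends in e,
      which kills \<open>h'\<close>. For \<open>h * C1\<close> the leading z, which begins with e,
      does the same.\<close>
    have "B1 * h' = (B * q ^ k * z ^ n * C * f * b) * (e * h')"
      unfolding B1_def \<epsilon>_def comm[of k k] unfolding k_def power_Suc2
        unfolding z_def[symmetric]
      using z_def B_def by (simp only: mult.assoc)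
    then show ?thesis using cong_mA_zero_left[OF eh] by simp
  qed
  moreover have "h * C1 \<approx> 0"
  proof -
    have "h * C1 = (h * e) * (l * c * f * B * z ^ n * q ^ k * (z ^ n * q ^ k) * C)"
      unfolding C1_def \<epsilon>_def k_def power_Suc[of z] using z_def C_def
        by (simp only: mult.assoc)
    then show ?thesis using cong_mA_zero_right[OF he] by simp
  qed
  ultimately show ?thesis unfolding orthogonal_partial_iso_def by blast
qed

end

section \<open>Making morphisms fixed by the whole group\<close>

text \<open>\<open>i * (p ^ n choose i)\<close> is a multiple of \<open>p ^ n\<close>; if p did not
  divide the binomial coefficient, \<open>p ^ n\<close> would divide i.\<close>

lemma prime_dvd_prime_power_choose:
  fixes p :: nat
  assumes "prime p" "0 < i" "i < p ^ n"
  shows "p dvd (p ^ n choose i)"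
proof (rule ccontr)
  assume "\<not> p dvd (p ^ n choose i)"
  then have cop: "coprime (p ^ n) (p ^ n choose i)"
    using assms(1) by (simp add: prime_imp_coprime)
  have "i * (p ^ n choose i) = p ^ n * ((p ^ n - 1) choose (i - 1))"
    using times_binomial_minus1_eq[OF assms(2), of "p ^ n"] by simp
  then have "p ^ n dvd i * (p ^ n choose i)" by simp
  then have "p ^ n dvd i" using cop by (simp add: coprime_dvd_mult_left_iff)
  then show False using assms by (simp add: nat_dvd_not_less)
qed

context p_group_alg
begin

lemma twist_of_nat: "twist \<alpha> \<beta> g (of_nat k * x)
  = of_nat k * twist \<alpha> \<beta> g x"
  unfolding twist_def by (metis mult.assoc mult_of_nat_commute)

text \<open>The expansion of g^j = (1 + (g - 1))^j, read as operators.\<close>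

lemma twist_power_binomial:
  assumes "unit_representation \<alpha>" "unit_representation \<beta>" "g \<in> carrier K"
  shows "twist \<alpha> \<beta> (g [^] (j::nat)) x
    = (\<Sum>i\<le>j. of_nat (j choose i) * ((\<lambda>y. twist \<alpha> \<beta> g y - y) ^^ i) x)"
proof (induction j)
  case 0
  then show ?case using twist_one assms by simp
next
  case (Suc j)
  define d where "d i = ((\<lambda>y. twist \<alpha> \<beta> g y - y) ^^ i) x" for i
  have twist_d: "twist \<alpha> \<beta> g (d i) = d (Suc i) + d i" for i unfolding d_def by simp
  have "twist \<alpha> \<beta> (g [^] Suc j) x
    = twist \<alpha> \<beta> g (twist \<alpha> \<beta> (g [^] j) x)"
    using twist_comp[OF assms, of "g [^] j"] assms(3) nat_pow_Suc2 by simp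
  also have "\<dots> = (\<Sum>i\<le>j. of_nat (j choose i) * (d (Suc i) + d i))"
    unfolding Suc d_def[symmetric] twist_sum twist_of_nat twist_d ..
  also have "\<dots>
    = (\<Sum>i\<le>j. of_nat (j choose i) * d (Suc i)) + (\<Sum>i\<le>j. of_nat (j choose i) * d i)"
    by (simp add: distrib_left sum.distrib)
  also have "(\<Sum>i\<le>j. of_nat (j choose i) * d i)
    = (\<Sum>i\<le>Suc j. of_nat (j choose i) * d i)"
    by (simp add: binomial_eq_0)
  also have "\<dots> = d 0 + (\<Sum>i\<le>j. of_nat (j choose Suc i) * d (Suc i))"
    by (simp add: sum.atMost_Suc_shift del: sum.atMost_Suc)
  also have "(\<Sum>i\<le>j. of_nat (j choose i) * d (Suc i)) + (d 0
    + (\<Sum>i\<le>j. of_nat (j choose Suc i) * d (Suc i)))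
     = d 0 + (\<Sum>i\<le>j. of_nat (Suc j choose Suc i) * d (Suc i))"
    by (simp add: sum.distrib distrib_right)
  also have "\<dots> = (\<Sum>i\<le>Suc j. of_nat (Suc j choose i) * d i)"
    by (simp add: sum.atMost_Suc_shift del: sum.atMost_Suc)
  finally show ?case unfolding d_def .
qed

lemma of_nat_p_mA: assumes "p dvd k" shows "of_nat k * x \<in> mA"
proof -
  have sn: "smul (of_nat j) x = of_nat j * x" for j
    by (induction j) (simp_all add: scale_left_distrib distrib_right)
  obtain r where "k = p * r" using assms by (rule dvdE)
  then have "(of_nat k :: 'o) \<in> m" using m_mult2[OF pm] by simp
  then show ?thesis using mA_smul[of "of_nat k" x] sn by simp
qed

text \<open>Modulo \<open>p\<close> the operator \<open>(g - 1)^|K|\<close> vanishes.\<close>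

lemma fixed_vector:
  assumes \<alpha>: "unit_representation \<alpha>" and \<beta>: "unit_representation \<beta>" and H:
    "H \<lhd> K" and HK: "H \<noteq> carrier K"
    and max: "\<And>L. \<lbrakk>subgroup L K; H \<subseteq> L\<rbrakk> \<Longrightarrow> L = H
      \<or> L = carrier K"
    and D: "D \<subseteq> intertw \<alpha> \<beta> H" "\<And>x y. x \<in> D
      \<Longrightarrow> y \<in> D \<Longrightarrow> x - y \<in> D"
      "\<And>g x. g \<in> carrier K \<Longrightarrow> x \<in> D
        \<Longrightarrow> twist \<alpha> \<beta> g x \<in> D"
    and M: "\<And>x y. x \<in> M \<Longrightarrow> y \<in> M
      \<Longrightarrow> x + y \<in> M" "\<And>x. x \<in> M \<Longrightarrow> - x \<in> M"
      "\<And>g x. g \<in> carrier K \<Longrightarrow> x \<in> M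
        \<Longrightarrow> twist \<alpha> \<beta> g x \<in> M"
      "\<And>x. x \<in> mA \<Longrightarrow> x \<in> intertw \<alpha> \<beta> H
        \<Longrightarrow> x \<in> M"
    and b: "b \<in> D" "b \<notin> M"
  shows "\<exists>d\<in>D. d \<notin> M
    \<and> (\<forall>g\<in>carrier K. twist \<alpha> \<beta> g d - d \<in> M)"
proof -
  interpret H: normal H K by (rule H)
  obtain g where g: "g \<in> carrier K" "g \<notin> H" using HK H.subset by blast
  define \<delta> where "\<delta> i = ((\<lambda>y. twist \<alpha> \<beta> g y - y) ^^ i) b" for i
  have \<delta>D: "\<delta> i \<in> D" for i unfolding \<delta>_def
    by (induction i) (use D g b in auto)
  define N where "N = p ^ n"
  have N0: "0 < N" unfolding N_def using p prime_gt_0_nat by simp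
  have "\<delta> N \<in> mA"
  proof -
    have "g [^] N = \<one>" using pow_order_eq_1[OF g(1)] ordK unfolding N_def by simp
    then have "b = (\<Sum>i\<le>N. of_nat (N choose i) * \<delta> i)"
      using twist_power_binomial[OF \<alpha> \<beta> g(1), of N b] twist_one[OF \<alpha> \<beta>]
        unfolding \<delta>_def by simp
    \<comment> \<open>The term 0 is b and cancels with the left side, as g^N = 1; the term N is the
      one wanted; the coefficients between are divisible by p.\<close>
    also have "{..N} = insert 0 (insert N {0<..<N})" by auto
    also have "(\<Sum>i\<in>\<dots>. of_nat (N choose i) * \<delta> i)
      = b + (\<delta> N + (\<Sum>i\<in>{0<..<N}. of_nat (N choose i) * \<delta> i))"
      using N0 by (simp add: \<delta>_def)
    finally have "\<delta> N = - (\<Sum>i\<in>{0<..<N}. of_nat (N choose i) * \<delta> i)"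
      by (simp add: eq_neg_iff_add_eq_0)
    moreover have "(\<Sum>i\<in>{0<..<N}. of_nat (N choose i) * \<delta> i) \<in> mA"
      by (intro mA_sum of_nat_p_mA) (simp add: N_def prime_dvd_prime_power_choose[OF p])
    ultimately show ?thesis using mA_minus by simp
  qed
  then have ex: "\<delta> N \<in> M" using M(4) \<delta>D D(1) by blast
  \<comment> \<open>The term just before the first one in M is fixed by g modulo M, as its
    difference from its twist is that first one.\<close>
  define j where "j = (LEAST i. \<delta> i \<in> M)"
  have j: "\<delta> j \<in> M" unfolding j_def using ex by (rule LeastI)
  have "\<delta> 0 \<notin> M" using b unfolding \<delta>_def by simp
  then obtain i where i: "j = Suc i" using j by (cases j) auto
  define d where "d = \<delta> i"
  have d: "d \<in> D" "d \<notin> M" unfolding d_def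
    using \<delta>D not_less_Least[of i "\<lambda>i. \<delta> i \<in> M"] i unfolding j_def by auto
  \<comment> \<open>The stabilizer of d modulo M. It contains H and the element g outside H, hence
    is everything by maximality of H.\<close>
  define S where "S = {s \<in> carrier K. twist \<alpha> \<beta> s d - d \<in> M}"
  have zM: "0 \<in> M" using M(4) mA_zero intertw_zero by blast
  have "twist \<alpha> \<beta> s d = d" if "s \<in> H" for s
    using intertw_iff_twist[OF \<alpha> H.subset, of d \<beta>] d(1) D(1) that by blast
  then have HS: "H \<subseteq> S" unfolding S_def using zM H.subset by auto
  have "subgroup S K"
  proof (rule subgroupI)
    show "S \<subseteq> carrier K" unfolding S_def by blast
    show "S \<noteq> {}" using HS H.one_closed by blast
    fix s assume s: "s \<in> S"
    then have sc: "s \<in> carrier K" unfolding S_def by blast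
    have "twist \<alpha> \<beta> (inv s) d - d
      = - twist \<alpha> \<beta> (inv s) (twist \<alpha> \<beta> s d - d)"
      using twist_comp[OF \<alpha> \<beta> inv_closed[OF sc] sc] sc twist_one[OF \<alpha> \<beta>]
        by (simp add: twist_diff)
    then show "inv s \<in> S" using M(2,3) s sc unfolding S_def by simp
    fix t assume t: "t \<in> S"
    then have tc: "t \<in> carrier K" unfolding S_def by blast
    have "twist \<alpha> \<beta> (s \<otimes> t) d - d
      = twist \<alpha> \<beta> s (twist \<alpha> \<beta> t d - d) + (twist \<alpha> \<beta> s d -
        d)"
      using twist_comp[OF \<alpha> \<beta> sc tc] by (simp add: twist_diff)
    moreover have "twist \<alpha> \<beta> s (twist \<alpha> \<beta> t d - d)
      + (twist \<alpha> \<beta> s d - d) \<in> M"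
      using M(1,3) s t sc unfolding S_def by blast
    ultimately have "twist \<alpha> \<beta> (s \<otimes> t) d - d \<in> M" by metis
    then show "s \<otimes> t \<in> S" using sc tc unfolding S_def by simp
  qed
  moreover have "g \<in> S"
  proof -
    have "twist \<alpha> \<beta> g d - d = \<delta> j" unfolding d_def i \<delta>_def by simp
    then show ?thesis using j g unfolding S_def by simp
  qed
  ultimately have "S = carrier K" using max HS g(2) by blast
  then show ?thesis using d unfolding S_def by blast
qed

text \<open>
  Sets closed under addition suffice here: the generators of the Brauer kernel are already closed
  under scalars.
\<close>

definition brauer_ker :: "('s \<Rightarrow> 'a) \<Rightarrow> 'a set" where
  "brauer_ker \<alpha> = {x. \<forall>Z. (\<forall>x\<in>Z. \<forall>y\<in>Z. x + y \<in> Z)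
    \<and> mA \<inter> endos \<alpha> \<subseteq> Z \<and>
     (\<forall>V. subgroup V K \<and> V \<noteq> carrier K \<longrightarrow> trace_in \<alpha> V Z)
       \<longrightarrow> x \<in> Z}"

text \<open>The fixed points x with \<open>c * x * b\<close> in \<open>N\<close> form one of the
  sets that \<open>brauer_ker\<close> intersects, since the Frobenius formula moves c and b inside
  the traces. This admits a right factor although \<open>N\<close> is only a left ideal.\<close>

lemma brauer_ker_ideal:
  assumes \<alpha>: "unit_representation \<alpha>" and N: "left_ideal \<alpha> N"
    and V: "\<And>V. subgroup V K \<Longrightarrow> V \<noteq> carrier K
      \<Longrightarrow> trace_in \<alpha> V N"
    and x: "x \<in> brauer_ker \<alpha>" and c: "c \<in> endos \<alpha>" and b: "b
      \<in> endos \<alpha>"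
  shows "c * x * b \<in> N"
proof -
  define Z where "Z = {x \<in> endos \<alpha>. c * x * b \<in> N}"
  have "\<forall>x\<in>Z. \<forall>y\<in>Z. x + y \<in> Z"
    unfolding Z_def using left_ideal_add[OF N] intertw_add by (simp add: algebra_simps)
  moreover have "mA \<inter> endos \<alpha> \<subseteq> Z"
  proof
    fix y assume y: "y \<in> mA \<inter> endos \<alpha>"
    then have "c * y * b \<in> mA" using mA_mult_left mA_mult_right by blast
    moreover have "c * y * b \<in> endos \<alpha>" using y c b intertw_mult by blast
    ultimately show "y \<in> Z" using y left_ideal_mA[OF N] unfolding Z_def by blast
  qed
  moreover have "trace_in \<alpha> W Z" if W: "subgroup W K" "W \<noteq> carrier K" for W
    unfolding trace_in_def
  proof
    fix y assume y: "y \<in> intertw \<alpha> \<alpha> W"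
    let ?t = "rel_trace \<alpha> \<alpha> W (carrier K)"
    have "c * ?t y * b = ?t (c * y * b)"
      using rel_trace_mult_left[OF \<alpha> W(1) subgroup_self c] rel_trace_mult_right[OF \<alpha>
        \<alpha> W(1) subgroup_self b] by metis
    moreover have "c * y * b \<in> intertw \<alpha> \<alpha> W"
      using y c b intertw_carrier[OF W(1)] intertw_mult by blast
    ultimately have "c * ?t y * b \<in> N" using V[OF W] unfolding trace_in_def by metis
    then show "?t y \<in> Z" using rel_trace_intertw[OF \<alpha> \<alpha> W(1) subgroup_self y]
      unfolding Z_def by blast
  qed
  ultimately have "x \<in> Z" using x unfolding brauer_ker_def by blast
  then show ?thesis unfolding Z_def by blast
qed

lemma card_subgroup_less:
  assumes "subgroup V K" "V \<noteq> carrier K" shows "card V < card (carrier K)"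
  using assms psubset_card_mono[OF finK] subgroup.subset by blast

text \<open>\<open>V0\<close> is a vertex of \<open>N\<close>, and \<open>V0max\<close> keeps the
  vertices on the side of \<beta> from being larger. The pair \<open>u\<close>, \<open>u'\<close>
  serves the case that \<open>V0\<close> is the whole group, \<open>loc\<close> the case of a proper
  \<open>V0\<close>.\<close>

lemma nonradical_exists:
  assumes \<alpha>: "unit_representation \<alpha>" and \<beta>: "unit_representation \<beta>" and
    mN: "max_left_ideal \<alpha> N"
    and pi: "partial_iso \<alpha> \<beta> h h'" and eN: "h' * h \<in> N"
    and V0: "subgroup V0 K" "\<not> trace_in \<alpha> V0 N"
    and V0min: "\<And>V. subgroup V K \<Longrightarrow> card V < card V0
      \<Longrightarrow> trace_in \<alpha> V N"
    and V0max: "\<And>N'. max_left_ideal \<beta> N' \<Longrightarrow> h * h' \<in> N'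
      \<Longrightarrow>
       \<exists>V. subgroup V K \<and> card V \<le> card V0 \<and> \<not> trace_in \<beta> V N'"
    and u: "u \<in> intertw \<alpha> \<beta> (carrier K)" "u'
      \<in> intertw \<beta> \<alpha> (carrier K)" "u' * u - 1 \<in> brauer_ker \<alpha>"
    and loc: "\<And>R. subgroup R K \<Longrightarrow> R \<noteq> carrier K
      \<Longrightarrow> \<exists>a\<in>intertw \<alpha> \<beta> R. \<exists>a'\<in>intertw \<beta>
        \<alpha> R. a' * a = 1"
  shows "\<exists>c\<in>intertw \<beta> \<alpha> (carrier K). \<exists>b\<in>intertw \<alpha>
    \<beta> (carrier K). c * (1 - h * h') * b \<notin> N"
proof (cases "V0 = carrier K")
  case True
  have N: "left_ideal \<alpha> N" and N1: "1 \<notin> N" using mN unfolding max_left_ideal_def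
    by auto
  let ?t = "rel_trace \<alpha> \<alpha> (carrier K) (carrier K)"
  have triv: "?t x = x" if "x \<in> endos \<alpha>" for x
    using rel_trace_self[OF \<alpha> \<alpha> subgroup_self that] .
  \<comment> \<open>By \<open>V0min\<close> all traces from proper subgroups lie in
    \<open>N\<close>, so \<open>u' * u - 1\<close> counts as zero.\<close>
  have inv: "?t (c * (u' * u - 1) * b) \<in> N"
    if cb: "c \<in> endos \<alpha>" "b \<in> endos \<alpha>" for c b
  proof -
    have "c * (u' * u - 1) * b \<in> N"
      by (rule brauer_ker_ideal[OF \<alpha> N _ u(3) cb]) (use V0min True card_subgroup_less in
        blast)
    then show ?thesis using triv left_ideal_endos[OF N] by metis
  qed
  have 1: "?t 1 \<notin> N" using triv[OF intertw_one] N1 by simp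
  obtain c b where cb: "c \<in> intertw \<beta> \<alpha> (carrier K)" "b
    \<in> intertw \<alpha> \<beta> (carrier K)" "?t (c * (1 - h * h') * b) \<notin> N"
    using nonradical_trace_exists[OF \<alpha> \<beta> subgroup_self N pi eN u(1,2) inv intertw_one
      1] by blast
  have "1 - h * h' \<in> endos \<beta>" using pi intertw_one intertw_mult intertw_diff
    unfolding partial_iso_def by blast
  then have "c * (1 - h * h') * b \<in> endos \<alpha>" using cb intertw_mult by blast
  then show ?thesis using cb triv by metis
next
  case False
  have N: "left_ideal \<alpha> N" and N1: "1 \<notin> N" using mN unfolding max_left_ideal_def
    by auto
  obtain H where H: "H \<lhd> K" "V0 \<subseteq> H" "H \<noteq> carrier K"
    and Hmax: "\<And>L. \<lbrakk>subgroup L K; H \<subseteq> L\<rbrakk> \<Longrightarrow> L = H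
      \<or> L = carrier K"
    using p_group_maximal_normal[OF p ordK finK V0(1) False] by blast
  interpret H: normal H K by (rule H(1))
  have Hs: "subgroup H K" by (rule H.subgroup_axioms)
  let ?t = "rel_trace \<alpha> \<alpha> H (carrier K)"
  have hK: "h \<in> intertw \<alpha> \<beta> (carrier K)" "h'
    \<in> intertw \<beta> \<alpha> (carrier K)" "h * h' * h \<approx>
      h" using pi unfolding partial_iso_def by auto
  define f where "f = 1 - h * h'"
  have fK: "f \<in> endos \<beta>" unfolding f_def using hK intertw_one intertw_mult intertw_diff
    by blast
  have fH: "f \<in> intertw \<beta> \<beta> H" using intertw_carrier[OF Hs fK] .
  have hf: "h * h' * f \<approx> 0"
  proof -
    have "h * h' * f = - (h * h' * h - h) * h'" unfolding f_def by (simp add: algebra_simps)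
    moreover have "- (h * h' * h - h) * h' \<in> mA"
      using hK(3) unfolding cong_mA_def by (intro mA_mult_right mA_minus)
    ultimately show ?thesis unfolding cong_mA_zero_iff by simp
  qed
  obtain x0 where x0: "x0 \<in> intertw \<alpha> \<alpha> H" "?t x0 \<notin> N"
  proof -
    obtain x where x: "x
      \<in> intertw \<alpha> \<alpha> V0" "rel_trace \<alpha> \<alpha> V0 (carrier K) x \<notin>
        N" using V0(2) unfolding trace_in_def by blast
    have "?t (rel_trace \<alpha> \<alpha> V0 H x) \<notin> N"
      using rel_trace_trans[OF \<alpha> \<alpha> V0(1) Hs subgroup_self H(2) H.subset x(1)] x(2)
        by simp
    then show ?thesis using that rel_trace_intertw[OF \<alpha> \<alpha> V0(1) Hs x(1)] by blast
  qed
  obtain a a' where a: "a \<in> intertw \<alpha> \<beta> H" "a'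
    \<in> intertw \<beta> \<alpha> H" "a' * a = 1" using loc[OF Hs H(3)] by blast
  have inv: "?t (c * (a' * a - 1) * b) \<in> N" for c b using a(3) left_ideal_zero[OF N] by simp
  obtain c0 b0 where cb0: "c0 \<in> intertw \<beta> \<alpha> H" "b0
    \<in> intertw \<alpha> \<beta> H" "?t (c0 * f * b0) \<notin> N"
    using nonradical_trace_exists[OF \<alpha> \<beta> Hs N pi eN a(1,2) inv x0] unfolding f_def
      by blast
  \<comment> \<open>The radical, in the second argument, of the pairing of c and b by
    \<open>?t (c * b)\<close> modulo \<open>N\<close>. The morphisms below are constructed modulo
    M.\<close>
  define M where "M = {b
    \<in> intertw \<alpha> \<beta> H. \<forall>c\<in>intertw \<beta> \<alpha> H. ?t (c * b) \<in>
      N}"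
  have M_add: "x + y \<in> M" if "x \<in> M" "y \<in> M" for x y
    using that unfolding M_def
      by (simp add: intertw_add distrib_left rel_trace_add left_ideal_add[OF N])
  have M_left: "d * x \<in> M" if "d \<in> intertw \<beta> \<beta> H" "x \<in> M" for d x
    using that intertw_mult unfolding M_def by (simp flip: mult.assoc)
  have M_minus: "- x \<in> M" if "x \<in> M" for x
    using M_left[of "- 1" x] that intertw_diff[OF intertw_zero intertw_one] by simp
  have M_mA: "x \<in> M" if x: "x \<in> mA" "x \<in> intertw \<alpha> \<beta> H" for x
  proof -
    have "?t (c * x) \<in> N" if "c \<in> intertw \<beta> \<alpha> H" for c
      using left_ideal_mA[OF N] rel_trace_mA[OF mA_mult_left[OF x(1)]] rel_trace_intertw[OF \<alpha>
        \<alpha> Hs subgroup_self] intertw_mult[OF that x(2)] by blast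
    then show ?thesis using x unfolding M_def by blast
  qed
  have M_sum: "sum k A \<in> M"
    if "\<And>i. i \<in> A \<Longrightarrow> k i \<in> M" for k :: "'s \<Rightarrow> 'a" and A
    using that by (induction A rule: infinite_finite_induct) (auto intro: M_add M_mA mA_zero
      intertw_zero)
  have M_tw: "twist \<alpha> \<beta> g x \<in> M"
    if g: "g \<in> carrier K" and x: "x \<in> M" for g x
  proof -
    have "?t (c * twist \<alpha> \<beta> g x) \<in> N"
      if c: "c \<in> intertw \<beta> \<alpha> H" for c
    proof -
      \<comment> \<open>The twist is shifted to the other factor, since the trace does not change
        under conjugation.\<close>
      define c' where "c' = twist \<beta> \<alpha> (inv g) c"
      have c': "c' \<in> intertw \<beta> \<alpha> H" unfolding c'_def
        using twist_intertw_normal[OF \<beta> \<alpha> H(1) inv_closed[OF g] c] .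
      have "twist \<beta> \<alpha> g c' = c" unfolding c'_def
        using twist_comp[OF \<beta> \<alpha> g inv_closed[OF g]] g twist_one[OF \<beta> \<alpha>]
          by simp
      then have "c * twist \<alpha> \<beta> g x = twist \<alpha> \<alpha> g (c' * x)"
        using twist_mult[OF \<beta> g] by simp
      then have "?t (c * twist \<alpha> \<beta> g x) = ?t (c' * x)"
        using rel_trace_conj[OF \<alpha> \<alpha> H(1) g] intertw_mult c' x unfolding M_def by simp
      then show ?thesis using c' x unfolding M_def by simp
    qed
    then show ?thesis using twist_intertw_normal[OF \<alpha> \<beta> H(1) g] x unfolding M_def
      by blast
  qed
  have M_diffI: "x \<in> M" if "y \<in> M" "x - y \<in> M" for x y using M_add[OF that(2,1)] by simp

  \<comment> \<open>The fixed endomorphisms that map all H-fixed morphisms into M.\<close>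
  define T where "T = {t
    \<in> endos \<beta>. \<forall>c\<in>intertw \<beta> \<alpha> H. \<forall>b\<in>intertw \<alpha>
      \<beta> H. ?t (c * t * b) \<in> N}"
  have T_add: "x + y \<in> T" if "x \<in> T" "y \<in> T" for x y
    using that unfolding T_def
      by (simp add: intertw_add distrib_left distrib_right rel_trace_add left_ideal_add[OF N])
  have T_left: "d * x \<in> T" if "d \<in> endos \<beta>" "x \<in> T" for d x
    using that intertw_mult intertw_carrier[OF Hs that(1)] unfolding T_def
      by (simp flip: mult.assoc)
  have T_mA: "x \<in> T" if x: "x \<in> mA" "x \<in> endos \<beta>" for x
  proof -
    have "?t (c * x * b) \<in> N"
      if "c \<in> intertw \<beta> \<alpha> H" "b \<in> intertw \<alpha> \<beta> H" for c b
    proof -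
      have "c * x * b \<in> intertw \<alpha> \<alpha> H"
        using that intertw_carrier[OF Hs x(2)] intertw_mult by blast
      moreover have "c * x * b \<in> mA" using x mA_mult_left mA_mult_right by blast
      ultimately show ?thesis
        using left_ideal_mA[OF N] rel_trace_mA rel_trace_intertw[OF \<alpha> \<alpha> Hs
          subgroup_self] by blast
    qed
    then show ?thesis using x unfolding T_def by blast
  qed
  \<comment> \<open>Maximality of H gives H V = K, so the trace from V is the trace from
    \<open>V \<inter> H\<close> to H. This intersection has smaller order than \<open>V0\<close>,
    and \<open>V0min\<close> applies.\<close>
  have T_mackey: "rel_trace \<beta> \<beta> V (carrier K) y \<in> T"
    if V: "subgroup V K" "\<not> V \<subseteq> H" "card V \<le> card V0" and y: "y
      \<in> intertw \<beta> \<beta> V" for V y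
  proof -
    have VH: "subgroup (V \<inter> H) K" using V(1) Hs subgroups_Inter_pair by blast
    have finV: "finite V" using V(1) finK subgroup.subset finite_subset by metis
    have HV: "H <#> V = carrier K"
    proof -
      have "subgroup (H <#> V) K" using mult_norm_subgroup[OF H(1) V(1)] .
      moreover have "x \<in> H <#> V" if "x \<in> H" for x
      proof -
        have "x = x \<otimes> \<one>" using that H.mem_carrier by simp
        then show ?thesis using that subgroup.one_closed[OF V(1)] unfolding set_mult_def by blast
      qed
      moreover have "x \<in> H <#> V" if "x \<in> V" for x
      proof -
        have "x = \<one> \<otimes> x" using that subgroup.mem_carrier[OF V(1)] by simp
        then show ?thesis using that H.one_closed unfolding set_mult_def by blast
      qed
      ultimately show ?thesis using Hmax[of "H <#> V"] V(2) by auto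
    qed
    have cover: "\<exists>s\<in>H. inv s \<otimes> g \<in> V" if "g \<in> carrier K" for g
    proof -
      have "g \<in> H <#> V" using HV that by simp
      then obtain s v where sv: "s \<in> H" "v \<in> V" "g = s \<otimes> v" unfolding set_mult_def
        by blast
      then have "inv s \<otimes> g = v"
        using H.mem_carrier subgroup.mem_carrier[OF V(1)] mult_inv_cancel(2) by simp
      then show ?thesis using sv by blast
    qed
    have mac: "rel_trace \<beta> \<beta> V (carrier K) y
      = rel_trace \<beta> \<beta> (V \<inter> H) H
        y" by (rule rel_trace_mackey[OF \<beta> \<beta> V(1) Hs cover y])
    have "?t (c * rel_trace \<beta> \<beta> V (carrier K) y * b) \<in> N"
      if c: "c \<in> intertw \<beta> \<alpha> H" and b: "b \<in> intertw \<alpha> \<beta> H" for c b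
    proof -
      have "c * rel_trace \<beta> \<beta> (V \<inter> H) H y * b
        = rel_trace \<alpha> \<alpha> (V \<inter> H) H (c * y * b)"
        using rel_trace_mult_left[OF \<beta> VH Hs c] rel_trace_mult_right[OF \<alpha> \<beta> VH Hs
          b] by metis
      moreover have cyb: "c * y * b \<in> intertw \<alpha> \<alpha> (V \<inter> H)"
        using intertw_mult[OF intertw_mult[OF intertw_mono[OF Int_lower2 c] intertw_mono[OF
          Int_lower1 y]] intertw_mono[OF Int_lower2 b]] .
      moreover have "?t (rel_trace \<alpha> \<alpha> (V \<inter> H) H (c * y * b))
        = rel_trace \<alpha> \<alpha> (V \<inter> H) (carrier K) (c * y * b)"
        using rel_trace_trans[OF \<alpha> \<alpha> VH Hs subgroup_self _ H.subset cyb] by blast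
      moreover have "card (V \<inter> H) < card V0"
      proof -
        have "V \<inter> H \<subset> V" using V(2) by blast
        then show ?thesis using psubset_card_mono[OF finV] V(3) by (meson less_le_trans)
      qed
      ultimately show ?thesis using mac V0min[OF VH] unfolding trace_in_def by metis
    qed
    then show ?thesis using rel_trace_intertw[OF \<beta> \<beta> V(1) subgroup_self y]
      unfolding T_def by blast
  qed

  \<comment> \<open>The summands of an element of F behave predictably on the set \<open>D\<close>
    below: \<open>h * h'\<close> sends it into \<open>mA\<close>, T sends it into M, and what
    remains is a trace from H.\<close>
  define F where "F = {l * (h * h') + (rel_trace \<beta> \<beta> H (carrier K) y + t) | l y t. l
    \<in> endos \<beta> \<and> y \<in> intertw \<beta> \<beta> H \<and> t \<in> T}"
  have hh: "h * h' \<in> endos \<beta>" using hK intertw_mult by blast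
  define F0 where "F0 = {rel_trace \<beta> \<beta> H (carrier K) y + t | y t. y
    \<in> intertw \<beta> \<beta> H \<and> t \<in> T}"
  have "left_ideal \<beta> F0" unfolding left_ideal_def
  proof (intro conjI ballI subsetI)
    fix x assume "x \<in> F0"
    then obtain y t
      where x: "x = rel_trace \<beta> \<beta> H (carrier K) y + t" "y
        \<in> intertw \<beta> \<beta> H" "t \<in> T" unfolding F0_def by blast
    show "x \<in> endos \<beta>"
      using x intertw_add rel_trace_intertw[OF \<beta> \<beta> Hs subgroup_self] unfolding T_def
        by blast
    fix z assume "z \<in> F0"
    then obtain y' t'
      where z: "z = rel_trace \<beta> \<beta> H (carrier K) y' + t'" "y'
        \<in> intertw \<beta> \<beta> H" "t' \<in> T" unfolding F0_def by blast
    have "x + z = rel_trace \<beta> \<beta> H (carrier K) (y + y') + (t + t')" using x z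
      by (simp add: rel_trace_add)
    then show "x + z \<in> F0" unfolding F0_def using x z intertw_add T_add by blast
  next
    fix d x assume d: "d \<in> endos \<beta>" and "x \<in> F0"
    then obtain y t
      where x: "x = rel_trace \<beta> \<beta> H (carrier K) y + t" "y
        \<in> intertw \<beta> \<beta> H" "t \<in> T" unfolding F0_def by blast
    have "d * x = rel_trace \<beta> \<beta> H (carrier K) (d * y) + d * t"
      using x rel_trace_mult_left[OF \<beta> Hs subgroup_self d, of \<beta> y]
        by (simp add: distrib_left)
    then show "d * x \<in> F0" unfolding F0_def
      using intertw_mult[OF intertw_carrier[OF Hs d] x(2)] T_left[OF d x(3)] by blast
  next
    fix x assume "x \<in> mA \<inter> endos \<beta>"
    then have "x = rel_trace \<beta> \<beta> H (carrier K) 0 + x" "x \<in> T" using T_mA by auto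
    then show "x \<in> F0" unfolding F0_def using intertw_zero by blast
  qed
  then have "left_ideal \<beta> {l * (h * h') + y | l y. l \<in> endos \<beta> \<and> y \<in> F0}"
    using left_ideal_adjoin hh by blast
  moreover have "F = {l * (h * h') + y | l y. l \<in> endos \<beta> \<and> y \<in> F0}"
    unfolding F_def F0_def by blast
  ultimately have F: "left_ideal \<beta> F" by simp
  have T0: "0 \<in> T" using T_mA mA_zero intertw_zero by blast
  have TF: "t \<in> F" if "t \<in> T" for t
  proof -
    have "t = 0 * (h * h') + (rel_trace \<beta> \<beta> H (carrier K) 0 + t)" by simp
    then show ?thesis unfolding F_def using that intertw_zero by blast
  qed
  have trF: "rel_trace \<beta> \<beta> H (carrier K) y \<in> F"
    if "y \<in> intertw \<beta> \<beta> H" for y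
  proof -
    have "rel_trace \<beta> \<beta> H (carrier K) y
      = 0 * (h * h') + (rel_trace \<beta> \<beta> H (carrier K) y + 0)" by simp
    then show ?thesis unfolding F_def using that intertw_zero T0 by blast
  qed
  have hhF: "h * h' \<in> F"
  proof -
    have "h * h' = 1 * (h * h') + (rel_trace \<beta> \<beta> H (carrier K) 0 + 0)" by simp
    then show ?thesis unfolding F_def using intertw_one intertw_zero T0 by blast
  qed
  \<comment> \<open>a maximal left ideal containing \<open>F\<close> would have a vertex larger than \<open>V0\<close>\<close>
  have "1 \<in> F"
  proof (rule ccontr)
    assume "1 \<notin> F"
    then obtain N' where N': "max_left_ideal \<beta> N'" "F \<subseteq> N'"
      using max_left_ideal_ex[OF F] by blast
    then obtain V where V: "subgroup V K" "card V \<le> card V0" "\<not> trace_in \<beta> V N'"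
      using V0max hhF by blast
    then obtain y
      where y: "y \<in> intertw \<beta> \<beta> V" "rel_trace \<beta> \<beta> V (carrier K) y
        \<notin> N'" unfolding trace_in_def by blast
    show False
    proof (cases "V \<subseteq> H")
      case True
      then have "rel_trace \<beta> \<beta> V (carrier K) y
        = rel_trace \<beta> \<beta> H (carrier K) (rel_trace \<beta> \<beta> V H y)"
        using rel_trace_trans[OF \<beta> \<beta> V(1) Hs subgroup_self _ H.subset y(1)] by simp
      then show False using y(2) N'(2) trF rel_trace_intertw[OF \<beta> \<beta> V(1) Hs y(1)]
        by auto
    next
      case False
      then show False using T_mackey[OF V(1) False V(2) y(1)] TF N'(2) y(2) by blast
    qed
  qed
  then obtain l y t where one: "1 = l * (h * h') + (rel_trace \<beta> \<beta> H (carrier K) y + t)"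
    and l: "l \<in> endos \<beta>" and y: "y \<in> intertw \<beta> \<beta> H" and t: "t \<in> T"
      unfolding F_def by blast

  \<comment> \<open>The search for a fixed vector is confined to multiples of f, so that multiplying
    the result by f again changes nothing modulo \<open>mA\<close>. This set is stable under K
    because f is fixed by K.\<close>
  define D where "D = {f * b | b. b \<in> intertw \<alpha> \<beta> H}"
  have D1: "D \<subseteq> intertw \<alpha> \<beta> H" unfolding D_def using fH intertw_mult by blast
  have D2: "x - z \<in> D" if xz: "x \<in> D" "z \<in> D" for x z
  proof -
    obtain b b' where "b \<in> intertw \<alpha> \<beta> H" "b' \<in> intertw \<alpha> \<beta> H" "x
      = f * b" "z = f * b'" using xz unfolding D_def by blast
    moreover then have "x - z = f * (b - b')" by (simp add: right_diff_distrib)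
    ultimately show ?thesis unfolding D_def using intertw_diff by blast
  qed
  have D3: "twist \<alpha> \<beta> g x \<in> D" if g: "g \<in> carrier K" and x: "x \<in> D" for g x
  proof -
    obtain b where b: "b \<in> intertw \<alpha> \<beta> H" "x = f * b" using x unfolding D_def
      by blast
    have "twist \<beta> \<beta> g f = f"
      using intertw_iff_twist[of \<beta> "carrier K" f \<beta>] \<beta> fK g by blast
    then have "twist \<alpha> \<beta> g x = f * twist \<alpha> \<beta> g b"
      using b twist_mult[OF \<beta> g] by simp
    then show ?thesis unfolding D_def using twist_intertw_normal[OF \<alpha> \<beta> H(1) g b(1)]
      by blast
  qed
  have fb0: "f * b0 \<in> D" "f * b0 \<notin> M"
    using cb0 unfolding D_def M_def by (auto simp: mult.assoc)
  obtain d where d: "d \<in> D" "d \<notin> M" "\<And>g. g \<in> carrier K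
    \<Longrightarrow> twist \<alpha> \<beta> g d - d \<in> M"
    using fixed_vector[OF \<alpha> \<beta> H(1,3) Hmax D1 D2 D3 M_add M_minus M_tw M_mA fb0]
      by blast
  obtain d0 where d0: "d0 \<in> intertw \<alpha> \<beta> H" "d = f * d0" using d(1) unfolding D_def
    by blast
  have dI: "d \<in> intertw \<alpha> \<beta> H" using d(1) D1 by blast
  let ?ty = "rel_trace \<beta> \<beta> H (carrier K) y"
  have ty: "?ty \<in> endos \<beta>"
    using rel_trace_intertw[OF \<beta> \<beta> Hs subgroup_self y] .
  have 1: "?ty * d - d \<in> M"
  proof -
    have "d = 1 * d" by simp
    also have "\<dots> = l * (h * h' * f * d0) + (?ty * d + t * d)"
      unfolding one d0(2) by (simp add: distrib_right mult.assoc)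
    finally have eq: "?ty * d - d = - (l * (h * h' * f * d0)) + - (t * d)"
      by (simp add: algebra_simps)
    have "l * (h * h' * f * d0) \<in> M"
    proof (rule M_left[OF intertw_carrier[OF Hs l] M_mA])
      show "h * h' * f * d0 \<in> mA" using hf mA_mult_right unfolding cong_mA_zero_iff by blast
      show "h * h' * f * d0 \<in> intertw \<alpha> \<beta> H"
        using intertw_mult[OF intertw_mult[OF intertw_carrier[OF Hs hh] fH] d0(1)] .
    qed
    moreover have "t * d \<in> M"
    proof -
      have "t * d \<in> intertw \<alpha> \<beta> H"
        using intertw_mult[OF intertw_carrier[OF Hs] dI] t unfolding T_def by blast
      then show ?thesis using t dI unfolding T_def M_def by (simp add: mult.assoc)
    qed
    ultimately show ?thesis unfolding eq using M_add M_minus by blast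
  qed
  \<comment> \<open>A trace is truly fixed by K, and this one is still congruent to d: as d is fixed
    modulo M, it can be drawn out of the trace of \<open>y * d\<close>, and the trace of y acts on d
    as the identity modulo M.\<close>
  define b' where "b' = rel_trace \<alpha> \<beta> H (carrier K) (y * d)"
  have b': "b' \<in> intertw \<alpha> \<beta> (carrier K)" unfolding b'_def
    using rel_trace_intertw[OF \<alpha> \<beta> Hs subgroup_self intertw_mult[OF y dI]] .
  have "b' - ?ty * d
    = (\<Sum>g\<in>transversal_of H (carrier K). twist \<beta> \<beta> g y * (twist \<alpha> \<beta>
      g d - d))"
  proof -
    have "transversal_of H (carrier K) \<subseteq> carrier K"
      using transversal_of_subset[OF Hs subgroup_self] .
    then have "b'
      = (\<Sum>g\<in>transversal_of H (carrier K). twist \<beta> \<beta> g y * twist \<alpha>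
        \<beta> g d)"
      unfolding b'_def rel_trace_def using twist_mult[OF \<beta>] by (intro sum.cong) auto
    then show ?thesis unfolding rel_trace_def
      by (simp add: sum_distrib_right sum_subtractf right_diff_distrib)
  qed
  moreover have "(\<Sum>g\<in>transversal_of H (carrier K). twist \<beta> \<beta> g y
    * (twist \<alpha> \<beta> g d - d)) \<in> M"
  proof (rule M_sum)
    fix g assume "g \<in> transversal_of H (carrier K)"
    then have g: "g \<in> carrier K" using transversal_of_subset[OF Hs subgroup_self] by blast
    show "twist \<beta> \<beta> g y * (twist \<alpha> \<beta> g d - d) \<in> M"
      using M_left twist_intertw_normal[OF \<beta> \<beta> H(1) g y] d(3)[OF g] by blast
  qed
  ultimately have "(b' - ?ty * d) + (?ty * d - d) \<in> M" using 1 M_add by simp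
  then have 2: "b' - d \<in> M" by simp
  have "f * b' \<notin> M"
  proof
    assume 3: "f * b' \<in> M"
    have "f * d - d = - (h * h' * f) * d0" unfolding d0(2) f_def by (simp add: algebra_simps)
    moreover have "- (h * h' * f) * d0 \<in> mA" using hf unfolding cong_mA_zero_iff
      by (rule mA_mult_right[OF mA_minus])
    ultimately have "f * d - d \<in> mA" by simp
    then have 4: "f * d - d \<in> M" using M_mA intertw_diff[OF intertw_mult[OF fH dI] dI] by blast
    have "f * (b' - d) \<in> M" using M_left[OF fH 2] .
    then have "f * b' + - (f * (b' - d)) + - (f * d - d) \<in> M" using 3 4 M_add M_minus by blast
    then show False using d(2) by (simp add: algebra_simps)
  qed
  moreover have fb': "f * b' \<in> intertw \<alpha> \<beta> (carrier K)"
    using intertw_mult[OF fK b'] .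
  ultimately obtain c where c: "c \<in> intertw \<beta> \<alpha> H" "?t (c * (f * b')) \<notin> N"
    unfolding M_def using intertw_carrier[OF Hs fb'] by blast
  \<comment> \<open>As \<open>f * b'\<close> is now fixed by K, the Frobenius formula replaces c by
    its trace.\<close>
  have "rel_trace \<beta> \<alpha> H (carrier K) c * (f * b') = ?t (c * (f * b'))"
    using rel_trace_mult_right[OF \<alpha> \<beta> Hs subgroup_self fb'] .
  then have "rel_trace \<beta> \<alpha> H (carrier K) c * f * b' \<notin> N" using c(2)
    by (simp add: mult.assoc)
  then show ?thesis using b' rel_trace_intertw[OF \<beta> \<alpha> Hs subgroup_self c(1)]
    unfolding f_def by blast
qed

end

section \<open>Vertices and the construction of the unit\<close>

context p_group_alg
begin

text \<open>The order of a vertex of the simple module defined by the maximal left ideal \<open>N\<close>.\<close>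

definition vertex_order :: "('s \<Rightarrow> 'a) \<Rightarrow> 'a set \<Rightarrow> nat" where
  "vertex_order \<alpha> N = (LEAST k. \<exists>V. subgroup V K \<and> card V = k
    \<and> \<not> trace_in \<alpha> V N)"

text \<open>The whole group is a candidate, since the trace of 1 from K to K is 1, which is not in
  \<open>N\<close>.\<close>

lemma vertex_order_attained:
  assumes "unit_representation \<alpha>" "max_left_ideal \<alpha> N"
  shows "\<exists>V. subgroup V K \<and> card V = vertex_order \<alpha> N
    \<and> \<not> trace_in \<alpha> V N"
proof -
  have "rel_trace \<alpha> \<alpha> (carrier K) (carrier K) 1 \<notin> N"
    using rel_trace_self[OF assms(1,1) subgroup_self intertw_one] assms(2)
      unfolding max_left_ideal_def by simp
  then have "\<not> trace_in \<alpha> (carrier K) N" unfolding trace_in_def using intertw_one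
    by blast
  then have "\<exists>k V. subgroup V K \<and> card V = k \<and> \<not> trace_in \<alpha> V N"
    using subgroup_self by blast
  then show ?thesis unfolding vertex_order_def by (rule LeastI_ex)
qed

lemma trace_in_below_vertex_order: "subgroup V K \<Longrightarrow> card V < vertex_order \<alpha> N
  \<Longrightarrow> trace_in \<alpha> V N"
  unfolding vertex_order_def using not_less_Least by blast

lemma vertex_order_le: assumes "unit_representation \<alpha>" "max_left_ideal \<alpha> N"
  shows "vertex_order \<alpha> N \<le> card (carrier K)"
  using vertex_order_attained[OF assms] card_mono[OF finK] subgroup.subset by metis

lemma orthogonal_partial_iso_at_max_vertex:
  assumes "unit_representation \<alpha>" "unit_representation \<beta>"
    "partial_iso \<alpha> \<beta> h h'" "max_left_ideal \<alpha> N" "h' * h \<in> N"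
    and mx: "\<And>N'. max_left_ideal \<beta> N' \<Longrightarrow> h * h' \<in> N'
      \<Longrightarrow> vertex_order \<beta> N' \<le> vertex_order \<alpha> N"
    and "u \<in> intertw \<alpha> \<beta> (carrier K)" "u'
      \<in> intertw \<beta> \<alpha> (carrier K)" "u' * u - 1 \<in> brauer_ker \<alpha>"
    and loc: "\<And>R. subgroup R K \<Longrightarrow> R \<noteq> carrier K
      \<Longrightarrow> \<exists>a\<in>intertw \<alpha> \<beta> R. \<exists>a'\<in>intertw \<beta>
        \<alpha> R. a' * a = 1"
  shows "\<exists>b c. orthogonal_partial_iso \<alpha> \<beta> h h' b c"
proof -
  obtain V where V: "subgroup V K" "card V = vertex_order \<alpha> N" "\<not> trace_in \<alpha> V N"
    using vertex_order_attained assms(1,4) by blast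
  have mn: "trace_in \<alpha> W N" if "subgroup W K" "card W < card V" for W
    using trace_in_below_vertex_order that V(2) by simp
  have mx': "\<exists>W. subgroup W K \<and> card W \<le> card V
    \<and> \<not> trace_in \<beta> W N'" if N': "max_left_ideal \<beta> N'" "h * h' \<in> N'" for N'
    using vertex_order_attained[OF assms(2) N'(1)] mx[OF N'] V(2) by metis
  have "\<exists>c\<in>intertw \<beta> \<alpha> (carrier K). \<exists>b\<in>intertw \<alpha> \<beta>
    (carrier K). c * (1 - h * h') * b \<notin> N"
    by (rule nonradical_exists[OF assms(1,2,4,3,5) V(1,3)]) (fact mn mx' assms(7-9) loc)+
  then show ?thesis using orthogonal_partial_iso_of_nonradical[OF assms(4,3,5)] by blast
qed

text \<open>Were 1 in the left ideal generated by \<open>h' * h\<close> and \<open>mA\<close>, then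
  h would have a left inverse modulo \<open>mA\<close> and be a unit by Dedekind finiteness.\<close>

lemma max_left_ideal_of_non_unit:
  assumes "partial_iso \<alpha> \<beta> h h'" "\<not> unit_of h"
  shows "\<exists>N. max_left_ideal \<alpha> N \<and> h' * h \<in> N"
proof -
  have hh: "h' * h \<in> endos \<alpha>" using assms(1) intertw_mult unfolding partial_iso_def
    by blast
  have "left_ideal \<alpha> (mA \<inter> endos \<alpha>)" unfolding left_ideal_def
    using mA_add mA_mult_left intertw_add intertw_mult by blast
  from left_ideal_adjoin[OF this hh] have N: "left_ideal \<alpha> {a * (h' * h) + y | a y. a
    \<in> endos \<alpha> \<and> y \<in> mA \<inter> endos \<alpha>}" (is "left_ideal \<alpha> ?N") .
  have "1 \<notin> ?N"
  proof
    assume "1 \<in> ?N"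
    then obtain a y where ay: "1 = a * (h' * h) + y" "y \<in> mA" by blast
    have "(a * h') * h - 1 = - y" unfolding ay(1) by (simp add: mult.assoc)
    then have "(a * h') * h - 1 \<in> mA" using mA_minus[OF ay(2)] by simp
    then show False using left_unit_mod_imp_unit assms(2) unfolding cong_mA_def by blast
  qed
  moreover have "h' * h \<in> ?N"
  proof -
    have "h' * h = 1 * (h' * h) + 0" by simp
    then show ?thesis using intertw_one intertw_zero mA_zero by blast
  qed
  ultimately show ?thesis using max_left_ideal_ex[OF N] by blast
qed

text \<open>The maximum is taken over the vertices of both sides; it exists because h is not a unit.
  The side on which it is attained plays the role of \<alpha>, with \<open>u\<close> serving one
  case and \<open>v\<close> the other.\<close>

lemma orthogonal_partial_iso_exists:
  assumes \<alpha>: "unit_representation \<alpha>" and \<beta>: "unit_representation \<beta>" and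
    pi: "partial_iso \<alpha> \<beta> h h'" and nu: "\<not> unit_of h"
    and u: "u \<in> intertw \<alpha> \<beta> (carrier K)" "u'
      \<in> intertw \<beta> \<alpha> (carrier K)" "u' * u - 1 \<in> brauer_ker \<alpha>"
    and v: "v \<in> intertw \<beta> \<alpha> (carrier K)" "v'
      \<in> intertw \<alpha> \<beta> (carrier K)" "v' * v - 1 \<in> brauer_ker \<beta>"
    and loc: "\<And>R. subgroup R K \<Longrightarrow> R \<noteq> carrier K \<Longrightarrow>
      \<exists>a\<in>intertw \<alpha> \<beta> R. \<exists>a'\<in>intertw \<beta> \<alpha> R. a' * a
        = 1 \<and> a * a' = 1"
  shows "\<exists>b c. orthogonal_partial_iso \<alpha> \<beta> h h' b c"
proof -
  define A where "A = {vertex_order \<alpha> N | N. max_left_ideal \<alpha> N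
    \<and> h' * h \<in> N}"
  define B where "B = {vertex_order \<beta> N | N. max_left_ideal \<beta> N \<and> h * h' \<in> N}"
  have "A \<union> B \<subseteq> {..card (carrier K)}" unfolding A_def B_def
    using vertex_order_le \<alpha> \<beta> by auto
  then have fin: "finite (A \<union> B)" using finite_subset by blast
  have "A \<noteq> {}" unfolding A_def using max_left_ideal_of_non_unit[OF pi nu] by blast
  then have "Max (A \<union> B) \<in> A \<union> B" using Max_in[OF fin] by blast
  then consider "Max (A \<union> B) \<in> A" | "Max (A \<union> B) \<in> B" by blast
  then show ?thesis
  proof cases
    case 1
    then obtain N
      where N: "max_left_ideal \<alpha> N" "h' * h \<in> N" "vertex_order \<alpha> N
        = Max (A \<union> B)" unfolding A_def by auto
    have mx: "vertex_order \<beta> N' \<le> vertex_order \<alpha> N"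
      if "max_left_ideal \<beta> N'" "h * h' \<in> N'" for N'
      unfolding N(3) using that by (intro Max_ge[OF fin]) (auto simp: B_def)
    show ?thesis by (rule orthogonal_partial_iso_at_max_vertex[OF \<alpha> \<beta> pi N(1,2) mx u])
      (use loc in blast)+
  next
    case 2
    then obtain N
      where N: "max_left_ideal \<beta> N" "h * h' \<in> N" "vertex_order \<beta> N
        = Max (A \<union> B)" unfolding B_def by auto
    have mx: "vertex_order \<alpha> N' \<le> vertex_order \<beta> N"
      if "max_left_ideal \<alpha> N'" "h' * h \<in> N'" for N'
      unfolding N(3) using that by (intro Max_ge[OF fin]) (auto simp: A_def)
    have "\<exists>b c. orthogonal_partial_iso \<beta> \<alpha> h' h b c"
      by (rule orthogonal_partial_iso_at_max_vertex[OF \<beta> \<alpha> partial_iso_sym[OF pi]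
        N(1,2) mx v]) (use loc in blast)+
    then show ?thesis using orthogonal_partial_iso_sym by blast
  qed
qed

text \<open>The last three claims say that the left ideal \<open>A h' h + mA\<close> grows strictly:
  the new one contains \<open>h' * h\<close> and \<open>c * b\<close>, but the old one does not
  contain \<open>c * b\<close>, as multiplying by c on the right kills \<open>h' * h\<close> and
  leaves c.\<close>

lemma partial_iso_extend:
  assumes pi: "partial_iso \<alpha> \<beta> h h'" and o:
    "orthogonal_partial_iso \<alpha> \<beta> h h' b c"
  shows "partial_iso \<alpha> \<beta> (h + b) (h' + c)"
    and "h' * h \<approx> h' * h * ((h' + c) * (h + b))"
    and "c * b \<approx> c * b * ((h' + c) * (h + b))"
    and "\<not> c * b \<approx> a * (h' * h)"
proof -
  have h: "h \<in> intertw \<alpha> \<beta> (carrier K)" "h'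
    \<in> intertw \<beta> \<alpha> (carrier K)" "h * h' * h \<approx> h" "h' * h * h' \<approx> h'"
    using pi unfolding partial_iso_def by auto
  have b: "b \<in> intertw \<alpha> \<beta> (carrier K)" "c
    \<in> intertw \<beta> \<alpha> (carrier K)" "b * c * b \<approx> b" "c * b * c \<approx> c"
    and b0: "\<not> b \<approx> 0" and z: "c * h \<approx> 0" "h' * b \<approx> 0" "b * h'
      \<approx> 0" "h * c \<approx> 0"
    using o unfolding orthogonal_partial_iso_def partial_iso_def cong_mA_zero_iff by auto
  have hk: "h * (h' + c) \<approx> h * h'" using cong_mA_add[OF cong_mA_refl z(4), of "h * h'"]
    by (simp add: distrib_left)
  have bk: "b * (h' + c) \<approx> b * c" using cong_mA_add[OF z(3) cong_mA_refl, of "b * c"]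
    by (simp add: distrib_left)
  have k'h: "h' * (h + b) \<approx> h' * h" using cong_mA_add[OF cong_mA_refl z(2), of "h' * h"]
    by (simp add: distrib_left)
  have k'b: "c * (h + b) \<approx> c * b" using cong_mA_add[OF z(1) cong_mA_refl, of "c * b"]
    by (simp add: distrib_left)
  have 1: "h * (h' + c) * (h + b) \<approx> h"
  proof -
    have "h * (h' + c) * (h + b) \<approx> h * h' * (h + b)" using hk by (rule cong_mA_mult_right)
    also have "h * h' * (h + b) = h * (h' * (h + b))" by (rule mult.assoc)
    also have "\<dots> \<approx> h * (h' * h)" using k'h by (rule cong_mA_mult_left)
    also have "\<dots> = h * h' * h" by (rule mult.assoc[symmetric])
    also note h(3)
    finally show ?thesis .
  qed
  have 2: "b * (h' + c) * (h + b) \<approx> b"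
  proof -
    have "b * (h' + c) * (h + b) \<approx> b * c * (h + b)" using bk by (rule cong_mA_mult_right)
    also have "b * c * (h + b) = b * (c * (h + b))" by (rule mult.assoc)
    also have "\<dots> \<approx> b * (c * b)" using k'b by (rule cong_mA_mult_left)
    also have "\<dots> = b * c * b" by (rule mult.assoc[symmetric])
    also note b(3)
    finally show ?thesis .
  qed
  have 3: "h' * (h + b) * (h' + c) \<approx> h'"
  proof -
    have "h' * (h + b) * (h' + c) \<approx> h' * h * (h' + c)" using k'h
      by (rule cong_mA_mult_right)
    also have "h' * h * (h' + c) = h' * (h * (h' + c))" by (rule mult.assoc)
    also have "\<dots> \<approx> h' * (h * h')" using hk by (rule cong_mA_mult_left)
    also have "\<dots> = h' * h * h'" by (rule mult.assoc[symmetric])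
    also note h(4)
    finally show ?thesis .
  qed
  have 4: "c * (h + b) * (h' + c) \<approx> c"
  proof -
    have "c * (h + b) * (h' + c) \<approx> c * b * (h' + c)" using k'b by (rule cong_mA_mult_right)
    also have "c * b * (h' + c) = c * (b * (h' + c))" by (rule mult.assoc)
    also have "\<dots> \<approx> c * (b * c)" using bk by (rule cong_mA_mult_left)
    also have "\<dots> = c * b * c" by (rule mult.assoc[symmetric])
    also note b(4)
    finally show ?thesis .
  qed
  show "partial_iso \<alpha> \<beta> (h + b) (h' + c)"
    using cong_mA_add[OF 1 2] cong_mA_add[OF 3 4] intertw_add h(1,2) b(1,2)
      unfolding partial_iso_def by (simp add: distrib_right)
  show "h' * h \<approx> h' * h * ((h' + c) * (h + b))"
    using cong_mA_sym[OF cong_mA_mult_left[OF 1, of h']] by (simp add: mult.assoc)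
  show "c * b \<approx> c * b * ((h' + c) * (h + b))"
    using cong_mA_sym[OF cong_mA_mult_left[OF 2, of c]] by (simp add: mult.assoc)
  show "\<not> c * b \<approx> a * (h' * h)"
  proof
    assume "c * b \<approx> a * (h' * h)"
    then have "c * b * c \<approx> a * (h' * h) * c" by (rule cong_mA_mult_right)
    also have "\<dots> = (a * h') * (h * c)" by (simp only: mult.assoc)
    also have "\<dots> \<approx> 0" using z(4) by (rule cong_mA_zero_left)
    finally have "c \<approx> 0" using b(4) cong_mA_sym cong_mA_trans by blast
    then have "b * c * b \<approx> 0" using cong_mA_zero_left cong_mA_zero_right by blast
    then show False using b(3) b0 cong_mA_sym cong_mA_trans by blast
  qed
qed

theorem twisted_unit_lift:
  assumes \<alpha>: "unit_representation \<alpha>" and \<beta>: "unit_representation \<beta>"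
    and u: "u \<in> intertw \<alpha> \<beta> (carrier K)" "u'
      \<in> intertw \<beta> \<alpha> (carrier K)" "u' * u - 1 \<in> brauer_ker \<alpha>"
    and v: "v \<in> intertw \<beta> \<alpha> (carrier K)" "v'
      \<in> intertw \<alpha> \<beta> (carrier K)" "v' * v - 1 \<in> brauer_ker \<beta>"
    and loc: "\<And>R. subgroup R K \<Longrightarrow> R \<noteq> carrier K \<Longrightarrow>
      \<exists>a\<in>intertw \<alpha> \<beta> R. \<exists>a'\<in>intertw \<beta> \<alpha> R. a' * a
        = 1 \<and> a * a' = 1"
  shows "\<exists>a\<in>intertw \<alpha> \<beta> (carrier K). unit_of a"
proof (rule ccontr)
  assume "\<not> ?thesis"
  then have nu: "\<not> unit_of h" if "partial_iso \<alpha> \<beta> h h'" for h h' using that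
    unfolding partial_iso_def by blast
  \<comment> \<open>For s = (h, h') this is \<open>A h' h + mA\<close>.\<close>
  define X where "X s = {x. \<exists>a. x \<approx> a * (snd s * fst s)}" for s :: "'a \<times> 'a"
  define P where "P s
    \<longleftrightarrow> partial_iso \<alpha> \<beta> (fst s) (snd s)" for s :: "'a \<times> 'a"
  have X_sub: "subspace (X s)" for s
    unfolding subspace_def
  proof (intro conjI ballI allI)
    show "0 \<in> X s" unfolding X_def by (auto intro!: exI[of _ 0])
    fix x y assume "x \<in> X s" "y \<in> X s"
    then obtain a b where "x \<approx> a * (snd s * fst s)" "y \<approx> b * (snd s * fst s)"
      unfolding X_def by blast
    then have "x + y \<approx> (a + b) * (snd s * fst s)" using cong_mA_add
      by (simp add: distrib_right)
    then show "x + y \<in> X s" unfolding X_def by blast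
  next
    fix r x assume "x \<in> X s"
    then obtain a where "x \<approx> a * (snd s * fst s)" unfolding X_def by blast
    then have "smul r 1 * x \<approx> smul r 1 * (a * (snd s * fst s))" by (rule cong_mA_mult_left)
    then have "smul r x \<approx> smul r a * (snd s * fst s)" by (simp add: smul_mult_left)
    then show "smul r x \<in> X s" unfolding X_def by blast
  qed
  have X_mA: "mA \<subseteq> X s" for s unfolding X_def
    by (auto intro!: exI[of _ 0] simp: cong_mA_zero_iff)
  have "\<exists>s'. P s' \<and> X s \<subseteq> X s' \<and> (\<exists>x\<in>X s'. x \<notin> X s)"
    if s: "P s" for s
  proof -
    obtain h h' where hh: "s = (h, h')" by (cases s)
    have pi: "partial_iso \<alpha> \<beta> h h'" using s unfolding P_def hh by simp
    obtain b c where o: "orthogonal_partial_iso \<alpha> \<beta> h h' b c"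
      using orthogonal_partial_iso_exists[OF \<alpha> \<beta> pi nu[OF pi] u v loc] by blast
    note e = partial_iso_extend[OF pi o]
    have "x \<in> X (h + b, h' + c)" if x: "x \<in> X s" for x
    proof -
      obtain a where "x \<approx> a * (h' * h)" using x unfolding X_def hh by auto
      also have "\<dots> \<approx> a * (h' * h * ((h' + c) * (h + b)))" using e(2)
        by (rule cong_mA_mult_left)
      also have "\<dots> = (a * (h' * h)) * ((h' + c) * (h + b))" by (rule mult.assoc[symmetric])
      finally show ?thesis unfolding X_def by auto
    qed
    moreover have "c * b \<in> X (h + b, h' + c)" using e(3) unfolding X_def by auto
    moreover have "c * b \<notin> X s" using e(4) unfolding X_def hh by auto
    ultimately show ?thesis using e(1) unfolding P_def by (intro exI[of _ "(h + b, h' + c)"]) auto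
  qed
  moreover have "P (0, 0)" unfolding P_def partial_iso_def using intertw_zero by simp
  ultimately obtain s
    where s: "\<And>k. P (s k)" "\<And>k::nat. X (s k) \<subseteq> X (s (Suc k))
      \<and> (\<exists>x\<in>X (s (Suc k)). x \<notin> X (s k))"
    using dependent_nat_choice[of "\<lambda>_ s. P s" "\<lambda>_ s s'. X s \<subseteq> X s'
      \<and> (\<exists>x\<in>X s'. x \<notin> X s)"] by metis
  \<comment> \<open>Elements picked in the gaps of an infinite strict chain are never in the span of
    their predecessors and \<open>mA\<close>, against \<open>chain_mod\<close>.\<close>
  obtain x where x: "\<And>k. x k \<in> X (s (Suc k))" "\<And>k. x k \<notin> X (s k)" using s(2)
    by metis
  have mono: "X (s i) \<subseteq> X (s j)" if "i \<le> j" for i j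
    using lift_Suc_mono_le[of "\<lambda>k. X (s k)"] s(2) that by blast
  obtain k where k: "x k \<in> span (x ` {..<k} \<union> mA)" using chain_mod[of x] by blast
  have "x ` {..<k} \<union> mA \<subseteq> X (s k)"
  proof -
    have "x i \<in> X (s k)" if "i < k" for i using x(1)[of i] mono[of "Suc i" k] that by auto
    then show ?thesis using X_mA by auto
  qed
  then have "span (x ` {..<k} \<union> mA) \<subseteq> X (s k)" using X_sub span_minimal by blast
  then show False using k x(2) by blast
qed

text \<open>\<theta> identifies the diagonal of Q with \<open>K\<close>, and V with a subgroup R of
  \<open>K\<close>. The representatives that \<open>rtr\<close> happens to choose pull back to a
  transversal of R, and the trace is independent of the transversal.\<close>

lemma rtr_eq_rel_trace:
  fixes G :: "('t, 'c) monoid_scheme"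
  assumes G: "group G" and Q: "subgroup Q G" and bij: "bij_betw \<theta> (carrier K) Q"
    and hom: "\<And>u v. u \<in> carrier K \<Longrightarrow> v \<in> carrier K
      \<Longrightarrow> \<theta> (u \<otimes> v) = \<theta> u \<otimes>\<^bsub>G\<^esub> \<theta> v"
    and unit_representation: "unit_representation (\<rho> \<circ> \<theta>)"
    and V: "subgroup V (G \<times>\<times> G)" "V \<subset> Delta (\<lambda>u. u) Q" and a: "a
      \<in> fixV G \<rho> V"
  shows "\<exists>R. subgroup R K \<and> R \<noteq> carrier K
    \<and> a \<in> intertw (\<rho> \<circ> \<theta>) (\<rho> \<circ> \<theta>) R \<and>
    rtr G \<rho> V (Delta (\<lambda>u. u) Q) a = rel_trace (\<rho> \<circ> \<theta>) (\<rho> \<circ>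
      \<theta>) R (carrier K) a"
proof -
  interpret G: group G by (rule G)
  interpret V: subgroup V "G \<times>\<times> G" by (rule V(1))
  have \<theta>G: "\<theta> u \<in> carrier G" "\<theta> u \<in> Q" if "u \<in> carrier K" for u
    using that bij subgroup.mem_carrier[OF Q] unfolding bij_betw_def by auto
  have inj: "\<theta> u = \<theta> v \<longleftrightarrow> u = v"
    if "u \<in> carrier K" "v \<in> carrier K" for u v
    using that bij unfolding bij_betw_def by (meson inj_on_eq_iff)
  have \<theta>1: "\<theta> \<one> = \<one>\<^bsub>G\<^esub>"
    using hom[of \<one> \<one>] \<theta>G[of \<one>] by (metis G.l_cancel_one' one_closed r_one)
  have \<theta>inv: "\<theta> (inv u) = inv\<^bsub>G\<^esub> (\<theta> u)"
    if "u \<in> carrier K" for u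
    using hom[of "inv u" u] \<theta>G that \<theta>1 by (metis G.inv_equality inv_closed l_inv)
  define d where "d u = (\<theta> u, \<theta> u)" for u
  define R where "R = {u \<in> carrier K. d u \<in> V}"
  have V_d: "\<exists>u\<in>R. g = d u" if "g \<in> V" for g
  proof -
    obtain q where "q \<in> Q" "g = (q, q)" using \<open>g \<in> V\<close> V(2) unfolding Delta_def
      by auto
    moreover then obtain u where "u \<in> carrier K" "q = \<theta> u" using bij
      unfolding bij_betw_def by auto
    ultimately show ?thesis using that unfolding R_def d_def by auto
  qed
  have R: "subgroup R K"
  proof (rule subgroupI)
    show "R \<subseteq> carrier K" unfolding R_def by blast
    have "\<one> \<in> R" unfolding R_def d_def using \<theta>1 V.one_closed by simp
    then show "R \<noteq> {}" by blast
    fix u assume u: "u \<in> R"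
    then have uc: "u \<in> carrier K" "d u \<in> V" unfolding R_def by auto
    have "inv\<^bsub>G \<times>\<times> G\<^esub> (d u) \<in> V" using uc by blast
    then show "inv u \<in> R" using uc inv_DirProd[OF G G] \<theta>G \<theta>inv
      unfolding R_def d_def by auto
    fix v assume v: "v \<in> R"
    then have vc: "v \<in> carrier K" "d v \<in> V" unfolding R_def by auto
    have "d u \<otimes>\<^bsub>G \<times>\<times> G\<^esub> d v \<in> V" using uc vc by blast
    then show "u \<otimes> v \<in> R" using uc vc hom unfolding R_def d_def by simp
  qed
  have RK: "R \<noteq> carrier K"
  proof
    assume eq: "R = carrier K"
    have "Delta (\<lambda>u. u) Q \<subseteq> V"
    proof
      fix g assume "g \<in> Delta (\<lambda>u. u) Q"
      then obtain q where q: "q \<in> Q" "g = (q, q)" unfolding Delta_def by auto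
      then obtain u where "u \<in> carrier K" "q = \<theta> u" using bij unfolding bij_betw_def
        by auto
      then show "g \<in> V" using eq q unfolding R_def d_def by auto
    qed
    then show False using V(2) by blast
  qed
  let ?\<alpha> = "\<rho> \<circ> \<theta>"
  have act_d: "act G \<rho> (d u) x = twist ?\<alpha> ?\<alpha> u x" if "u \<in> carrier K" for u x
    unfolding act_def twist_def d_def using \<theta>inv[OF that] by simp
  have aI: "a \<in> intertw ?\<alpha> ?\<alpha> R"
    using intertw_iff_twist[OF unit_representation subgroup.subset[OF R], of a] a act_d
      unfolding fixV_def R_def by auto
  \<comment> \<open>The left coset s R inside \<open>K\<close>.\<close>
  define cs where "cs s = {u \<in> carrier K. inv s \<otimes> u \<in> R}" for s
  have cs_self: "s \<in> cs s" if "s \<in> carrier K" for s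
    using that subgroup.one_closed[OF R] unfolding cs_def by simp
  have cs_sym: "s \<in> cs t" if "s \<in> carrier K" "t \<in> carrier K" "t \<in> cs s" for s t
  proof -
    have "inv (inv s \<otimes> t) \<in> R" using that subgroup.m_inv_closed[OF R] unfolding cs_def
      by blast
    then show ?thesis using that unfolding cs_def by (simp add: inv_mult_group)
  qed
  have cs_trans: "w \<in> cs s" if "s \<in> carrier K" "t \<in> cs s" "w \<in> cs t" for s t w
  proof -
    have twist: "t \<in> carrier K" "w \<in> carrier K" using that unfolding cs_def by auto
    have "(inv s \<otimes> t) \<otimes> (inv t \<otimes> w) \<in> R"
      using that subgroup.m_closed[OF R] unfolding cs_def by blast
    then show ?thesis using that(1) twist unfolding cs_def by (simp add: m_assoc mult_inv_cancel)
  qed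
  have cs_eq: "cs t = cs s" if "s \<in> carrier K" "t \<in> cs s" for s t
  proof -
    have "t \<in> carrier K" using that unfolding cs_def by blast
    then show ?thesis using cs_sym cs_trans that by blast
  qed
  have coset: "l_coset (G \<times>\<times> G) (d s) V = d ` cs s" if s: "s \<in> carrier K" for s
  proof (intro equalityI subsetI)
    fix g assume "g \<in> l_coset (G \<times>\<times> G) (d s) V"
    then obtain v where v: "v \<in> V" "g = d s \<otimes>\<^bsub>G \<times>\<times> G\<^esub> v"
      unfolding l_coset_def by blast
    then obtain u where u: "u \<in> R" "v = d u" using V_d by blast
    then have uc: "u \<in> carrier K" unfolding R_def by blast
    have "g = d (s \<otimes> u)" unfolding v(2) u(2) d_def using hom[OF s uc] by simp
    moreover have "s \<otimes> u \<in> cs s" unfolding cs_def using s uc u(1)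
      by (simp add: mult_inv_cancel)
    ultimately show "g \<in> d ` cs s" by blast
  next
    fix g assume "g \<in> d ` cs s"
    then obtain u where u: "u \<in> carrier K" "inv s \<otimes> u \<in> R" "g = d u"
      unfolding cs_def by blast
    have "\<theta> u = \<theta> s \<otimes>\<^bsub>G\<^esub> \<theta> (inv s \<otimes> u)"
      using hom[of s "inv s \<otimes> u"] s u(1) by (simp add: mult_inv_cancel)
    then have "g = d s \<otimes>\<^bsub>G \<times>\<times> G\<^esub> d (inv s \<otimes> u)"
      unfolding u(3) d_def by simp
    then show "g \<in> l_coset (G \<times>\<times> G) (d s) V" using u(2)
      unfolding l_coset_def R_def by blast
  qed
  have Delta_d: "Delta (\<lambda>u. u) Q = d ` carrier K"
    using bij unfolding Delta_def d_def bij_betw_def by auto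
  have cosets: "{l_coset (G \<times>\<times> G) g V | g. g \<in> Delta (\<lambda>u. u) Q}
    = (\<lambda>s. d ` cs s) ` carrier K"
    unfolding Setcompr_eq_image Collect_mem_eq Delta_d image_image
      by (rule image_cong[OF refl coset])
  \<comment> \<open>The element of \<open>K\<close> behind the representative that
    \<open>rtr\<close> picks from the coset C.\<close>
  define \<psi>
    where "\<psi> C = inv_into (carrier K) \<theta> (fst (SOME g. g
      \<in> C))" for C :: "('t \<times> 't) set"
  have \<psi>: "\<psi> (d ` cs s) \<in> cs s" "(SOME g. g \<in> d ` cs s) = d (\<psi> (d ` cs s))"
    if s: "s \<in> carrier K" for s
  proof -
    have "(SOME g. g \<in> d ` cs s) \<in> d ` cs s" 
      using cs_self[OF s] by (intro someI[of "\<lambda>g. g \<in> d ` cs s" "d s"]) blast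
    then obtain u where u: "u \<in> cs s" "(SOME g. g \<in> d ` cs s) = d u" by blast
    moreover have "inv_into (carrier K) \<theta> (\<theta> u) = u"
      using u(1) bij unfolding cs_def bij_betw_def by auto
    ultimately show "\<psi> (d ` cs s) \<in> cs s" "(SOME g. g \<in> d ` cs s)
      = d (\<psi> (d ` cs s))"
      unfolding \<psi>_def d_def by auto
  qed
  let ?C = "(\<lambda>s. d ` cs s) ` carrier K"
  have inj\<psi>: "inj_on \<psi> ?C"
  proof (rule inj_onI)
    fix C C' assume "C \<in> ?C" "C' \<in> ?C" and eq: "\<psi> C = \<psi> C'"
    then obtain s s'
      where s: "s \<in> carrier K" "C = d ` cs s" "s' \<in> carrier K" "C' = d ` cs s'" by blast
    then have "cs s = cs s'" using cs_eq \<psi>(1) eq by metis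
    then show "C = C'" using s by simp
  qed
  have "transversal (\<psi> ` ?C) R (carrier K)" unfolding transversal_def
  proof (intro conjI ballI)
    show "\<psi> ` ?C \<subseteq> carrier K" using \<psi>(1) unfolding cs_def by blast
    fix s assume s: "s \<in> carrier K"
    show "\<exists>!x. x \<in> \<psi> ` ?C \<and> inv x \<otimes> s \<in> R"
    proof (rule ex1I[of _ "\<psi> (d ` cs s)"])
      have "\<psi> (d ` cs s) \<in> carrier K" using \<psi>(1)[OF s] unfolding cs_def by blast
      then have "s \<in> cs (\<psi> (d ` cs s))"
        using cs_sym[OF s] \<psi>(1)[OF s] cs_eq[OF s] cs_self[OF s] by blast
      then show "\<psi> (d ` cs s) \<in> \<psi> ` ?C
        \<and> inv (\<psi> (d ` cs s)) \<otimes> s \<in> R" using s unfolding cs_def by blast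
      fix x assume x: "x \<in> \<psi> ` ?C \<and> inv x \<otimes> s \<in> R"
      then obtain s' where s': "s' \<in> carrier K" "x = \<psi> (d ` cs s')" by blast
      have "s \<in> cs x" using x s unfolding cs_def by blast
      then have "cs s = cs s'" using cs_eq[OF s'(1)] \<psi>(1)[OF s'(1)] s'(2) by metis
      then show "x = \<psi> (d ` cs s)" using s'(2) by simp
    qed
  qed
  then have "rel_trace ?\<alpha> ?\<alpha> R (carrier K) a
    = (\<Sum>g\<in>\<psi> ` ?C. twist ?\<alpha> ?\<alpha> g a)"
    using rel_trace_eq[OF unit_representation unit_representation R subgroup_self aI] by blast
  also have "\<dots> = (\<Sum>C\<in>?C. twist ?\<alpha> ?\<alpha> (\<psi> C) a)" using inj\<psi>
    by (simp add: sum.reindex)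
  also have "\<dots> = (\<Sum>C\<in>?C. act G \<rho> (SOME g. g \<in> C) a)"
  proof (rule sum.cong[OF refl])
    fix C assume "C \<in> ?C"
    then obtain s where s: "s \<in> carrier K" "C = d ` cs s" by blast
    have "\<psi> C \<in> carrier K" using \<psi>(1)[OF s(1)] s(2) unfolding cs_def by blast
    then show "twist ?\<alpha> ?\<alpha> (\<psi> C) a = act G \<rho> (SOME g. g \<in> C) a"
      using \<psi>(2)[OF s(1)] s(2) act_d by simp
  qed
  also have "\<dots> = rtr G \<rho> V (Delta (\<lambda>u. u) Q) a" unfolding rtr_def cosets ..
  finally show ?thesis using R RK aI by metis
qed

lemma rel_trace_smul: "smul r (rel_trace \<alpha> \<beta> R S x)
  = rel_trace \<alpha> \<beta> R S (smul r x)"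
  unfolding rel_trace_def twist_def by (simp add: scale_sum_right smul_mult_left smul_mult_right)

text \<open>Applied with \<theta> the identity of P and with \<theta> = \<phi>, so that the Brauer
  kernels at P and at Q are both expressed by subgroups of P.\<close>

lemma brK_brauer_ker:
  fixes G :: "('t, 'c) monoid_scheme"
  assumes G: "group G" and Q: "subgroup Q G" and bij: "bij_betw \<theta> (carrier K) Q"
    and hom: "\<And>u v. u \<in> carrier K \<Longrightarrow> v \<in> carrier K
      \<Longrightarrow> \<theta> (u \<otimes> v) = \<theta> u \<otimes>\<^bsub>G\<^esub> \<theta> v"
    and unit_representation: "unit_representation (\<rho> \<circ> \<theta>)" and x: "x
      \<in> brK m smul G \<rho> (\<lambda>u. u) Q"
  shows "x \<in> brauer_ker (\<rho> \<circ> \<theta>)"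
  unfolding brauer_ker_def
proof (intro CollectI allI impI, elim conjE)
  let ?\<alpha> = "\<rho> \<circ> \<theta>"
  fix Z assume add: "\<forall>x\<in>Z. \<forall>y\<in>Z. x + y
    \<in> Z" and mZ: "mA \<inter> endos ?\<alpha> \<subseteq> Z"
    and tZ: "\<forall>V. subgroup V K \<and> V \<noteq> carrier K
      \<longrightarrow> trace_in ?\<alpha> V Z"
  have Z0: "0 \<in> Z" using mZ mA_zero intertw_zero by blast
  have Z_sum: "sum k A \<in> Z"
    if "\<And>i. i \<in> A \<Longrightarrow> k i \<in> Z" for k :: "'a \<Rightarrow> 'a" and A
    using that by (induction A rule: infinite_finite_induct) (use Z0 add in auto)
  let ?S1 = "{smul r a | r a. r \<in> m \<and> a \<in> fixpts \<rho> (\<lambda>u. u) Q}"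
  let ?S2 = "\<Union>V\<in>{V. subgroup V (G \<times>\<times> G)
    \<and> V \<subset> Delta (\<lambda>u. u) Q}. rtr G \<rho> V (Delta (\<lambda>u. u) Q) ` fixV G
      \<rho> V"
  obtain F c where F: "F \<subseteq> ?S1 \<union> ?S2" "x = (\<Sum>x\<in>F. smul (c x) x)"
    using x unfolding brK_def ospan_def by blast
  have SZ: "smul r y \<in> Z" if "y \<in> ?S1 \<union> ?S2" for r y
  proof -
    from that consider s a
      where "y = smul s a" "s \<in> m" "a \<in> fixpts \<rho> (\<lambda>u. u) Q"
      | V a where "subgroup V (G \<times>\<times> G)" "V \<subset> Delta (\<lambda>u. u) Q" "a
        \<in> fixV G \<rho> V"
          "y = rtr G \<rho> V (Delta (\<lambda>u. u) Q) a" by blast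
    then show ?thesis
    proof cases
      case 1
      have "a \<in> endos ?\<alpha>" using 1(3) bij unfolding fixpts_def intertw_def bij_betw_def
        by auto
      then show ?thesis using mZ mA_scale[OF mA_smul[OF 1(2)]] intertw_smul 1(1) by blast
    next
      case 2
      obtain R where R: "subgroup R K" "R \<noteq> carrier K" "a
        \<in> intertw ?\<alpha> ?\<alpha> R" "y = rel_trace ?\<alpha> ?\<alpha> R (carrier K) a"
        using rtr_eq_rel_trace[OF G Q bij hom unit_representation 2(1-3)] 2(4) by metis
      have "smul r y = rel_trace ?\<alpha> ?\<alpha> R (carrier K) (smul r a)" unfolding R(4)
        by (rule rel_trace_smul)
      then show ?thesis using tZ R(1,2) intertw_smul[OF R(3)] unfolding trace_in_def by metis
    qed
  qed
  show "x \<in> Z" unfolding F(2)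
  proof (rule Z_sum)
    fix y assume "y \<in> F"
    then have "y \<in> ?S1 \<union> ?S2" using F(1) by (rule rev_subsetD)
    then show "smul (c y) y \<in> Z" by (rule SZ)
  qed
qed

end

text \<open>Inverting \<phi> twice with \<open>inv_into\<close> returns \<phi> only on P, so
  morphisms must be insensitive to values outside their domain.\<close>

lemma Fmor_cong:
  assumes "\<And>u. u \<in> P
    \<Longrightarrow> \<phi> u = \<psi> u" and F: "Fmor m smul G \<rho> \<phi> P Q"
  shows "Fmor m smul G \<rho> \<psi> P Q"
proof -
  have P: "subgroup P G" using F unfolding Fmor_def by blast
  have "fixpts \<rho> \<phi> P = fixpts \<rho> \<psi> P" unfolding fixpts_def using assms(1) by auto
  moreover have "Delta \<phi> P = Delta \<psi> P" unfolding Delta_def using assms(1)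
    by (auto intro!: image_cong)
  ultimately have "brauer_nz m smul G \<rho> \<phi> P = brauer_nz m smul G \<rho> \<psi> P"
    unfolding brauer_nz_def brK_def by simp
  moreover have "grp_inj G \<psi> P Q"
  proof -
    have g: "grp_inj G \<phi> P Q" using F unfolding Fmor_def by blast
    have "inj_on \<psi> P" using g inj_on_cong[of P \<phi> \<psi>] assms(1) unfolding grp_inj_def
      by blast
    moreover have "\<psi> ` P \<subseteq> Q" using g assms(1) unfolding grp_inj_def by auto
    ultimately show ?thesis using g assms(1) subgroup.m_closed[OF P] unfolding grp_inj_def by simp
  qed
  ultimately show ?thesis using F unfolding Fmor_def by simp
qed

lemma inv_into_inv_into:
  assumes "inj_on \<phi> P" "\<phi> ` P = Q" "u \<in> P"
  shows "inv_into Q (inv_into P \<phi>) u = \<phi> u"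
proof -
  have "inj_on (inv_into P \<phi>) Q" using assms(2) by (simp add: inj_on_inv_into)
  moreover have "inv_into P \<phi> (\<phi> u) = u" using assms by simp
  moreover have "\<phi> u \<in> Q" using assms by blast
  ultimately show ?thesis by (metis inv_into_f_f)
qed

theorem theorem5p11:
  fixes p :: nat and m :: "'o::idom set" and smul :: "'o \<Rightarrow> 'a::ring_1 \<Rightarrow> 'a"
    and G :: "('s, 'b) monoid_scheme" and \<rho> :: "'s \<Rightarrow> 'a"
    and \<phi> :: "'s \<Rightarrow> 's" and P Q :: "'s set"
  assumes "cl_domain p m"
    and "group G" and "finite (carrier G)" and "\<exists>n. order G = p ^ n"
    and "interior_alg smul G \<rho>"
    and "divisible m smul G \<rho>"
    and "all_twisted_units m smul G \<rho>"
    and "Fiso m smul G \<rho> \<phi> P Q"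
  shows "\<exists>a. unit_of a \<and> a \<in> fixpts \<rho> \<phi> P"
  using assms(8)
proof (induction "card P" arbitrary: \<phi> P Q rule: less_induct)
  case less
  interpret G: group G by (rule assms(2))
  have mor: "Fmor m smul G \<rho> \<phi> P Q" and im: "\<phi> ` P
    = Q" and mor': "Fmor m smul G \<rho> (inv_into P \<phi>) Q P"
    using less.prems unfolding Fiso_def by auto
  have P: "subgroup P G" and Q: "subgroup Q G" and inj: "inj_on \<phi> P"
    and hom: "\<And>u v. u \<in> P \<Longrightarrow> v \<in> P
      \<Longrightarrow> \<phi> (u \<otimes>\<^bsub>G\<^esub> v) = \<phi> u
        \<otimes>\<^bsub>G\<^esub> \<phi> v"
    using mor unfolding Fmor_def grp_inj_def by auto
  have bij: "bij_betw \<phi> P Q" using inj im unfolding bij_betw_def by blast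
  have iso': "Fiso m smul G \<rho> (inv_into P \<phi>) Q P"
    unfolding Fiso_def
  proof (intro conjI mor')
    show "inv_into P \<phi> ` Q = P" using inj im by (metis inv_into_image_cancel subset_refl)
    show "Fmor m smul G \<rho> (inv_into Q (inv_into P \<phi>)) P Q"
      by (rule Fmor_cong[OF _ mor]) (simp add: inv_into_inv_into[OF inj im])
  qed
  have finP: "finite P" using assms(3) P subgroup.subset finite_subset by metis
  obtain Y where Y: "O_basis smul Y" using assms(5) unfolding interior_alg_def by blast
  obtain n where n: "order G = p ^ n" using assms(4) by blast
  have p: "prime p" using assms(1) unfolding cl_domain_def by blast
  have "card P dvd p ^ n" using G.lagrange[OF P] n by (metis dvd_triv_right)
  then obtain k where k: "card P = p ^ k" using p divides_primepow_nat by blast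
  interpret p_group_alg m smul Y "G\<lparr>carrier := P\<rparr>" p k
  proof (intro p_group_alg.intro local_fin_alg.intro p_group_alg_axioms.intro)
    show "O_alg smul" using assms(5) unfolding interior_alg_def by blast
    show "finite Y" using Y unfolding O_basis_def by blast
    show "\<exists>c. a = (\<Sum>y\<in>Y. smul (c y) y)" for a using Y unfolding O_basis_def
      by blast
    show "ideal_in m" "1 \<notin> m" "\<And>x. x \<notin> m
      \<Longrightarrow> \<exists>y. x * y = 1" "prime p" "of_nat p \<in> m"
      using assms(1) unfolding cl_domain_def by auto
    show "Group.group (G\<lparr>carrier := P\<rparr>)" using G.subgroup_imp_group[OF P] .
    show "finite (carrier (G\<lparr>carrier := P\<rparr>))" using finP by simp
    show "order (G\<lparr>carrier := P\<rparr>) = p ^ k" using k unfolding order_def by simp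
  qed
  have \<rho>_mult: "\<rho> (s \<otimes>\<^bsub>G\<^esub> t) = \<rho> s * \<rho> t"
    if "s \<in> carrier G" "t \<in> carrier G" for s t
    using assms(5) that unfolding interior_alg_def by blast
  have \<rho>_one: "\<rho> \<one>\<^bsub>G\<^esub> = 1" using assms(5) unfolding interior_alg_def
    by blast
  have PG: "u \<in> P \<Longrightarrow> u \<in> carrier G" and \<phi>G: "u \<in> P
    \<Longrightarrow> \<phi> u \<in> carrier G" for u
    using P Q im subgroup.mem_carrier by fastforce+
  have \<phi>1: "\<phi> \<one>\<^bsub>G\<^esub> = \<one>\<^bsub>G\<^esub>"
    using hom[of "\<one>\<^bsub>G\<^esub>" "\<one>\<^bsub>G\<^esub>"] \<phi>G[of
      "\<one>\<^bsub>G\<^esub>"] subgroup.one_closed[OF P]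
    by (metis G.l_cancel_one' G.one_closed G.r_one)
  have \<alpha>: "unit_representation \<rho>" unfolding unit_representation_def
    using \<rho>_mult \<rho>_one PG by simp
  have \<beta>: "unit_representation (\<rho> \<circ> \<phi>)" unfolding unit_representation_def
    using \<rho>_mult \<rho>_one \<phi>1 \<phi>G hom by simp
  have I1: "intertw \<rho> (\<rho> \<circ> \<phi>) R = fixpts \<rho> \<phi> R" for R
    unfolding intertw_def fixpts_def by simp
  \<comment> \<open>The condition over Q is reindexed by q = \<phi> u with u in P.\<close>
  have I2: "intertw (\<rho> \<circ> \<phi>) \<rho> P = fixpts \<rho> (inv_into P \<phi>) Q"
    unfolding intertw_def fixpts_def using inj im[symmetric] by auto
  have "has_twisted_unit m smul G \<rho> \<phi> P Q"
    "has_twisted_unit m smul G \<rho> (inv_into P \<phi>) Q P"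
    using assms(7) less.prems iso' unfolding all_twisted_units_def by auto
  then obtain u u' v v' where
    u: "u \<in> fixpts \<rho> \<phi> P" "u' \<in> fixpts \<rho> (inv_into P \<phi>) Q" "u' * u - 1
      \<in> brK m smul G \<rho> (\<lambda>u. u) P"
    and v: "v \<in> fixpts \<rho> (inv_into P \<phi>) Q" "v'
      \<in> fixpts \<rho> (inv_into Q (inv_into P \<phi>)) P"
      "v' * v - 1 \<in> brK m smul G \<rho> (\<lambda>u. u) Q"
    unfolding has_twisted_unit_def by blast
  have v'P: "v' \<in> fixpts \<rho> \<phi> P" using v(2) inv_into_inv_into[OF inj im]
    unfolding fixpts_def by simp
  have uK: "u' * u - 1 \<in> brauer_ker (\<rho> \<circ> (\<lambda>u. u))"
    by (rule brK_brauer_ker[OF assms(2) P _ _ _ u(3)]) (use \<alpha> in \<open>auto simp: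
      bij_betw_def o_def\<close>)
  have vK: "v' * v - 1 \<in> brauer_ker (\<rho> \<circ> \<phi>)"
    by (rule brK_brauer_ker[OF assms(2) Q _ _ _ v(3)]) (use \<beta> bij hom in auto)
  have loc: "\<exists>a\<in>intertw \<rho> (\<rho> \<circ> \<phi>) R. \<exists>a'\<in>intertw
    (\<rho> \<circ> \<phi>) \<rho> R. a' * a = 1 \<and> a * a' = 1"
    if R: "subgroup R (G\<lparr>carrier := P\<rparr>)" "R
      \<noteq> carrier (G\<lparr>carrier := P\<rparr>)" for R
  proof -
    have RG: "subgroup R G" using G.incl_subgroup[OF P R(1)] .
    have RP: "R \<subset> P" using R subgroup.subset[OF R(1)] by auto
    \<comment> \<open>The restriction of \<phi> to R is a composite with an inclusion, hence a
      morphism. Divisibility cuts its target down to its image, and the isomorphism obtained falls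
      under the induction hypothesis.\<close>
    have "Fmor m smul G \<rho> (\<lambda>u. u) R P" using assms(6) RG P RP unfolding divisible_def
      by blast
    then have "Fmor m smul G \<rho> (\<phi> \<circ> (\<lambda>u. u)) R Q" using assms(6) mor
      unfolding divisible_def by blast
    then obtain \<psi> R'
      where \<psi>: "Fiso m smul G \<rho> \<psi> R R'"
        "\<forall>u\<in>R. (\<phi> \<circ> (\<lambda>u. u)) u = \<psi> u"
      using assms(6) unfolding divisible_def by blast
    have "card R < card P" using psubset_card_mono[OF finP RP] .
    then obtain a where a: "unit_of a" "a \<in> fixpts \<rho> \<psi> R"
      using less.hyps[OF _ \<psi>(1)] by blast
    then have aI: "a \<in> fixpts \<rho> \<phi> R" using \<psi>(2) unfolding fixpts_def by simp
    obtain a' where a': "a * a' = 1" "a' * a = 1" using a(1) unfolding unit_of_def by blast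
    have "\<rho> s * a' = a' * \<rho> (\<phi> s)" if "s \<in> R" for s
    proof -
      have "\<rho> (\<phi> s) * a = a * \<rho> s" using aI that unfolding fixpts_def by blast
      then have "a' * (\<rho> (\<phi> s) * a) * a' = a' * (a * \<rho> s) * a'" by simp
      then have "a' * \<rho> (\<phi> s) * (a * a') = (a' * a) * \<rho> s * a'"
        by (simp only: mult.assoc)
      then show ?thesis using a' by simp
    qed
    then have "a' \<in> intertw (\<rho> \<circ> \<phi>) \<rho> R" unfolding intertw_def by simp
    then show ?thesis using aI a' I1 by blast
  qed
  have "\<exists>a\<in>intertw \<rho> (\<rho> \<circ> \<phi>) (carrier (G\<lparr>carrier :=
    P\<rparr>)). unit_of a"
    by (rule twisted_unit_lift[of \<rho> "\<rho> \<circ> \<phi>" u u' v v'])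
       (use \<alpha> \<beta> u v v'P uK vK loc I1 I2 in \<open>auto simp: o_def\<close>)
  then show ?case using I1 by auto
qed

end
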